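(* For every positive integer $k$ there exist $n_k\in\mathbb{N}$ and $\delta_k\in(0,1)$ with the following property. If $W_1,\dots,W_k$ are graphons with $W_1+\cdots+W_k\le 1$ pointwise and $t(K_2,W_1+\cdots+W_k)\ge 1-\delta_k$, then for every integer $n\ge n_k$, $$\sum_{i\in[k]}t(K_{2n,2n,C_5},W_i)\ge\frac{t(K_2,W_1+\cdots+W_k)^{4n^2+5n}}{k^{4n^2+5n-1}}.$$
   Context: A graphon is a symmetric measurable $W:[0,1]^2\to[0,1]$; for a graph $H$ and a bounded symmetric measurable $W$, $t(H,W)=\int_{[0,1]^{V(H)}}\prod_{uv\in E(H)}W(x_u,x_v)\,dx_{V(H)}$; in particular $t(K_2,W)=\int_{[0,1]^2}W$. For $n\ge1$, $K_{2n,2n,C_5}$ is the graph obtained from $K_{2n,2n}$ by choosing $n$ distinct vertices $v_1,\dots,v_n$ of one part and, for each $i$, adding a new copy of $C_5$ sharing exactly the vertex $v_i$ with the rest of the graph (the added cycles are otherwise pairwise disjoint); it has $4n^2+5n$ edges. *)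

theory Defs
  imports "HOL-Analysis.Analysis" "HOL-Library.Ramsey"
begin

section \<open>Graphs\<close>

record 'a graph =
  verts :: "'a set"
  edges :: "'a set set"

definition simple_graph :: "'a graph \<Rightarrow> bool" where
  "simple_graph H \<longleftrightarrow> finite (verts H) \<and> edges H \<subseteq> [verts H]\<^bsup>2\<^esup>"

definition complete_graph :: "nat \<Rightarrow> nat graph" where
  "complete_graph m = \<lparr>verts = {..<m}, edges = [{..<m}]\<^bsup>2\<^esup>\<rparr>"

datatype vertex = Left nat | Right nat | Cyc nat nat

text \<open>The graph $K_{2n,2n,C_5}$. The parts of $K_{2n,2n}$ are the vertices \<open>Left i\<close> and
  \<open>Right j\<close> with \<open>i, j < 2 * n\<close>; the vertices $v_1,\dots,v_n$ are \<open>Left i\<close> with \<open>i < n\<close>,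
  and the 5-cycle attached to \<open>Left i\<close> is \<open>Left i, Cyc i 0, Cyc i 1, Cyc i 2, Cyc i 3\<close>.\<close>

definition K_C5 :: "nat \<Rightarrow> vertex graph" where
  "K_C5 n = \<lparr>
     verts = Left ` {..<2 * n} \<union> Right ` {..<2 * n} \<union> (\<Union>i<n. Cyc i ` {..<4}),
     edges = {{Left i, Right j} | i j. i < 2 * n \<and> j < 2 * n} \<union>
       (\<Union>i<n. {{Left i, Cyc i 0}, {Cyc i 0, Cyc i 1}, {Cyc i 1, Cyc i 2},
               {Cyc i 2, Cyc i 3}, {Cyc i 3, Left i}})\<rparr>"

lemma simple_graph_complete_graph: "simple_graph (complete_graph m)"
  by (simp add: simple_graph_def complete_graph_def)

lemma simple_graph_K_C5: "simple_graph (K_C5 n)"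
  by (auto simp: simple_graph_def K_C5_def nsets_def card_insert_if)

lemma card_edges_K_C5: "card (edges (K_C5 n)) = 4 * n\<^sup>2 + 5 * n"
proof -
  define B where "B = (\<lambda>(i, j). {Left i, Right j}) ` ({..<2 * n} \<times> {..<2 * n})"
  define C where "C = (\<lambda>i. {{Left i, Cyc i 0}, {Cyc i 0, Cyc i 1}, {Cyc i 1, Cyc i 2},
               {Cyc i 2, Cyc i 3}, {Cyc i 3, Left i}})"
  have "edges (K_C5 n) = B \<union> (\<Union>i<n. C i)"
    by (auto simp: K_C5_def B_def C_def)
  moreover have "B \<inter> (\<Union>i<n. C i) = {}"
    by (auto simp: B_def C_def doubleton_eq_iff)
  moreover have "card B = 4 * n\<^sup>2"
    unfolding B_def
    by (subst card_image) (auto simp: inj_on_def doubleton_eq_iff power2_eq_square)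
  moreover have "card (\<Union>i<n. C i) = (\<Sum>i<n. card (C i))"
    by (rule card_UN_disjoint) (auto simp: C_def doubleton_eq_iff)
  moreover have "card (C i) = 5" for i
    by (simp add: C_def doubleton_eq_iff)
  moreover have "finite B" "finite (\<Union>i<n. C i)"
    by (auto simp: B_def C_def)
  ultimately show ?thesis
    by (simp add: card_Un_disjoint)
qed


section \<open>Graphons and homomorphism densities\<close>

text \<open>Functions on the unit square are total functions on the plane; only their values on the
  unit square matter.\<close>

definition graphon :: "(real \<times> real \<Rightarrow> real) \<Rightarrow> bool" where
  "graphon W \<longleftrightarrow>
     W \<in> borel_measurable (lebesgue_on ({0..1} \<times> {0..1})) \<and>
     (\<forall>x\<in>{0..1}. \<forall>y\<in>{0..1}. W (x, y) = W (y, x) \<and> 0 \<le> W (x, y) \<and> W (x, y) \<le> 1)"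

text \<open>An arbitrary but fixed ordering of the endpoints of an edge; for symmetric \<open>W\<close> the value
  \<open>W (x u, x v)\<close> does not depend on it.\<close>

definition ends :: "'a set \<Rightarrow> 'a \<times> 'a" where
  "ends e = (SOME p. e = {fst p, snd p})"

text \<open>The homomorphism density $t(H,W)$. The product measure is completed because \<open>W\<close> is only
  assumed to be Lebesgue measurable.\<close>

definition hom_density :: "'a graph \<Rightarrow> (real \<times> real \<Rightarrow> real) \<Rightarrow> real" where
  "hom_density H W =
     (\<integral>x. (\<Prod>e\<in>edges H. case ends e of (u, v) \<Rightarrow> W (x u, x v))
        \<partial>completion (\<Pi>\<^sub>M v\<in>verts H. restrict_space lborel {0..1}))"

end

theory Submission
  imports Defs "HOL-Probability.Infinite_Product_Measure"
begin

text \<open>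
  Write $W$ for one of the graphons, $d$ for its density, $K(x,y)$ for the codegree and $c(x)$
  for the density of 5-cycles through $x$. Cauchy--Schwarz and convexity give
  $t(K_{2n,2n,C_5},W) \ge \bigl(\int\!\int \sqrt{c(x)c(y)}\,K(x,y)^{2n}\bigr)^n$, and a
  localised version in which the codegrees are counted inside a set $T$ at the price of a factor
  $|T|^{2n}$ only.

  Call $W$ rich if there is a set $S$ that is not too small, on which $c$ is bounded below and
  on which $W$ has density at least $(1+1/(2k))/k$. The localised bound with $T=S$ shows that
  for large $n$ a single rich graphon already satisfies $t(K_{2n,2n,C_5},W) \ge k^{1-4n^2-5n}$.

  If no $W_i$ is rich, then no colour is nearly absent from any set of non-negligible measure.
  For suppose that the colours in a nonempty set $J$ are nearly absent from $S$. If another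
  colour has small $c$ on a substantial part of $S$, this part, or the neighbourhood inside it
  of one of its points, must be sparse in that colour, which enlarges $J$ on a smaller set. Otherwise
  the at most $k-1$ colours outside $J$ share nearly all of $S \times S$, and one of them is
  rich. It follows that all densities $d$ are bounded below and that a point with small $c(x)$
  has small degree. Then $t(K_{2n,2n,C_5},W) \ge d^{4n^2+5n}$ for each colour: expand around the
  constant $d$. With $E=\|K-d^2\|_2^2$ and $V$ the degree variance one has $\|K\|_2^2 =
  d^4+E+2d^2V$, so the factor $K^{2n}$ gains a multiple of $n(E+V)$, while $c$ deviates from
  $d^5$ so little that $\sqrt{c(x)c(y)}$ loses only $O(E+V)$.
\<close>

section \<open>Bounded measurable functions\<close>

text \<open>Only half of the vertices of one part carry a cycle, and this makes the bound possible.
  Once the other part is mapped, n of these 2n vertices each contribute the density of the common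
  neighbourhood and n the same density weighted by c. Cauchy--Schwarz turns a pair of one vertex of
  each kind into the square of an integral with weight sqrt(c), and integrating out the other part
  produces codegree powers. The difficulty is uniformity: constants may depend on k only, while
  exponents are quadratic in n. A rich graphon gains (1 + 1/(2k))^(4n^2), so every loss must be
  exponential in O(n) only; therefore the localised bound averages over maps of the other part into
  T and keeps |T| out of the nth power. In the other case the main term has no slack, so the losses
  must be of second order and, up to a fraction of the gain, free of the factor n: a loss of order
  sqrt(E) would be too large. The weights enter through logarithms, so points with c(x) near 0 are
  treated separately: their small degree confines them to a set of measure O(V), on which codegrees
  are small too.\<close>

definition bdd_meas :: "'a measure \<Rightarrow> ('a \<Rightarrow> real) \<Rightarrow> bool" where
  "bdd_meas N f \<longleftrightarrow> f \<in> borel_measurable N \<and> (\<exists>B. \<forall>x\<in>space N. \<bar>f x\<bar> \<le> B)"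

text \<open>Closure rules that follow the syntax of an integrand. With \<open>bdd_integrable\<close>
  they settle the integrability conditions of linearity, monotonicity and Fubini structurally;
  boundedness is carried along because it survives products, unlike integrability.\<close>

named_theorems bdd

lemma bdd_measI: "f \<in> borel_measurable N \<Longrightarrow> (\<And>x. x \<in> space N \<Longrightarrow> \<bar>f x\<bar> \<le> B) \<Longrightarrow> bdd_meas N f"
  by (auto simp: bdd_meas_def)

lemma bdd_meas_measurable: "bdd_meas N f \<Longrightarrow> f \<in> borel_measurable N"
  by (auto simp: bdd_meas_def)

lemma bdd_const [bdd]: "bdd_meas N (\<lambda>x. c)"
  by (auto simp: bdd_meas_def)

lemma bdd_add [bdd]:
  assumes "bdd_meas N f" "bdd_meas N g" shows "bdd_meas N (\<lambda>x. f x + g x)"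
proof -
  obtain A B where AB: "\<forall>x\<in>space N. \<bar>f x\<bar> \<le> A" "\<forall>x\<in>space N. \<bar>g x\<bar> \<le> B"
    using assms unfolding bdd_meas_def by blast
  have [measurable]: "f \<in> borel_measurable N" "g \<in> borel_measurable N"
    using assms by (auto simp: bdd_meas_def)
  have "\<bar>f x + g x\<bar> \<le> A + B" if "x \<in> space N" for x
    using AB that abs_triangle_ineq[of "f x" "g x"] by fastforce
  then show ?thesis by (intro bdd_measI) auto
qed

lemma bdd_mult [bdd]:
  assumes "bdd_meas N f" "bdd_meas N g" shows "bdd_meas N (\<lambda>x. f x * g x)"
proof -
  obtain A B where AB: "\<forall>x\<in>space N. \<bar>f x\<bar> \<le> A" "\<forall>x\<in>space N. \<bar>g x\<bar> \<le> B"
    using assms unfolding bdd_meas_def by blast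
  have [measurable]: "f \<in> borel_measurable N" "g \<in> borel_measurable N"
    using assms by (auto simp: bdd_meas_def)
  have "\<bar>f x * g x\<bar> \<le> A * B" if "x \<in> space N" for x
    unfolding abs_mult using AB that by (intro mult_mono) (auto intro: order_trans[OF abs_ge_zero])
  then show ?thesis by (intro bdd_measI) auto
qed

lemma bdd_minus [bdd]: "bdd_meas N f \<Longrightarrow> bdd_meas N (\<lambda>x. - f x)"
  by (auto simp: bdd_meas_def)

lemma bdd_diff [bdd]: "bdd_meas N f \<Longrightarrow> bdd_meas N g \<Longrightarrow> bdd_meas N (\<lambda>x. f x - g x)"
  using bdd_add[of N f "\<lambda>x. - g x"] bdd_minus[of N g] by simp

lemma bdd_divide [bdd]: "bdd_meas N f \<Longrightarrow> bdd_meas N (\<lambda>x. f x / c)"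
  unfolding divide_inverse by (intro bdd)

lemma bdd_power [bdd]: "bdd_meas N f \<Longrightarrow> bdd_meas N (\<lambda>x. f x ^ n)"
  by (induction n) (auto intro: bdd)

lemma bdd_sum [bdd]: "(\<And>i. i \<in> I \<Longrightarrow> bdd_meas N (f i)) \<Longrightarrow> bdd_meas N (\<lambda>x. \<Sum>i\<in>I. f i x)"
  by (induction I rule: infinite_finite_induct) (auto intro: bdd)

lemma bdd_prod [bdd]: "(\<And>i. i \<in> I \<Longrightarrow> bdd_meas N (f i)) \<Longrightarrow> bdd_meas N (\<lambda>x. \<Prod>i\<in>I. f i x)"
  by (induction I rule: infinite_finite_induct) (auto intro: bdd)

lemma bdd_abs [bdd]: "bdd_meas N f \<Longrightarrow> bdd_meas N (\<lambda>x. \<bar>f x\<bar>)"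
  by (auto simp: bdd_meas_def)

lemma bdd_sqrt [bdd]:
  assumes "bdd_meas N f" shows "bdd_meas N (\<lambda>x. sqrt (f x))"
proof -
  obtain A where A: "\<forall>x\<in>space N. \<bar>f x\<bar> \<le> A"
    using assms unfolding bdd_meas_def by blast
  have [measurable]: "f \<in> borel_measurable N"
    using assms by (auto simp: bdd_meas_def)
  have "\<bar>sqrt (f x)\<bar> \<le> sqrt A" if "x \<in> space N" for x
    using A that by (metis real_sqrt_abs' real_sqrt_le_mono)
  then show ?thesis by (intro bdd_measI) auto
qed

lemma bdd_comp:
  assumes "bdd_meas N f" "g \<in> measurable L N" shows "bdd_meas L (\<lambda>x. f (g x))"
  using assms measurable_space[OF assms(2)] unfolding bdd_meas_def by auto

context prob_space
begin

lemma bdd_indicator [bdd]: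
  assumes "S \<in> events" "g \<in> measurable L M"
  shows "bdd_meas L (\<lambda>x. indicator S (g x))"
  using assms by (intro bdd_measI[where B = 1]) (auto simp: indicator_def)

lemma bdd_integrable: "bdd_meas M f \<Longrightarrow> integrable M f"
  unfolding bdd_meas_def by (auto intro!: integrable_const_bound AE_I2)

text \<open>The parameter space \<open>N\<close> is arbitrary, so the rule applies again inside
  itself and covers iterated integrals such as \<open>C5_at\<close>.\<close>

lemma bdd_integral [bdd]:
  assumes "bdd_meas (N \<Otimes>\<^sub>M M) (\<lambda>p. f (fst p) (snd p))"
  shows "bdd_meas N (\<lambda>x. \<integral>y. f x y \<partial>M)"
proof -
  obtain B where B: "\<forall>x\<in>space (N \<Otimes>\<^sub>M M). \<bar>f (fst x) (snd x)\<bar> \<le> B"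
    using assms unfolding bdd_meas_def by blast
  have [measurable]: "(\<lambda>p. f (fst p) (snd p)) \<in> borel_measurable (N \<Otimes>\<^sub>M M)"
    using assms by (auto simp: bdd_meas_def)
  have "\<bar>\<integral>y. f x y \<partial>M\<bar> \<le> \<bar>B\<bar>" if x: "x \<in> space N" for x
  proof -
    have "(\<lambda>y. f x y) \<in> borel_measurable M"
      using measurable_compose[OF measurable_Pair1'[OF x] \<open>(\<lambda>p. f (fst p) (snd p)) \<in> _\<close>] by simp
    moreover have "\<bar>f x y\<bar> \<le> \<bar>B\<bar>" if "y \<in> space M" for y
      using bspec[OF B, of "(x, y)"] x that by (auto simp: space_pair_measure)
    ultimately have "\<bar>\<integral>y. f x y \<partial>M\<bar> \<le> (\<integral>y. \<bar>B\<bar> \<partial>M)"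
      by (intro order_trans[OF integral_abs_bound] integral_mono bdd_integrable bdd)
         (auto simp: bdd_meas_def)
    then show ?thesis by (simp add: prob_space)
  qed
  moreover have "(\<lambda>x. \<integral>y. f x y \<partial>M) \<in> borel_measurable N"
    using assms by (intro borel_measurable_lebesgue_integral) (auto simp: bdd_meas_def split_beta')
  ultimately show ?thesis by (intro bdd_measI) auto
qed

lemma integral_bdd_mono:
  assumes "bdd_meas M f" "bdd_meas M g" "\<And>x. x \<in> space M \<Longrightarrow> f x \<le> g x"
  shows "(\<integral>x. f x \<partial>M) \<le> (\<integral>x. g x \<partial>M)"
  by (intro integral_mono bdd_integrable assms)

lemma integral_bdd_le:
  assumes "bdd_meas M f" "\<And>x. x \<in> space M \<Longrightarrow> f x \<le> c"
  shows "(\<integral>x. f x \<partial>M) \<le> (c::real)"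
  using integral_bdd_mono[OF assms(1) bdd_const[of _ c]] assms(2) by (simp add: prob_space)

lemma square_integral_le:
  assumes "bdd_meas M f" shows "(\<integral>x. f x \<partial>M)\<^sup>2 \<le> (\<integral>x. (f x)\<^sup>2 \<partial>M)"
proof -
  define m where "m = (\<integral>x. f x \<partial>M)"
  have "0 \<le> (\<integral>x. (f x - m)\<^sup>2 \<partial>M)" by (intro Bochner_Integration.integral_nonneg) auto
  also have "\<dots> = (\<integral>x. (f x)\<^sup>2 - 2 * m * f x + m\<^sup>2 \<partial>M)"
    by (simp add: power2_diff algebra_simps)
  also have "\<dots> = (\<integral>x. (f x)\<^sup>2 \<partial>M) - 2 * m * m + m\<^sup>2"
    by (subst Bochner_Integration.integral_add Bochner_Integration.integral_diff;
        (intro bdd_integrable bdd assms)?)+ (simp add: m_def prob_space)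
  finally show ?thesis by (simp add: m_def power2_eq_square)
qed

lemma Cauchy_Schwarz_bdd:
  assumes f: "bdd_meas M f" and g: "bdd_meas M g"
  shows "(\<integral>x. f x * g x \<partial>M)\<^sup>2 \<le> (\<integral>x. (f x)\<^sup>2 \<partial>M) * (\<integral>x. (g x)\<^sup>2 \<partial>M)"
proof -
  define A B C where "A = (\<integral>x. (g x)\<^sup>2 \<partial>M)" "B = (\<integral>x. f x * g x \<partial>M)" "C = (\<integral>x. (f x)\<^sup>2 \<partial>M)"
  have q: "0 \<le> A * t\<^sup>2 + (2 * B) * t + C" for t
  proof -
    have "0 \<le> (\<integral>x. (f x + t * g x)\<^sup>2 \<partial>M)" by (intro Bochner_Integration.integral_nonneg) auto
    also have "\<dots> = (\<integral>x. (f x)\<^sup>2 + (2 * t) * (f x * g x) + t\<^sup>2 * (g x)\<^sup>2 \<partial>M)"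
      by (simp add: power2_sum algebra_simps)
    also have "\<dots> = C + (2 * t) * B + t\<^sup>2 * A"
      by (subst Bochner_Integration.integral_add; (intro bdd_integrable bdd assms)?)+
         (simp add: A_B_C_def)
    finally show ?thesis by (simp add: algebra_simps)
  qed
  have A0: "0 \<le> A" unfolding A_B_C_def by (intro Bochner_Integration.integral_nonneg) auto
  show ?thesis
  proof (cases "A = 0")
    case True
    have "B = 0"
    proof (rule ccontr)
      assume "B \<noteq> 0"
      \<comment> \<open>This argument makes the linear polynomial 2 B t + C equal to -1.\<close>
      then show False using q[of "- (C + 1) / (2 * B)"] True by (auto simp: field_simps)
    qed
    then show ?thesis using True by (simp add: A_B_C_def)
  next
    case False
    then have "A > 0" using A0 by simp
    with q[of "- B / A"] have "B\<^sup>2 \<le> C * A"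
      by (simp add: field_simps power2_eq_square)
    then show ?thesis by (simp add: A_B_C_def mult.commute)
  qed
qed

lemma integral_indicator_prob: "S \<in> events \<Longrightarrow> (\<integral>x. indicator S x \<partial>M) = prob S"
  by (simp add: sets.Int_space_eq2)

end

text \<open>A convex power lies above its tangent at m; this is Bernoulli's inequality for a / m.
  Integrated with m at or below the mean, it serves as Jensen's inequality throughout.\<close>

lemma power_ge_tangent:
  fixes a m :: real
  assumes "0 \<le> a" "0 \<le> m"
  shows "m ^ n + real n * m ^ (n - 1) * (a - m) \<le> a ^ n"
proof (cases "m = 0")
  case True
  then show ?thesis using assms by (cases n; cases "n - 1") (auto simp: power_0_left)
next
  case False
  then have m: "m > 0" using assms by simp
  have "1 + real n * (a / m - 1) \<le> (1 + (a / m - 1)) ^ n"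
    using assms m by (intro Bernoulli_inequality) (simp add: field_simps)
  then have "m ^ n * (1 + real n * (a / m - 1)) \<le> m ^ n * (a / m) ^ n"
    using m by (intro mult_left_mono) auto
  also have "\<dots> = a ^ n" using m by (simp add: power_divide)
  also have "m ^ n * (1 + real n * (a / m - 1)) = m ^ n + real n * m ^ (n - 1) * (a - m)"
    using m by (cases n) (auto simp: field_simps)
  finally show ?thesis .
qed

locale pair_space = prob_space M for M :: "'a measure"
begin

sublocale P: pair_prob_space M M ..

lemma integral_pair:
  assumes "bdd_meas (M \<Otimes>\<^sub>M M) (\<lambda>p. f (fst p) (snd p))"
  shows "(\<integral>p. f (fst p) (snd p) \<partial>(M \<Otimes>\<^sub>M M)) = (\<integral>x. \<integral>y. f x y \<partial>M \<partial>M)"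
  using P.integral_fst'[OF P.bdd_integrable[OF assms]] by simp

lemma integral_pair_mult:
  assumes "bdd_meas M f" "bdd_meas M g"
  shows "(\<integral>p. f (fst p) * g (snd p) \<partial>(M \<Otimes>\<^sub>M M)) = (\<integral>x. f x \<partial>M) * (\<integral>x. g x \<partial>M)"
  by (subst integral_pair) (auto intro!: bdd bdd_comp[OF assms(1)] bdd_comp[OF assms(2)])

lemma integral_pair_fst: "bdd_meas M f \<Longrightarrow> (\<integral>p. f (fst p) \<partial>(M \<Otimes>\<^sub>M M)) = (\<integral>x. f x \<partial>M)"
  using integral_pair_mult[of f "\<lambda>_. 1"] by (auto simp: prob_space intro: bdd)

lemma integral_pair_snd: "bdd_meas M f \<Longrightarrow> (\<integral>p. f (snd p) \<partial>(M \<Otimes>\<^sub>M M)) = (\<integral>x. f x \<partial>M)"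
  using integral_pair_mult[of "\<lambda>_. 1" f] by (auto simp: prob_space intro: bdd)

end

section \<open>Degrees, codegrees and rooted 5-cycles\<close>

definition deg :: "'a measure \<Rightarrow> ('a \<times> 'a \<Rightarrow> real) \<Rightarrow> 'a \<Rightarrow> real" where
  "deg M W x = (\<integral>y. W (x, y) \<partial>M)"

definition codeg :: "'a measure \<Rightarrow> ('a \<times> 'a \<Rightarrow> real) \<Rightarrow> 'a \<Rightarrow> 'a \<Rightarrow> real" where
  "codeg M W x y = (\<integral>z. W (x, z) * W (y, z) \<partial>M)"

text \<open>The cycle is x, c, a, b, d with the neighbours c and d of the root integrated out: each
  gives a codegree, and ab is the edge opposite to x.\<close>

definition C5_at :: "'a measure \<Rightarrow> ('a \<times> 'a \<Rightarrow> real) \<Rightarrow> 'a \<Rightarrow> real" where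
  "C5_at M W x = (\<integral>a. \<integral>b. codeg M W x a * W (a, b) * codeg M W x b \<partial>M \<partial>M)"

definition mass :: "'a measure \<Rightarrow> ('a \<times> 'a \<Rightarrow> real) \<Rightarrow> 'a set \<Rightarrow> real" where
  "mass M W S = (\<integral>x. \<integral>y. indicator S x * indicator S y * W (x, y) \<partial>M \<partial>M)"

text \<open>Symmetry and bounds hold at every point, and measurability refers to the product
  sigma-algebra, so that sections are measurable and iterated integrals meaningful. Graphons are
  brought into this form later.\<close>

locale kernel = pair_space M for M :: "'a measure" +
  fixes W :: "'a \<times> 'a \<Rightarrow> real"
  assumes W_measurable: "W \<in> borel_measurable (M \<Otimes>\<^sub>M M)"
    and W_commute: "W (x, y) = W (y, x)"
    and W_nonneg: "0 \<le> W p"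
    and W_le_1: "W p \<le> 1"
begin

lemma bdd_W [bdd]: "bdd_meas (M \<Otimes>\<^sub>M M) W"
  using W_measurable W_nonneg W_le_1 by (intro bdd_measI[where B = 1]) (auto simp: abs_le_iff order_trans[OF _ W_nonneg])

lemma bdd_W_comp [bdd]:
  "f \<in> measurable N M \<Longrightarrow> g \<in> measurable N M \<Longrightarrow> bdd_meas N (\<lambda>z. W (f z, g z))"
  by (rule bdd_comp[OF bdd_W]) simp

lemma bdd_codeg [bdd]:
  assumes [measurable]: "f \<in> measurable N M" "g \<in> measurable N M"
  shows "bdd_meas N (\<lambda>z. codeg M W (f z) (g z))"
  unfolding codeg_def by (intro bdd; measurable)

lemma bdd_deg [bdd]:
  assumes [measurable]: "f \<in> measurable N M"
  shows "bdd_meas N (\<lambda>z. deg M W (f z))"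
  unfolding deg_def by (intro bdd; measurable)

lemma bdd_C5_at [bdd]:
  assumes [measurable]: "f \<in> measurable N M"
  shows "bdd_meas N (\<lambda>z. C5_at M W (f z))"
  unfolding C5_at_def by (intro bdd; measurable)

lemma codeg_commute: "codeg M W x y = codeg M W y x"
  by (simp add: codeg_def mult.commute)

lemma deg_nonneg: "0 \<le> deg M W x"
  unfolding deg_def by (intro Bochner_Integration.integral_nonneg W_nonneg)

lemma deg_le_1: "x \<in> space M \<Longrightarrow> deg M W x \<le> 1"
  unfolding deg_def by (intro integral_bdd_le bdd W_le_1) auto

lemma codeg_nonneg: "0 \<le> codeg M W x y"
  unfolding codeg_def by (intro Bochner_Integration.integral_nonneg mult_nonneg_nonneg W_nonneg)

lemma codeg_le_deg: "x \<in> space M \<Longrightarrow> y \<in> space M \<Longrightarrow> codeg M W x y \<le> deg M W x"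
  unfolding codeg_def deg_def
  by (intro integral_bdd_mono bdd) (auto intro: mult_right_le_one_le W_nonneg W_le_1)

lemma codeg_le_1: "x \<in> space M \<Longrightarrow> y \<in> space M \<Longrightarrow> codeg M W x y \<le> 1"
  using codeg_le_deg deg_le_1 by (rule order_trans)

lemma C5_at_nonneg: "0 \<le> C5_at M W x"
  unfolding C5_at_def
  by (intro Bochner_Integration.integral_nonneg mult_nonneg_nonneg W_nonneg codeg_nonneg)

lemma C5_at_pair:
  assumes x: "x \<in> space M"
  shows "C5_at M W x = (\<integral>p. codeg M W x (fst p) * W p * codeg M W x (snd p) \<partial>(M \<Otimes>\<^sub>M M))"
proof -
  have "(\<integral>p. codeg M W x (fst p) * W (fst p, snd p) * codeg M W x (snd p) \<partial>(M \<Otimes>\<^sub>M M)) = C5_at M W x"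
    unfolding C5_at_def using x by (intro integral_pair bdd) auto
  then show ?thesis by simp
qed

section \<open>Moments of degrees, codegrees and rooted 5-cycles\<close>

definition density :: real where "density = (\<integral>x. deg M W x \<partial>M)"
definition degree_variance :: real where
  "degree_variance = (\<integral>x. (deg M W x - density)\<^sup>2 \<partial>M)"
text \<open>Centred at the square of the density and not at the mean codegree, which exceeds it by
  \<open>degree_variance\<close>.\<close>

definition codegree_variance :: real where
  "codegree_variance = (\<integral>p. (codeg M W (fst p) (snd p) - density\<^sup>2)\<^sup>2 \<partial>(M \<Otimes>\<^sub>M M))"

lemma density_nonneg: "0 \<le> density"
  unfolding density_def by (intro Bochner_Integration.integral_nonneg deg_nonneg)

lemma density_le_1: "density \<le> 1"
  unfolding density_def by (intro integral_bdd_le bdd deg_le_1) auto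

lemma degree_variance_nonneg: "0 \<le> degree_variance"
  unfolding degree_variance_def by (intro Bochner_Integration.integral_nonneg) auto

lemma codegree_variance_nonneg: "0 \<le> codegree_variance"
  unfolding codegree_variance_def by (intro Bochner_Integration.integral_nonneg) auto

lemma integral_W: "(\<integral>p. W p \<partial>(M \<Otimes>\<^sub>M M)) = density"
proof -
  have "(\<integral>p. W (fst p, snd p) \<partial>(M \<Otimes>\<^sub>M M)) = density"
    unfolding density_def deg_def by (intro integral_pair bdd) auto
  then show ?thesis by simp
qed

lemma integral_deg_square: "(\<integral>x. (deg M W x)\<^sup>2 \<partial>M) = density\<^sup>2 + degree_variance"
proof -
  have "degree_variance = (\<integral>x. (deg M W x)\<^sup>2 - 2 * density * deg M W x + density\<^sup>2 \<partial>M)"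
    by (simp add: degree_variance_def power2_diff algebra_simps)
  also have "\<dots> = (\<integral>x. (deg M W x)\<^sup>2 \<partial>M) - 2 * density * density + density\<^sup>2"
    by (subst Bochner_Integration.integral_add Bochner_Integration.integral_diff;
        (intro bdd_integrable bdd)?; simp?)+ (simp add: density_def prob_space)
  finally show ?thesis by (simp add: power2_eq_square)
qed

text \<open>For a fixed middle vertex z the two ends are independent, and each contributes the
  degree of z.\<close>

lemma integral_codeg: "(\<integral>p. codeg M W (fst p) (snd p) \<partial>(M \<Otimes>\<^sub>M M)) = density\<^sup>2 + degree_variance"
proof -
  interpret Q: pair_sigma_finite "M \<Otimes>\<^sub>M M" M ..
  interpret Q': pair_prob_space "M \<Otimes>\<^sub>M M" M ..
  have "(\<integral>p. codeg M W (fst p) (snd p) \<partial>(M \<Otimes>\<^sub>M M)) =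
        (\<integral>p. \<integral>z. W (fst p, z) * W (snd p, z) \<partial>M \<partial>(M \<Otimes>\<^sub>M M))"
    by (simp add: codeg_def)
  also have "\<dots> = (\<integral>z. \<integral>p. W (fst p, z) * W (snd p, z) \<partial>(M \<Otimes>\<^sub>M M) \<partial>M)"
    by (rule Q.Fubini_integral[symmetric], unfold split_beta', intro Q'.P.bdd_integrable bdd) auto
  also have "\<dots> = (\<integral>z. deg M W z * deg M W z \<partial>M)"
  proof (intro Bochner_Integration.integral_cong refl)
    fix z assume z: "z \<in> space M"
    have "(\<integral>p. W (fst p, z) * W (snd p, z) \<partial>(M \<Otimes>\<^sub>M M)) = (\<integral>x. W (x, z) \<partial>M) * (\<integral>x. W (x, z) \<partial>M)"
      using z by (intro integral_pair_mult bdd) auto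
    then show "(\<integral>p. W (fst p, z) * W (snd p, z) \<partial>(M \<Otimes>\<^sub>M M)) = deg M W z * deg M W z"
      by (simp add: deg_def W_commute[of _ z])
  qed
  finally show ?thesis by (simp add: integral_deg_square flip: power2_eq_square)
qed

lemma integral_codeg_square:
  "(\<integral>p. (codeg M W (fst p) (snd p))\<^sup>2 \<partial>(M \<Otimes>\<^sub>M M)) =
    density ^ 4 + codegree_variance + 2 * density\<^sup>2 * degree_variance"
proof -
  have "codegree_variance =
    (\<integral>p. (codeg M W (fst p) (snd p))\<^sup>2 - 2 * density\<^sup>2 * codeg M W (fst p) (snd p) + density ^ 4 \<partial>(M \<Otimes>\<^sub>M M))"
    by (simp add: codegree_variance_def power2_diff algebra_simps flip: power_mult)
  also have "\<dots> = (\<integral>p. (codeg M W (fst p) (snd p))\<^sup>2 \<partial>(M \<Otimes>\<^sub>M M))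
      - 2 * density\<^sup>2 * (density\<^sup>2 + degree_variance) + density ^ 4"
    by (subst Bochner_Integration.integral_add Bochner_Integration.integral_diff;
        (intro P.bdd_integrable bdd)?; simp?)+ (simp add: integral_codeg P.prob_space)
  finally show ?thesis by (simp add: algebra_simps power4_eq_xxxx power2_eq_square)
qed

definition codeg_dev :: "'a \<Rightarrow> 'a \<Rightarrow> real" where
  "codeg_dev x y = codeg M W x y - density\<^sup>2"

lemma bdd_codeg_dev [bdd]:
  "f \<in> measurable N M \<Longrightarrow> g \<in> measurable N M \<Longrightarrow> bdd_meas N (\<lambda>z. codeg_dev (f z) (g z))"
  unfolding codeg_dev_def by (intro bdd)

lemma abs_codeg_dev_le_1: "x \<in> space M \<Longrightarrow> y \<in> space M \<Longrightarrow> \<bar>codeg_dev x y\<bar> \<le> 1"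
  using codeg_nonneg[of x y] codeg_le_1[of x y] density_nonneg density_le_1 power_le_one[of density 2]
    zero_le_power2[of density]
  unfolding codeg_dev_def abs_le_iff by linarith

text \<open>Both codegrees in \<open>C5_at\<close> are written as \<open>density\<^sup>2\<close>
  plus \<open>codeg_dev\<close>. The constant part is density^4 times the edge density, the two
  mixed terms agree by symmetry of \<open>W\<close>, and \<open>q\<close> is the quadratic part. The
  bound 1 on |q| serves to estimate q^2 by r as well.\<close>

lemma codeg_dev_decomposition:
  assumes x: "x \<in> space M"
  defines "p1 \<equiv> \<integral>a. codeg_dev x a * deg M W a \<partial>M"
    and "q \<equiv> \<integral>p. codeg_dev x (fst p) * W p * codeg_dev x (snd p) \<partial>(M \<Otimes>\<^sub>M M)"
    and "r \<equiv> \<integral>a. (codeg_dev x a)\<^sup>2 \<partial>M"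
  shows "C5_at M W x - density ^ 5 = 2 * density\<^sup>2 * p1 + q"
    and "p1\<^sup>2 \<le> r" and "\<bar>q\<bar> \<le> r" and "\<bar>q\<bar> \<le> 1"
proof -
  note x [measurable]
  have p1a: "(\<integral>p. codeg_dev x (fst p) * W (fst p, snd p) \<partial>(M \<Otimes>\<^sub>M M)) = p1"
    unfolding p1_def deg_def using x
    by (subst integral_pair) (auto intro!: bdd)
  have "(\<integral>p. codeg_dev x (snd p) * W (fst p, snd p) \<partial>(M \<Otimes>\<^sub>M M)) =
      (\<integral>p. codeg_dev x (fst p) * W (fst p, snd p) \<partial>(M \<Otimes>\<^sub>M M))"
    by (subst P.distr_pair_swap, subst integral_distr)
       (use x in \<open>auto simp: split_beta' W_commute[of "snd _"] intro!: bdd_meas_measurable bdd\<close>)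
  then have p1b: "(\<integral>p. codeg_dev x (snd p) * W (fst p, snd p) \<partial>(M \<Otimes>\<^sub>M M)) = p1"
    using p1a by simp
  have "C5_at M W x = (\<integral>p. density ^ 4 * W (fst p, snd p)
        + density\<^sup>2 * (codeg_dev x (fst p) * W (fst p, snd p))
        + density\<^sup>2 * (codeg_dev x (snd p) * W (fst p, snd p))
        + codeg_dev x (fst p) * W (fst p, snd p) * codeg_dev x (snd p) \<partial>(M \<Otimes>\<^sub>M M))"
    unfolding C5_at_pair[OF x]
    by (intro Bochner_Integration.integral_cong) (auto simp: codeg_dev_def algebra_simps power4_eq_xxxx power2_eq_square)
  also have "\<dots> = density ^ 4 * density + density\<^sup>2 * p1 + density\<^sup>2 * p1 + q"
    by (subst Bochner_Integration.integral_add;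
        (intro P.bdd_integrable bdd)?; use x in simp)+
       (use p1a p1b in \<open>simp add: integral_W q_def\<close>)
  finally show "C5_at M W x - density ^ 5 = 2 * density\<^sup>2 * p1 + q"
    by (simp add: power_Suc2[of density 4, simplified] numeral_eq_Suc)
  have "p1\<^sup>2 \<le> (\<integral>a. (codeg_dev x a * deg M W a)\<^sup>2 \<partial>M)"
    unfolding p1_def using x by (intro square_integral_le bdd) auto
  also have "\<dots> \<le> r"
    unfolding r_def using x deg_nonneg deg_le_1
    by (intro integral_bdd_mono bdd)
       (auto simp: power_mult_distrib intro!: mult_right_le_one_le power_le_one)
  finally show "p1\<^sup>2 \<le> r" .
  have b: "\<bar>codeg_dev x (fst p) * W p * codeg_dev x (snd p)\<bar> \<le> \<bar>codeg_dev x (fst p) * codeg_dev x (snd p)\<bar>"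
    for p using W_nonneg[of p] W_le_1[of p]
    by (simp add: abs_mult mult_left_le mult.assoc mult_left_mono mult_left_le_one_le)
  have bq: "bdd_meas (M \<Otimes>\<^sub>M M) (\<lambda>p. codeg_dev x (fst p) * W p * codeg_dev x (snd p))"
    using x bdd_W by (intro bdd) auto
  have b2: "bdd_meas M (\<lambda>a. (codeg_dev x a)\<^sup>2)" using x by (intro bdd) auto
  have f1: "(\<integral>p. (codeg_dev x (fst p))\<^sup>2 \<partial>(M \<Otimes>\<^sub>M M)) = r"
    unfolding r_def by (rule integral_pair_fst[OF b2])
  have f2: "(\<integral>p. (codeg_dev x (snd p))\<^sup>2 \<partial>(M \<Otimes>\<^sub>M M)) = r"
    unfolding r_def by (rule integral_pair_snd[OF b2])
  have q: "\<bar>q\<bar> \<le> (\<integral>p. \<bar>codeg_dev x (fst p) * W p * codeg_dev x (snd p)\<bar> \<partial>(M \<Otimes>\<^sub>M M))"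
    unfolding q_def by (rule integral_abs_bound)
  also have "\<dots> \<le> (\<integral>p. (codeg_dev x (fst p))\<^sup>2 / 2 + (codeg_dev x (snd p))\<^sup>2 / 2 \<partial>(M \<Otimes>\<^sub>M M))"
  proof (intro P.integral_bdd_mono)
    fix p
    have "\<bar>a * b\<bar> \<le> a\<^sup>2 / 2 + b\<^sup>2 / 2" for a b :: real
      using sum_squares_bound[of "\<bar>a\<bar>" "\<bar>b\<bar>"] by (simp add: abs_mult)
    then show "\<bar>codeg_dev x (fst p) * W p * codeg_dev x (snd p)\<bar>
      \<le> (codeg_dev x (fst p))\<^sup>2 / 2 + (codeg_dev x (snd p))\<^sup>2 / 2"
      using b[of p] order_trans by blast
  qed (use x in \<open>auto intro!: bdd bq\<close>)
  also have "\<dots> = r / 2 + r / 2"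
  proof (subst Bochner_Integration.integral_add)
  qed (use x f1 f2 in \<open>auto intro!: P.bdd_integrable bdd\<close>)
  finally show "\<bar>q\<bar> \<le> r" by simp
  have "\<bar>codeg_dev x (fst p) * codeg_dev x (snd p)\<bar> \<le> 1" if "p \<in> space (M \<Otimes>\<^sub>M M)" for p
    using that x abs_codeg_dev_le_1
    by (auto simp: abs_mult space_pair_measure intro!: mult_le_one)
  then have "(\<integral>p. \<bar>codeg_dev x (fst p) * W p * codeg_dev x (snd p)\<bar> \<partial>(M \<Otimes>\<^sub>M M)) \<le> 1"
    using order_trans[OF b] by (intro P.integral_bdd_le bdd bq) auto
  with q show "\<bar>q\<bar> \<le> 1" by simp
qed

lemma integral_codeg_dev_square:
  "(\<integral>x. \<integral>a. (codeg_dev x a)\<^sup>2 \<partial>M \<partial>M) = codegree_variance"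
  unfolding codegree_variance_def codeg_dev_def
  by (rule integral_pair[symmetric]) (intro bdd; simp)

text \<open>The constant comes from (2 d^2 p1 + q)^2 <= 2 (2 d^2 p1)^2 + 2 q^2, where the two
  squares on the right are at most 4 r and r.\<close>

lemma C5_at_variance: "(\<integral>x. (C5_at M W x - density ^ 5)\<^sup>2 \<partial>M) \<le> 10 * codegree_variance"
proof -
  have "(\<integral>x. (C5_at M W x - density ^ 5)\<^sup>2 \<partial>M) \<le> (\<integral>x. 10 * (\<integral>a. (codeg_dev x a)\<^sup>2 \<partial>M) \<partial>M)"
  proof (intro integral_bdd_mono)
    fix x assume x: "x \<in> space M"
    define p1 where "p1 = (\<integral>a. codeg_dev x a * deg M W a \<partial>M)"
    define q where "q = (\<integral>p. codeg_dev x (fst p) * W p * codeg_dev x (snd p) \<partial>(M \<Otimes>\<^sub>M M))"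
    define r where "r = (\<integral>a. (codeg_dev x a)\<^sup>2 \<partial>M)"
    note dec = codeg_dev_decomposition[OF x, folded p1_def q_def r_def]
    have "q\<^sup>2 = \<bar>q\<bar> * \<bar>q\<bar>" by (simp add: power2_eq_square)
    also have "\<dots> \<le> 1 * r" using dec by (intro mult_mono) auto
    finally have q2: "q\<^sup>2 \<le> r" by simp
    have "(2 * density\<^sup>2 * p1)\<^sup>2 = 4 * (density ^ 4 * p1\<^sup>2)"
      by (simp add: power_mult_distrib flip: power_mult)
    also have "density ^ 4 * p1\<^sup>2 \<le> 1 * r"
      using dec density_nonneg density_le_1 by (intro mult_mono power_le_one) auto
    finally have p2: "(2 * density\<^sup>2 * p1)\<^sup>2 \<le> 4 * r" by simp
    have "(2 * density\<^sup>2 * p1 + q)\<^sup>2 \<le> 2 * (2 * density\<^sup>2 * p1)\<^sup>2 + 2 * q\<^sup>2"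
      using sum_squares_bound[of "2 * density\<^sup>2 * p1" q] by (simp add: power2_sum)
    then show "(C5_at M W x - density ^ 5)\<^sup>2 \<le> 10 * (\<integral>a. (codeg_dev x a)\<^sup>2 \<partial>M)"
      unfolding dec(1) using p2 q2 by (simp add: r_def)
  qed (auto intro!: bdd)
  also have "\<dots> = 10 * codegree_variance"
    by (simp add: integral_codeg_dev_square)
  finally show ?thesis .
qed

text \<open>The mean deviation has to be of order E + V, whereas the variance bound alone would give
  the order sqrt(E). The linear term is split by deg = d + (deg - d): the part with d contributes d
  V >= 0, and the rest is a product of two deviations.\<close>

lemma integral_C5_at: "(\<integral>x. C5_at M W x - density ^ 5 \<partial>M) \<ge> - (2 * codegree_variance + degree_variance)"
proof -
  let ?R = "\<lambda>p. codeg_dev (fst p) (snd p)"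
  have d2: "density\<^sup>2 \<le> 1" using density_nonneg density_le_1 by (simp add: power_le_one)
  have "(\<integral>x. \<integral>a. codeg_dev x a * deg M W a \<partial>M \<partial>M) = (\<integral>p. ?R p * deg M W (snd p) \<partial>(M \<Otimes>\<^sub>M M))"
    by (rule integral_pair[symmetric]) (intro bdd; simp)
  also have "\<dots> \<ge> (\<integral>p. density * ?R p - ((?R p)\<^sup>2 / 2 + (deg M W (snd p) - density)\<^sup>2 / 2) \<partial>(M \<Otimes>\<^sub>M M))"
  proof (intro P.integral_bdd_mono bdd)
    fix p
    show "density * ?R p - ((?R p)\<^sup>2 / 2 + (deg M W (snd p) - density)\<^sup>2 / 2) \<le> ?R p * deg M W (snd p)"
      using sum_squares_ge_zero[of "?R p + (deg M W (snd p) - density)" 0]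
      by (simp add: power2_eq_square field_simps)
  qed auto
  also have "(\<integral>p. density * ?R p - ((?R p)\<^sup>2 / 2 + (deg M W (snd p) - density)\<^sup>2 / 2) \<partial>(M \<Otimes>\<^sub>M M)) =
     density * degree_variance - (codegree_variance / 2 + degree_variance / 2)"
  proof -
    have "(\<integral>p. ?R p \<partial>(M \<Otimes>\<^sub>M M)) = degree_variance"
      unfolding codeg_dev_def
      by (subst Bochner_Integration.integral_diff)
         (auto simp: integral_codeg P.prob_space intro!: P.bdd_integrable bdd)
    moreover have "(\<integral>p. (?R p)\<^sup>2 \<partial>(M \<Otimes>\<^sub>M M)) = codegree_variance"
      by (simp add: codegree_variance_def codeg_dev_def)
    moreover have "(\<integral>p. (deg M W (snd p) - density)\<^sup>2 \<partial>(M \<Otimes>\<^sub>M M)) = degree_variance"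
      unfolding degree_variance_def by (rule integral_pair_snd) (intro bdd; simp)
    ultimately show ?thesis
      by (subst Bochner_Integration.integral_diff Bochner_Integration.integral_add;
          (intro P.bdd_integrable bdd)?; simp?)+
  qed
  finally have p1: "(\<integral>x. \<integral>a. codeg_dev x a * deg M W a \<partial>M \<partial>M)
      \<ge> - (codegree_variance + degree_variance) / 2"
    using mult_nonneg_nonneg[OF density_nonneg degree_variance_nonneg] by (simp add: field_simps)
  have "(\<integral>x. 2 * density\<^sup>2 * (\<integral>a. codeg_dev x a * deg M W a \<partial>M)
        - (\<integral>a. (codeg_dev x a)\<^sup>2 \<partial>M) \<partial>M) \<le> (\<integral>x. C5_at M W x - density ^ 5 \<partial>M)"
    using codeg_dev_decomposition(1,3) by (intro integral_bdd_mono bdd) (fastforce simp: abs_le_iff)+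
  also have "(\<integral>x. 2 * density\<^sup>2 * (\<integral>a. codeg_dev x a * deg M W a \<partial>M)
        - (\<integral>a. (codeg_dev x a)\<^sup>2 \<partial>M) \<partial>M) =
     2 * density\<^sup>2 * (\<integral>x. \<integral>a. codeg_dev x a * deg M W a \<partial>M \<partial>M) - codegree_variance"
    by (subst Bochner_Integration.integral_diff)
       (auto simp: integral_codeg_dev_square intro!: bdd_integrable bdd)
  moreover have "density\<^sup>2 * (- (codegree_variance + degree_variance))
      \<le> density\<^sup>2 * (2 * (\<integral>x. \<integral>a. codeg_dev x a * deg M W a \<partial>M \<partial>M))"
    using p1 by (intro mult_left_mono) auto
  moreover have "density\<^sup>2 * (codegree_variance + degree_variance) \<le> codegree_variance + degree_variance"
    using d2 degree_variance_nonneg codegree_variance_nonneg by (intro mult_left_le_one_le) auto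
  ultimately show ?thesis by (simp add: algebra_simps)
qed

end

section \<open>Codegrees weighted by rooted 5-cycles\<close>

text \<open>The factor s is absorbed in the power: with z = s^(1/n) g one has s g^n = z^n >= 1 + n
  (z - 1) and s^(1/n) >= 1 + ln s / n. So the weight s enters only through ln s, without a factor n,
  while g - 1 is multiplied by n.\<close>

lemma mult_power_ge_ln:
  fixes s g :: real
  assumes "s > 0" "g \<ge> 0" "n > 0"
  shows "1 + real n * (g - 1) + g * ln s \<le> s * g ^ n"
proof -
  define z where "z = exp (ln s / n) * g"
  have "g * (1 + ln s / n) \<le> z"
    unfolding z_def using assms exp_ge_add_one_self[of "ln s / n"]
    by (subst mult.commute) (intro mult_right_mono; simp)
  then have "real n * (g * (1 + ln s / n)) \<le> real n * z"
    by (intro mult_left_mono) auto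
  moreover have "real n * (g * (1 + ln s / n)) = real n * g + g * ln s"
    using assms by (simp add: distrib_left)
  ultimately have "1 + real n * (g - 1) + g * ln s \<le> 1 + real n * (z - 1)"
    by (simp add: algebra_simps)
  also have "\<dots> \<le> (1 + (z - 1)) ^ n"
    using assms by (intro Bernoulli_inequality) (simp add: z_def)
  also have "\<dots> = s * g ^ n"
    using assms by (simp add: z_def power_mult_distrib flip: exp_of_nat_mult)
  finally show ?thesis .
qed

text \<open>From ln(1 + t) >= t / (1 + t) = t - t^2 / (1 + t); the lower bound on 1 + t keeps the
  coefficient of the quadratic error bounded.\<close>

lemma ln_ge_quadratic:
  fixes t :: real
  assumes "\<eta> > 0" "1 + t \<ge> \<eta>"
  shows "t - t\<^sup>2 / \<eta> \<le> ln (1 + t)"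
proof -
  have "1 + t > 0" using assms by linarith
  have "t - t\<^sup>2 / \<eta> \<le> t - t\<^sup>2 / (1 + t)"
    using assms by (simp add: divide_left_mono)
  also have "\<dots> = t / (1 + t)"
    using \<open>1 + t > 0\<close> by (simp add: field_simps power2_eq_square)
  also have "\<dots> = 1 - inverse (1 + t)"
    using \<open>1 + t > 0\<close> by (simp add: field_simps)
  also have "\<dots> \<le> ln (1 + t)"
    using ln_le_minus_one[of "inverse (1 + t)"] \<open>1 + t > 0\<close> by (simp add: ln_inverse)
  finally show ?thesis .
qed

lemma ln_square_le:
  fixes t :: real
  assumes "0 < \<eta>" "\<eta> \<le> 1" "1 + t \<ge> \<eta>"
  shows "(ln (1 + t))\<^sup>2 \<le> t\<^sup>2 / \<eta>\<^sup>2"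
proof -
  have p: "1 + t > 0" using assms by linarith
  have "ln (1 + t) \<le> t" using ln_add_one_self_le_self2[of t] p by simp
  also have "\<dots> \<le> \<bar>t\<bar> / \<eta>"
    using assms mult_left_le[of \<eta> "\<bar>t\<bar>"] mult_right_mono[of t "\<bar>t\<bar>" \<eta>]
    unfolding pos_le_divide_eq[OF \<open>0 < \<eta>\<close>] by linarith
  finally have u: "ln (1 + t) \<le> \<bar>t\<bar> / \<eta>" .
  have "- ln (1 + t) \<le> inverse (1 + t) - 1"
    using ln_le_minus_one[of "inverse (1 + t)"] p by (simp add: ln_inverse)
  also have "\<dots> = - t / (1 + t)" using p by (simp add: field_simps)
  also have "\<dots> \<le> \<bar>t\<bar> / (1 + t)" using p by (intro divide_right_mono) auto
  also have "\<dots> \<le> \<bar>t\<bar> / \<eta>" using assms p by (intro divide_left_mono) auto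
  finally have "\<bar>ln (1 + t)\<bar> \<le> \<bar>t\<bar> / \<eta>" using u by linarith
  then have "\<bar>ln (1 + t)\<bar>\<^sup>2 \<le> (\<bar>t\<bar> / \<eta>)\<^sup>2" by (intro power_mono) auto
  then show ?thesis by (simp add: power_divide)
qed

context kernel
begin

text \<open>Everything is normalised by the values for a constant kernel: g is the relative codegree
  and 1 + \<gamma> the relative 5-cycle density. Apart from the indicators the left-hand side is
  polynomial in them, so its integral can be estimated by E and V. The indicator term makes it
  negative as soon as one point lies in \<open>B\<close>, where the logarithm of the weight is not
  bounded below.\<close>

lemma weighted_codeg_power_ge_pointwise:
  fixes x y :: 'a and \<eta> :: real and n :: nat
  assumes xy: "x \<in> space M" "y \<in> space M"
    and d: "density > 0" and \<eta>: "0 < \<eta>" "\<eta> \<le> 1" and n: "n > 0"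
  defines "B \<equiv> {x \<in> space M. C5_at M W x < \<eta>}"
    and "\<gamma> \<equiv> \<lambda>x. C5_at M W x / density ^ 5 - 1"
    and "g \<equiv> codeg M W x y / density\<^sup>2"
  shows "1 + real n * (g\<^sup>2 - 1) - (indicator B x + indicator B y) * (2 + real n * g\<^sup>2) - (g\<^sup>2 - 1)\<^sup>2
        + ((\<gamma> x + \<gamma> y) - ((\<gamma> x)\<^sup>2 + (\<gamma> y)\<^sup>2) * (2 / \<eta>\<^sup>2)) / 2
      \<le> sqrt (C5_at M W x) * sqrt (C5_at M W y) * codeg M W x y ^ (2 * n) / density ^ (4 * n + 5)"
proof -
  have \<gamma>_pos: "\<gamma> z \<ge> -1" for z
    using C5_at_nonneg[of z] d by (simp add: \<gamma>_def)
  have g0: "g \<ge> 0" using codeg_nonneg d by (simp add: g_def)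
  have e1: "1 / \<eta> \<le> 1 / \<eta>\<^sup>2" "1 \<le> 1 / \<eta>\<^sup>2"
    using \<eta> by (auto simp: field_simps power2_eq_square mult_le_one)
  have le1: "t - t\<^sup>2 * (2 / \<eta>\<^sup>2) \<le> 1" for t :: real
  proof -
    have "t \<le> 1 + t\<^sup>2 * 1"
      using sum_squares_bound[of t 1] zero_le_power2[of t] unfolding power_one by linarith
    also have "t\<^sup>2 * 1 \<le> t\<^sup>2 * (2 / \<eta>\<^sup>2)" using e1 by (intro mult_left_mono) auto
    finally show ?thesis by simp
  qed
  show ?thesis
  proof (cases "x \<in> B \<or> y \<in> B")
    case True
    then have i: "1 \<le> indicator B x + (indicator B y :: real)" by (auto simp: indicator_def)
    \<comment> \<open>Once the indicators sum to at least 1, the terms n g^2 cancel in the upper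
      bound; as each \<gamma>-part is at most 1, the total is at most -n.\<close>
    have "1 + real n * (g\<^sup>2 - 1) - (indicator B x + indicator B y) * (2 + real n * g\<^sup>2) - (g\<^sup>2 - 1)\<^sup>2
        + ((\<gamma> x + \<gamma> y) - ((\<gamma> x)\<^sup>2 + (\<gamma> y)\<^sup>2) * (2 / \<eta>\<^sup>2)) / 2
        \<le> 1 + real n * (g\<^sup>2 - 1) - 1 * (2 + real n * g\<^sup>2) - 0 + (1 + 1) / 2"
      using le1[of "\<gamma> x"] le1[of "\<gamma> y"] i
      by (intro add_mono diff_mono divide_right_mono mult_right_mono order_refl)
         (auto simp: algebra_simps)
    also have "\<dots> \<le> 0" using n by (simp add: algebra_simps)
    also have "\<dots> \<le> sqrt (C5_at M W x) * sqrt (C5_at M W y) * codeg M W x y ^ (2 * n) / density ^ (4 * n + 5)"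
      using C5_at_nonneg codeg_nonneg d by (intro divide_nonneg_nonneg mult_nonneg_nonneg) auto
    finally show ?thesis .
  next
    case False
    then have c: "C5_at M W x \<ge> \<eta>" "C5_at M W y \<ge> \<eta>" using xy by (auto simp: B_def)
    have "density ^ 5 \<le> 1" using d density_le_1 by (simp add: power_le_one)
    then have "\<eta> * density ^ 5 \<le> \<eta>" using \<eta> by (intro mult_left_le) auto
    then have c5: "C5_at M W z \<ge> \<eta> \<Longrightarrow> 1 + \<gamma> z \<ge> \<eta>" for z
      using d by (simp add: \<gamma>_def le_divide_eq)
    \<comment> \<open>The root halves the logarithm l. In l g^2 = l + l (g^2 - 1), AM-GM moves the
      cross term into l^2 / 4 and (g^2 - 1)^2; the points x and y each pay half of the
      latter.\<close>
    have ln_half: "ln (sqrt (1 + \<gamma> z)) * g\<^sup>2 \<ge>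
      (\<gamma> z - (\<gamma> z)\<^sup>2 * (2 / \<eta>\<^sup>2)) / 2 - (g\<^sup>2 - 1)\<^sup>2 / 2" if "C5_at M W z \<ge> \<eta>" for z
    proof -
      define l where "l = ln (1 + \<gamma> z)"
      have "\<gamma> z - (\<gamma> z)\<^sup>2 / \<eta> \<le> l" "l\<^sup>2 \<le> (\<gamma> z)\<^sup>2 / \<eta>\<^sup>2"
        unfolding l_def using ln_ge_quadratic[of \<eta> "\<gamma> z"] ln_square_le[of \<eta> "\<gamma> z"] c5[OF that] \<eta> by auto
      moreover have "(\<gamma> z)\<^sup>2 / \<eta> \<le> (\<gamma> z)\<^sup>2 / \<eta>\<^sup>2"
        using mult_left_mono[OF e1(1), of "(\<gamma> z)\<^sup>2"] by simp
      moreover have "l * (g\<^sup>2 - 1) \<ge> - (l\<^sup>2 / 4) - (g\<^sup>2 - 1)\<^sup>2"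
        using zero_le_power2[of "l / 2 + (g\<^sup>2 - 1)"] by (simp add: power2_sum power_divide del: zero_le_power2)
      moreover have "l * g\<^sup>2 = l + l * (g\<^sup>2 - 1)" by (simp add: algebra_simps)
      moreover have "0 \<le> (\<gamma> z)\<^sup>2 / \<eta>\<^sup>2" by simp
      ultimately have lg: "l * g\<^sup>2 \<ge> \<gamma> z - 2 * ((\<gamma> z)\<^sup>2 / \<eta>\<^sup>2) - (g\<^sup>2 - 1)\<^sup>2" by linarith
      have e1: "ln (sqrt (1 + \<gamma> z)) * g\<^sup>2 = l * g\<^sup>2 / 2"
        using \<eta> c5[OF that] by (simp add: l_def ln_sqrt)
      have e2: "(\<gamma> z)\<^sup>2 * (2 / \<eta>\<^sup>2) = 2 * ((\<gamma> z)\<^sup>2 / \<eta>\<^sup>2)" by simp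
      show ?thesis unfolding e1 e2 diff_divide_distrib[symmetric] using lg by (intro divide_right_mono) auto
    qed
    define s where "s = sqrt (1 + \<gamma> x) * sqrt (1 + \<gamma> y)"
    have p: "1 + \<gamma> x > 0" "1 + \<gamma> y > 0" using \<eta> c5 c by fastforce+
    \<comment> \<open>The codegree power 2n is read as the nth power of g^2, whose mean is known
      from the second moment of the codegree.\<close>
    have "1 + real n * (g\<^sup>2 - 1) + g\<^sup>2 * ln s \<le> s * (g\<^sup>2) ^ n"
      using p n by (intro mult_power_ge_ln) (auto simp: s_def)
    moreover have "ln s = ln (sqrt (1 + \<gamma> x)) + ln (sqrt (1 + \<gamma> y))"
      using p by (simp add: s_def ln_mult)
    moreover have "s * (g\<^sup>2) ^ n = sqrt (C5_at M W x) * sqrt (C5_at M W y) * codeg M W x y ^ (2 * n) / density ^ (4 * n + 5)"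
      using d by (simp add: s_def g_def \<gamma>_def real_sqrt_divide power_add power_divide power_mult
        flip: power_mult)
    ultimately show ?thesis
      using False ln_half[OF c(1)] ln_half[OF c(2)]
      by (simp add: algebra_simps add_divide_distrib diff_divide_distrib)
  qed
qed

text \<open>The pointwise bound is integrated. A point with small c has degree at most d^2/3 <= d/3,
  so it can be charged to the degree variance: its indicator is at most 9/(4 d^2) times (deg - d)^2.
  Its codegrees are at most d^2/3 too, which limits the part of the penalty that grows with n to n
  V/(2 d^2), a quarter of the gain 2 n V/d^2.\<close>

lemma weighted_codeg_power_ge:
  assumes d: "density > 0" and \<eta>: "0 < \<eta>" "\<eta> \<le> 1" and n: "40 / (\<eta>\<^sup>2 * density ^ 10) \<le> real n"
    and low: "\<And>x. x \<in> space M \<Longrightarrow> C5_at M W x < \<eta> \<Longrightarrow> deg M W x \<le> density\<^sup>2 / 3"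
  shows "density ^ (4 * n + 5) \<le>
    (\<integral>p. sqrt (C5_at M W (fst p)) * sqrt (C5_at M W (snd p)) * codeg M W (fst p) (snd p) ^ (2 * n) \<partial>(M \<Otimes>\<^sub>M M))"
proof -
  define B where "B = {x \<in> space M. C5_at M W x < \<eta>}"
  define \<gamma> where "\<gamma> = (\<lambda>x. C5_at M W x / density ^ 5 - 1)"
  define v where "v = (\<lambda>x. (deg M W x - density)\<^sup>2)"
  define d where "d = density"
  define E V where "E = codegree_variance" and "V = degree_variance"
  \<comment> \<open>\<open>u\<close> dominates every power of 1/d that occurs, so all other losses
    become multiples of u E and u V.\<close>
  define u where "u = 1 / (\<eta>\<^sup>2 * d ^ 10)"
  have d01: "0 < d" "d \<le> 1" using assms density_le_1 by (auto simp: d_def)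
  have EV: "0 \<le> E" "0 \<le> V" using codegree_variance_nonneg degree_variance_nonneg by (auto simp: E_def V_def)
  have \<eta>2: "1 \<le> 1 / \<eta>\<^sup>2" using \<eta> by (simp add: power_le_one)
  have du: "1 / d ^ k \<le> u" if "k \<le> 10" for k
  proof -
    have "1 / d ^ k \<le> 1 / d ^ 10"
      using d01 that by (intro divide_left_mono power_decreasing) auto
    also have "\<dots> \<le> 1 / \<eta>\<^sup>2 * (1 / d ^ 10)"
      using mult_right_mono[OF \<eta>2, of "1 / d ^ 10"] d01 by simp
    finally show ?thesis by (simp add: u_def)
  qed
  have n0: "n > 0"
  proof -
    have "0 < 40 / (\<eta>\<^sup>2 * density ^ 10)" using assms by simp
    then show ?thesis using n by linarith
  qed
  let ?K = "\<lambda>p. codeg M W (fst p) (snd p)"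
  let ?I = "\<lambda>f. integral\<^sup>L (M \<Otimes>\<^sub>M M) f"
  have bv: "bdd_meas M v" and b\<gamma>: "bdd_meas M \<gamma>" unfolding v_def \<gamma>_def by (intro bdd; simp)+
  have b\<gamma>2: "bdd_meas M (\<lambda>x. (\<gamma> x)\<^sup>2)" by (intro bdd b\<gamma>)
  have Iv: "(\<integral>x. v x \<partial>M) = V" by (simp add: v_def V_def degree_variance_def)
  have I\<gamma>: "(\<integral>x. \<gamma> x \<partial>M) \<ge> - (2 * E + V) / d ^ 5"
  proof -
    have "\<gamma> = (\<lambda>x. (C5_at M W x - d ^ 5) / d ^ 5)" using d01 by (auto simp: \<gamma>_def d_def diff_divide_distrib)
    then have "(\<integral>x. \<gamma> x \<partial>M) = (\<integral>x. C5_at M W x - d ^ 5 \<partial>M) / d ^ 5" by simp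
    then show ?thesis using integral_C5_at d01 by (simp add: E_def V_def d_def divide_right_mono)
  qed
  have I\<gamma>2: "(\<integral>x. (\<gamma> x)\<^sup>2 \<partial>M) \<le> 10 * E / d ^ 10"
  proof -
    have "(\<lambda>x. (\<gamma> x)\<^sup>2) = (\<lambda>x. (C5_at M W x - d ^ 5)\<^sup>2 / d ^ 10)"
      using d01 by (auto simp: \<gamma>_def d_def power_divide diff_divide_distrib[symmetric] divide_diff_eq_iff
         simp flip: power_mult)
    then have "(\<integral>x. (\<gamma> x)\<^sup>2 \<partial>M) = (\<integral>x. (C5_at M W x - d ^ 5)\<^sup>2 \<partial>M) / d ^ 10" by simp
    then show ?thesis using C5_at_variance d01 by (simp add: E_def d_def divide_right_mono)
  qed
  define f1 where "f1 = (\<lambda>p. 1 + real n * ((?K p)\<^sup>2 / d ^ 4 - 1))"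
  define f2 where "f2 = (\<lambda>p. (9 / (4 * d\<^sup>2) * (2 + real n / 9)) * (v (fst p) + v (snd p)))"
  define f3 where "f3 = (\<lambda>p. 4 / d ^ 8 * (?K p - d\<^sup>2)\<^sup>2)"
  define f4 where "f4 = (\<lambda>p. (\<gamma> (fst p) + \<gamma> (snd p)) / 2)"
  define f5 where "f5 = (\<lambda>p. ((\<gamma> (fst p))\<^sup>2 + (\<gamma> (snd p))\<^sup>2) / \<eta>\<^sup>2)"
  have bf: "bdd_meas (M \<Otimes>\<^sub>M M) f1" "bdd_meas (M \<Otimes>\<^sub>M M) f2" "bdd_meas (M \<Otimes>\<^sub>M M) f3"
    "bdd_meas (M \<Otimes>\<^sub>M M) f4" "bdd_meas (M \<Otimes>\<^sub>M M) f5"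
    unfolding f1_def f2_def f3_def f4_def f5_def
    by (intro bdd bdd_comp[OF bv] bdd_comp[OF b\<gamma>]; simp)+
  note intf = bf[THEN P.bdd_integrable]
  have "?I f1 = 1 + real n * (?I (\<lambda>p. (?K p)\<^sup>2) / d ^ 4 - 1)"
  proof -
    have i: "integrable (M \<Otimes>\<^sub>M M) (\<lambda>p. (?K p)\<^sup>2)"
      by (intro P.bdd_integrable bdd) auto
    show ?thesis unfolding f1_def using i by (simp add: P.prob_space)
  qed
  also have "\<dots> = 1 + real n * (E / d ^ 4 + 2 * V / d\<^sup>2)"
    using d01 unfolding integral_codeg_square
    by (simp add: E_def V_def d_def field_simps power4_eq_xxxx power2_eq_square)
  finally have I1: "?I f1 = 1 + real n * (E / d ^ 4 + 2 * V / d\<^sup>2)" .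
  have I2: "?I f2 = 9 / (4 * d\<^sup>2) * (2 + real n / 9) * (2 * V)"
  proof -
    have "?I (\<lambda>p. v (fst p) + v (snd p)) = 2 * V"
      by (subst Bochner_Integration.integral_add)
         (auto simp: integral_pair_fst[OF bv] integral_pair_snd[OF bv] Iv
           intro!: P.bdd_integrable bdd_comp[OF bv])
    then show ?thesis unfolding f2_def by simp
  qed
  have I3: "?I f3 = 4 / d ^ 8 * E"
    unfolding f3_def by (simp add: E_def codegree_variance_def d_def)
  have I4: "?I f4 = (\<integral>x. \<gamma> x \<partial>M)"
  proof -
    have "?I (\<lambda>p. \<gamma> (fst p) + \<gamma> (snd p)) = 2 * (\<integral>x. \<gamma> x \<partial>M)"
      by (subst Bochner_Integration.integral_add)
         (auto simp: integral_pair_fst[OF b\<gamma>] integral_pair_snd[OF b\<gamma>]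
           intro!: P.bdd_integrable bdd_comp[OF b\<gamma>])
    then show ?thesis unfolding f4_def by simp
  qed
  have I5: "?I f5 = 2 * (\<integral>x. (\<gamma> x)\<^sup>2 \<partial>M) / \<eta>\<^sup>2"
  proof -
    have "?I (\<lambda>p. (\<gamma> (fst p))\<^sup>2 + (\<gamma> (snd p))\<^sup>2) = 2 * (\<integral>x. (\<gamma> x)\<^sup>2 \<partial>M)"
      by (subst Bochner_Integration.integral_add)
         (auto simp: integral_pair_fst[OF b\<gamma>2] integral_pair_snd[OF b\<gamma>2]
           intro!: P.bdd_integrable bdd_comp[OF b\<gamma>2])
    then show ?thesis unfolding f5_def by simp
  qed
  have "1 \<le> ?I f1 - ?I f2 - ?I f3 + ?I f4 - ?I f5"
  proof -
    \<comment> \<open>The losses amount to 4 + 2 + 20 multiples of uE and, besides nV / 2, to 9 + 1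
      multiples of uV; the factor 40 covers them.\<close>
    have arith: "1 \<le> 1 + (nE + 2 * nV) - (9 * V2 + nV / 2) - 4 * E8 + \<Gamma> - \<Gamma>2"
      if "40 * uE \<le> nE" "40 * uV \<le> nV" "0 \<le> uE" "0 \<le> uV" "V2 \<le> uV" "E8 \<le> uE"
        "E5 \<le> uE" "V5 \<le> uV" "- 2 * E5 - V5 \<le> \<Gamma>" "\<Gamma>2 \<le> 20 * uE"
      for nE nV uE uV V2 E8 E5 V5 \<Gamma> \<Gamma>2 :: real
      using that by linarith
    have nu: "40 * u \<le> n" using n by (simp add: u_def d_def)
    have "E \<le> E / d ^ 4" "V \<le> V / d\<^sup>2"
      using EV d01 by (auto simp: le_divide_eq mult_left_le power_le_one)
    then have n40: "40 * (u * E) \<le> n * (E / d ^ 4)" "40 * (u * V) \<le> n * (V / d\<^sup>2)"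
      unfolding mult.assoc[symmetric] using nu EV by (intro mult_mono; simp)+
    have u_bounds: "V / d\<^sup>2 \<le> u * V" "E / d ^ 8 \<le> u * E" "E / d ^ 5 \<le> u * E" "V / d ^ 5 \<le> u * V"
      using mult_right_mono[OF du[of 2] EV(2)] mult_right_mono[OF du[of 8] EV(1)]
        mult_right_mono[OF du[of 5] EV(1)] mult_right_mono[OF du[of 5] EV(2)] by simp_all
    have \<Gamma>2: "2 * (\<integral>x. (\<gamma> x)\<^sup>2 \<partial>M) / \<eta>\<^sup>2 \<le> 20 * (u * E)"
    proof -
      have "2 * (\<integral>x. (\<gamma> x)\<^sup>2 \<partial>M) / \<eta>\<^sup>2 \<le> 2 * (10 * E / d ^ 10) / \<eta>\<^sup>2"
        using I\<gamma>2 by (intro divide_right_mono mult_left_mono) auto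
      then show ?thesis by (simp add: u_def mult.commute)
    qed
    have \<Gamma>: "- 2 * (E / d ^ 5) - V / d ^ 5 \<le> (\<integral>x. \<gamma> x \<partial>M)"
      using I\<gamma> by (simp add: diff_divide_distrib)
    have u0: "0 \<le> u * E" "0 \<le> u * V" using EV by (auto simp: u_def)
    have eqs: "9 / (4 * d\<^sup>2) * (2 + real n / 9) * (2 * V) = 9 * (V / d\<^sup>2) + n * (V / d\<^sup>2) / 2"
      "4 / d ^ 8 * E = 4 * (E / d ^ 8)"
      "1 + real n * (E / d ^ 4 + 2 * V / d\<^sup>2) = 1 + (n * (E / d ^ 4) + 2 * (n * (V / d\<^sup>2)))"
      using d01 by (simp_all add: field_simps)
    show ?thesis
      unfolding I1 I2 I3 I4 I5 eqs
      by (rule arith[OF n40 u0 u_bounds \<Gamma> \<Gamma>2])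
  qed
  also have "\<dots> = ?I (\<lambda>p. f1 p - f2 p - f3 p + f4 p - f5 p)"
    using intf by simp
  also have "\<dots> \<le> ?I (\<lambda>p. sqrt (C5_at M W (fst p)) * sqrt (C5_at M W (snd p)) * ?K p ^ (2 * n) / d ^ (4 * n + 5))"
  proof (intro P.integral_bdd_mono)
    fix p assume "p \<in> space (M \<Otimes>\<^sub>M M)"
    then have xy: "fst p \<in> space M" "snd p \<in> space M" by (auto simp: space_pair_measure)
    define g where "g = ?K p / d\<^sup>2"
    have B_v: "indicator B x \<le> 9 / (4 * d\<^sup>2) * v x" if "x \<in> space M" for x
    proof (cases "x \<in> B")
      case True
      then have "deg M W x \<le> d\<^sup>2 / 3" using low by (auto simp: B_def d_def)
      also have "d\<^sup>2 \<le> d" using d01 by (simp add: power2_eq_square mult_left_le)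
      finally have "(2 * d / 3)\<^sup>2 \<le> (d - deg M W x)\<^sup>2" using d01 by (intro power_mono) auto
      then show ?thesis using True d01 by (simp add: v_def d_def power2_commute field_simps)
    qed (simp add: v_def)
    have g_B: "g\<^sup>2 \<le> 1 / 9" if "fst p \<in> B \<or> snd p \<in> B"
    proof -
      have "?K p \<le> d\<^sup>2 / 3"
        using that xy low codeg_le_deg[of "fst p" "snd p"] codeg_le_deg[of "snd p" "fst p"]
        by (force simp: B_def d_def codeg_commute[of "fst p"])
      then have "g \<le> 1 / 3" using d01 by (simp add: g_def field_simps)
      then have "g\<^sup>2 \<le> (1 / 3)\<^sup>2" using codeg_nonneg by (intro power_mono) (auto simp: g_def)
      then show ?thesis by (simp add: power_divide)
    qed
    have "(indicator B (fst p) + indicator B (snd p)) * (2 + n * g\<^sup>2)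
      \<le> (indicator B (fst p) + indicator B (snd p)) * (2 + n / 9)"
    proof (cases "fst p \<in> B \<or> snd p \<in> B")
      case True
      have "n * g\<^sup>2 \<le> n * (1 / 9)" by (intro mult_left_mono g_B True) simp
      then show ?thesis by (intro mult_left_mono) auto
    qed simp
    also have "\<dots> \<le> (9 / (4 * d\<^sup>2) * v (fst p) + 9 / (4 * d\<^sup>2) * v (snd p)) * (2 + n / 9)"
      using B_v xy by (intro mult_right_mono add_mono) auto
    also have "\<dots> = f2 p" by (simp only: f2_def distrib_left distrib_right mult_ac)
    finally have f2: "(indicator B (fst p) + indicator B (snd p)) * (2 + n * g\<^sup>2) \<le> f2 p" .
    \<comment> \<open>Factor g^2 - 1 = (g - 1)(g + 1); codegrees at most 1 give g + 1 <= 2 / d^2,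
      whence the coefficient 4 / d^8.\<close>
    have f3: "(g\<^sup>2 - 1)\<^sup>2 \<le> f3 p"
    proof -
      have "g \<le> 1 / d\<^sup>2" "1 \<le> 1 / d\<^sup>2" "0 \<le> g"
        using codeg_nonneg codeg_le_1 xy d01 by (auto simp: g_def divide_right_mono power_le_one)
      then have "(g + 1)\<^sup>2 \<le> (2 / d\<^sup>2)\<^sup>2" by (intro power_mono) auto
      also have "\<dots> = 4 / d ^ 4" by (simp add: power_divide flip: power_mult)
      finally have "(g - 1)\<^sup>2 * (g + 1)\<^sup>2 \<le> (g - 1)\<^sup>2 * (4 / d ^ 4)" by (intro mult_left_mono) auto
      moreover have "g - 1 = (?K p - d\<^sup>2) / d\<^sup>2" using d01 by (simp add: g_def diff_divide_distrib)
      then have "(g - 1)\<^sup>2 = (?K p - d\<^sup>2)\<^sup>2 / d ^ 4" by (simp add: power_divide flip: power_mult)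
      then have "(g - 1)\<^sup>2 * (4 / d ^ 4) = f3 p" by (simp add: f3_def flip: power_add)
      moreover have "(g\<^sup>2 - 1)\<^sup>2 = (g - 1)\<^sup>2 * (g + 1)\<^sup>2"
        by (simp add: power2_eq_square algebra_simps)
      ultimately show ?thesis by simp
    qed
    have "1 + real n * (g\<^sup>2 - 1) - (indicator B (fst p) + indicator B (snd p)) * (2 + n * g\<^sup>2) - (g\<^sup>2 - 1)\<^sup>2
        + ((\<gamma> (fst p) + \<gamma> (snd p)) - ((\<gamma> (fst p))\<^sup>2 + (\<gamma> (snd p))\<^sup>2) * (2 / \<eta>\<^sup>2)) / 2
      \<le> sqrt (C5_at M W (fst p)) * sqrt (C5_at M W (snd p)) * ?K p ^ (2 * n) / d ^ (4 * n + 5)"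
      using weighted_codeg_power_ge_pointwise[OF xy \<open>density > 0\<close> \<eta> n0]
      by (simp add: g_def \<gamma>_def B_def d_def)
    moreover have "f1 p = 1 + real n * (g\<^sup>2 - 1)"
      by (simp add: f1_def g_def power_divide flip: power_mult)
    moreover have "f4 p - f5 p = ((\<gamma> (fst p) + \<gamma> (snd p)) - ((\<gamma> (fst p))\<^sup>2 + (\<gamma> (snd p))\<^sup>2) * (2 / \<eta>\<^sup>2)) / 2"
      using \<eta> by (simp add: f4_def f5_def field_simps)
    ultimately show "f1 p - f2 p - f3 p + f4 p - f5 p
      \<le> sqrt (C5_at M W (fst p)) * sqrt (C5_at M W (snd p)) * ?K p ^ (2 * n) / d ^ (4 * n + 5)"
      using f2 f3 by linarith
  qed (auto intro!: bdd bf)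
  finally show ?thesis using d01 by (simp add: d_def)
qed

end

section \<open>Sparse sets and rich kernels\<close>

context pair_space
begin

lemma integral_pair_swap:
  assumes "bdd_meas (M \<Otimes>\<^sub>M M) (\<lambda>p. f (fst p) (snd p))"
  shows "(\<integral>p. f (snd p) (fst p) \<partial>(M \<Otimes>\<^sub>M M)) = (\<integral>p. f (fst p) (snd p) \<partial>(M \<Otimes>\<^sub>M M))"
  using bdd_meas_measurable[OF assms]
  by (subst (2) P.distr_pair_swap, subst integral_distr) (auto simp: split_beta')

end

context kernel
begin

lemma bdd_indicator_W: "S \<in> events \<Longrightarrow> bdd_meas (M \<Otimes>\<^sub>M M) (\<lambda>p. indicator S (fst p) * indicator S (snd p) * W (fst p, snd p))"
  by (intro bdd) auto

lemma mass_pair: "S \<in> events \<Longrightarrow>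
  mass M W S = (\<integral>p. indicator S (fst p) * indicator S (snd p) * W p \<partial>(M \<Otimes>\<^sub>M M))"
  unfolding mass_def by (subst integral_pair[symmetric]) (auto intro: bdd_indicator_W[simplified] simp: bdd_indicator_W[simplified])

lemma mass_nonneg: "0 \<le> mass M W S"
  unfolding mass_def by (intro Bochner_Integration.integral_nonneg mult_nonneg_nonneg W_nonneg) auto

lemma mass_mono: "S \<in> events \<Longrightarrow> T \<in> events \<Longrightarrow> S \<subseteq> T \<Longrightarrow> mass M W S \<le> mass M W T"
  unfolding mass_pair
  by (intro P.integral_bdd_mono bdd) (auto simp: indicator_def W_nonneg)

lemma mass_space: "mass M W (space M) = density"
  unfolding mass_def density_def deg_def
  by (intro Bochner_Integration.integral_cong) auto

lemma mass_eq: "mass M W S = (\<integral>x. indicator S x * (\<integral>y. indicator S y * W (x, y) \<partial>M) \<partial>M)"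
  by (simp add: mass_def mult.assoc)

text \<open>\<open>N\<close> collects the points of \<open>S\<close> joined to x with weight at
  least \<beta>/2. Walks of three edges with both ends in \<open>N\<close> close up through x to
  5-cycles, and mass w of \<open>N\<close> forces a density w^3/32 of such walks. Read backwards: a
  point with few 5-cycles but large degree into \<open>S\<close> has a sparse neighbourhood inside
  \<open>S\<close>.\<close>

lemma ex_sparse_neighbourhood:
  assumes x: "x \<in> space M" and S: "S \<in> events" and \<beta>: "\<beta> > 0"
    and deg: "\<beta> \<le> (\<integral>y. indicator S y * W (x, y) \<partial>M)"
  shows "\<exists>N\<in>events. N \<subseteq> S \<and> \<beta> / 2 \<le> prob N \<and> (\<beta> / 2)\<^sup>2 * (mass M W N ^ 3 / 32) \<le> C5_at M W x"
proof -
  define N where "N = {y \<in> space M. y \<in> S \<and> \<beta> / 2 \<le> W (x, y)}"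
  have Wx: "(\<lambda>y. W (x, y)) \<in> borel_measurable M"
    using x by (intro bdd_meas_measurable bdd) auto
  have N: "N \<in> events" unfolding N_def using S Wx by measurable
  note N [measurable]
  have "(\<integral>y. indicator S y * W (x, y) \<partial>M) \<le> (\<integral>y. indicator N y + \<beta> / 2 \<partial>M)"
    using x S N \<beta> W_le_1
    by (intro integral_bdd_mono bdd) (auto simp: N_def indicator_def intro: add_increasing2)
  also have "\<dots> = prob N + \<beta> / 2"
    using N by (simp add: prob_space sets.Int_space_eq2 emeasure_eq_measure)
  finally have "\<beta> / 2 \<le> prob N" using deg by simp
  define h where "h = (\<lambda>a. \<integral>y. indicator N y * W (a, y) \<partial>M)"
  have h0: "0 \<le> h a" for a
    unfolding h_def by (intro Bochner_Integration.integral_nonneg mult_nonneg_nonneg W_nonneg) auto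
  have bh: "bdd_meas L (\<lambda>z. h (f z))" if [measurable]: "f \<in> measurable L M" for f and L :: "'b measure"
    unfolding h_def by (intro bdd) auto
  have bh1: "bdd_meas M h" unfolding h_def by (intro bdd) auto
  define w where "w = mass M W N"
  \<comment> \<open>Points with degree below t into \<open>N\<close> carry mass at most t on either
    side. With t = w / 4 half of the mass remains, on pairs with h(a) h(b) >= t^2, and t^2 w / 2 =
    w^3 / 32.\<close>
  define t where "t = w / 4"
  have w0: "0 \<le> w" "0 \<le> t" by (auto simp: w_def t_def mass_nonneg)
  define L where "L = {a \<in> space M. h a < t}"
  have L [measurable]: "L \<in> events" unfolding L_def using bdd_meas_measurable[OF bh1] by measurable
  let ?F = "\<lambda>p. indicator N (fst p) * indicator N (snd p) * W p"
  have bF: "bdd_meas (M \<Otimes>\<^sub>M M) ?F" by (intro bdd) auto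
  have low: "(\<integral>p. ?F p * indicator L (fst p) \<partial>(M \<Otimes>\<^sub>M M)) \<le> t"
  proof -
    have "(\<integral>p. indicator N (fst p) * indicator N (snd p) * W (fst p, snd p) * indicator L (fst p) \<partial>(M \<Otimes>\<^sub>M M))
      = (\<integral>a. \<integral>b. indicator N a * indicator N b * W (a, b) * indicator L a \<partial>M \<partial>M)"
      by (intro integral_pair bdd) auto
    also have "\<dots> = (\<integral>a. indicator N a * indicator L a * h a \<partial>M)"
      unfolding h_def by (simp add: mult_ac flip: integral_mult_right_zero)
    also have "\<dots> \<le> t"
      using w0 h0 by (intro integral_bdd_le bdd bh1 L N) (auto simp: indicator_def L_def)
    finally show ?thesis by simp
  qed
  have low': "(\<integral>p. ?F p * indicator L (snd p) \<partial>(M \<Otimes>\<^sub>M M)) \<le> t"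
  proof -
    have "(\<integral>p. indicator N (snd p) * indicator N (fst p) * W (snd p, fst p) * indicator L (snd p) \<partial>(M \<Otimes>\<^sub>M M))
      = (\<integral>p. indicator N (fst p) * indicator N (snd p) * W (fst p, snd p) * indicator L (fst p) \<partial>(M \<Otimes>\<^sub>M M))"
      by (intro integral_pair_swap bdd) auto
    also have "(\<lambda>p. indicator N (snd p) * indicator N (fst p) * W (snd p, fst p) * indicator L (snd p)) =
       (\<lambda>p. ?F p * indicator L (snd p))"
      using W_commute by (auto simp: fun_eq_iff mult_ac)
    finally show ?thesis using low by simp
  qed
  have K: "codeg M W x a \<ge> \<beta> / 2 * h a" if "a \<in> space M" for a
  proof -
    have "\<beta> / 2 * h a = (\<integral>y. \<beta> / 2 * (indicator N y * W (a, y)) \<partial>M)" by (simp add: h_def)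
    also have "\<dots> \<le> codeg M W x a"
      unfolding codeg_def
    proof (intro integral_bdd_mono bdd N)
      fix y
      show "\<beta> / 2 * (indicator N y * W (a, y)) \<le> W (x, y) * W (a, y)"
        using \<beta> W_nonneg[of "(a, y)"] W_nonneg[of "(x, y)"]
          mult_right_mono[of "\<beta> / 2" "W (x, y)" "W (a, y)"]
        by (auto simp: N_def indicator_def)
    qed (use that x in auto)
    finally show ?thesis .
  qed
  have "t\<^sup>2 * (w - t - t) \<le> t\<^sup>2 * ((\<integral>p. ?F p \<partial>(M \<Otimes>\<^sub>M M))
      - (\<integral>p. ?F p * indicator L (fst p) \<partial>(M \<Otimes>\<^sub>M M)) - (\<integral>p. ?F p * indicator L (snd p) \<partial>(M \<Otimes>\<^sub>M M)))"
    using low low' unfolding w_def mass_pair[OF N] by (intro mult_left_mono) auto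
  also have "\<dots> = (\<integral>p. t\<^sup>2 * (?F p - ?F p * indicator L (fst p) - ?F p * indicator L (snd p)) \<partial>(M \<Otimes>\<^sub>M M))"
  proof -
    have "bdd_meas (M \<Otimes>\<^sub>M M) (\<lambda>p. ?F p * indicator L (fst p))"
      "bdd_meas (M \<Otimes>\<^sub>M M) (\<lambda>p. ?F p * indicator L (snd p))"
      by (intro bdd_mult bF; intro bdd; simp)+
    then show ?thesis
      using bF by (simp add: P.bdd_integrable Bochner_Integration.integral_diff)
  qed
  also have "\<dots> \<le> (\<integral>p. h (fst p) * W p * h (snd p) \<partial>(M \<Otimes>\<^sub>M M))"
  proof (intro P.integral_bdd_mono)
    fix p assume "p \<in> space (M \<Otimes>\<^sub>M M)"
    then have p: "fst p \<in> space M" "snd p \<in> space M" by (auto simp: space_pair_measure)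
    let ?q = "1 - indicator L (fst p) - indicator L (snd p) :: real"
    have "t\<^sup>2 * (indicator N (fst p) * indicator N (snd p) * ?q) \<le> h (fst p) * h (snd p)"
    proof (cases "fst p \<in> L \<or> snd p \<in> L")
      case True
      then have "?q \<le> 0" by (auto simp: indicator_def)
      then have "t\<^sup>2 * (indicator N (fst p) * indicator N (snd p) * ?q) \<le> 0"
        by (intro mult_nonneg_nonpos) auto
      also have "0 \<le> h (fst p) * h (snd p)" using h0 by simp
      finally show ?thesis .
    next
      case False
      then have "t * t \<le> h (fst p) * h (snd p)" using p w0 by (intro mult_mono) (auto simp: L_def)
      then show ?thesis using False h0 by (auto simp: indicator_def power2_eq_square)
    qed
    from mult_right_mono[OF this W_nonneg[of p]]
    show "t\<^sup>2 * (?F p - ?F p * indicator L (fst p) - ?F p * indicator L (snd p)) \<le> h (fst p) * W p * h (snd p)"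
      by (simp add: algebra_simps)
  qed (auto intro!: bdd bh)
  finally have "w ^ 3 / 32 \<le> (\<integral>p. h (fst p) * W p * h (snd p) \<partial>(M \<Otimes>\<^sub>M M))"
    by (simp add: t_def power2_eq_square power3_eq_cube)
  then have "(\<beta> / 2)\<^sup>2 * (w ^ 3 / 32) \<le> (\<beta> / 2)\<^sup>2 * (\<integral>p. h (fst p) * W p * h (snd p) \<partial>(M \<Otimes>\<^sub>M M))"
    by (intro mult_left_mono) auto
  also have "\<dots> = (\<integral>p. (\<beta> / 2 * h (fst p)) * W p * (\<beta> / 2 * h (snd p)) \<partial>(M \<Otimes>\<^sub>M M))"
    by (simp add: power2_eq_square mult_ac flip: integral_mult_right_zero)
  also have "\<dots> \<le> (\<integral>p. codeg M W x (fst p) * W p * codeg M W x (snd p) \<partial>(M \<Otimes>\<^sub>M M))"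
    using x K h0 \<beta> W_nonneg codeg_nonneg
    by (intro P.integral_bdd_mono mult_mono bdd bh) (auto simp: space_pair_measure)
  also have "\<dots> = C5_at M W x" by (rule C5_at_pair[OF x, symmetric])
  finally show ?thesis
    using N \<open>\<beta> / 2 \<le> prob N\<close> by (intro bexI[of _ N]) (auto simp: w_def N_def)
qed

end

section \<open>Absent colours force a rich kernel\<close>

context pair_space
begin

text \<open>The share exceeds 1/k by a margin that leaves room for the pigeonhole principle: k - 1
  colours below it cover at most (1 - 1/k)(1 + 1/(2k)) < 1 - 1/(2k) of the pairs in a set. One
  parameter can bound both size and 5-cycle density, as both cost only factors with exponent of
  order n.\<close>

definition rich :: "nat \<Rightarrow> real \<Rightarrow> ('a \<times> 'a \<Rightarrow> real) \<Rightarrow> bool" where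
  "rich k \<rho> W \<longleftrightarrow> (\<exists>S\<in>events. \<rho> \<le> prob S \<and> (\<forall>x\<in>S. \<rho> \<le> C5_at M W x) \<and>
     (1 + 1 / (2 * k)) / k * (prob S)\<^sup>2 \<le> mass M W S)"

lemma rich_mono: "rich k \<rho> W \<Longrightarrow> \<rho>' \<le> \<rho> \<Longrightarrow> rich k \<rho>' W"
  unfolding rich_def by (meson order_trans)

text \<open>The deficit is absolute and not relative to \<open>S\<close>, so it is informative only
  on sets large compared with sqrt(\<delta>). Hence \<delta> is chosen after the sizes of the
  sets.\<close>

definition nearly_full :: "real \<Rightarrow> 'i set \<Rightarrow> ('i \<Rightarrow> 'a \<times> 'a \<Rightarrow> real) \<Rightarrow> bool" where
  "nearly_full \<delta> I W \<longleftrightarrow> (\<forall>S\<in>events. (prob S)\<^sup>2 - \<delta> \<le> (\<Sum>i\<in>I. mass M (W i) S))"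

lemma nearly_full_mono: "nearly_full \<delta> I W \<Longrightarrow> \<delta> \<le> \<delta>' \<Longrightarrow> nearly_full \<delta>' I W"
  unfolding nearly_full_def by fastforce

text \<open>Induction on the number m of colours not known to be nearly absent. The constants
  precede the quantifiers over \<open>W\<close>, \<open>J\<close> and \<open>S\<close>, which is the
  uniformity required in the end. The induction hypothesis is instantiated at two sizes, as the
  smaller set on which one more colour is absent arises in two ways.\<close>

lemma rich_of_absent_colour:
  fixes I :: "'i set" and \<alpha> :: real
  assumes I: "finite I" "I \<noteq> {}" and \<alpha>: "\<alpha> > 0"
  shows "\<exists>\<epsilon>>0. \<exists>\<rho>>0. \<exists>\<delta>>0. \<forall>(W :: 'i \<Rightarrow> 'a \<times> 'a \<Rightarrow> real) J S.
    (\<forall>i\<in>I. kernel M (W i)) \<longrightarrow> nearly_full \<delta> I W \<longrightarrow> J \<subseteq> I \<longrightarrow> J \<noteq> {} \<longrightarrow> card (I - J) = m \<longrightarrow>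
    S \<in> events \<longrightarrow> \<alpha> \<le> prob S \<longrightarrow> (\<forall>i\<in>J. mass M (W i) S \<le> \<epsilon> * (prob S)\<^sup>2) \<longrightarrow>
    (\<exists>i\<in>I. rich (card I) \<rho> (W i))"
  using \<alpha>
proof (induction m arbitrary: \<alpha>)
  case 0
  define k where "k = real (card I)"
  have k: "k > 0" using I by (simp add: k_def card_gt_0_iff)
  show ?case
  \<comment> \<open>With m = 0 all k colours are absent and cover at most k / (2k) = 1/2 of the
    square of \<open>S\<close>, against near fullness with deficit \<alpha>^2/4. The case being
    contradictory, the value 1 for \<rho> is arbitrary.\<close>
  proof (rule exI[of _ "1 / (2 * k)"], intro conjI, use k in simp, rule exI[of _ 1], intro conjI, simp,
      rule exI[of _ "\<alpha>\<^sup>2 / 4"], intro conjI allI impI, use 0 in simp)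
    fix W :: "'i \<Rightarrow> 'a \<times> 'a \<Rightarrow> real" and J S
    assume W: "nearly_full (\<alpha>\<^sup>2 / 4) I W" and J: "J \<subseteq> I" "card (I - J) = 0"
      and S: "S \<in> events" "\<alpha> \<le> prob S" and *: "\<forall>i\<in>J. mass M (W i) S \<le> 1 / (2 * k) * (prob S)\<^sup>2"
    have "J = I" using J I by auto
    have "(prob S)\<^sup>2 - \<alpha>\<^sup>2 / 4 \<le> (\<Sum>i\<in>I. mass M (W i) S)" using W S by (auto simp: nearly_full_def)
    also have "\<dots> \<le> card I * (1 / (2 * k) * (prob S)\<^sup>2)"
      using * \<open>J = I\<close> by (intro sum_bounded_above) auto
    also have "\<dots> = (prob S)\<^sup>2 / 2" using k by (simp add: k_def)
    finally have "(prob S)\<^sup>2 / 2 \<le> \<alpha>\<^sup>2 / 4" by simp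
    moreover have "\<alpha>\<^sup>2 \<le> (prob S)\<^sup>2" using 0 S by (intro power_mono) auto
    moreover have "0 < \<alpha>\<^sup>2" using 0 by simp
    ultimately show "\<exists>i\<in>I. rich (card I) 1 (W i)" by linarith
  qed
next
  case (Suc m)
  define k where "k = real (card I)"
  have k1: "k \<ge> 1" using I by (simp add: k_def card_gt_0_iff Suc_le_eq)
  \<comment> \<open>If for each colour the set of low 5-cycle density is smaller than \<alpha>1,
    removing these sets for at most k colours costs at most \<alpha>/2.\<close>
  define \<alpha>1 where "\<alpha>1 = \<alpha> / (2 * k)"
  have \<alpha>1: "\<alpha>1 > 0" using Suc.prems k1 by (simp add: \<alpha>1_def)
  from Suc.IH[OF \<alpha>1] obtain \<epsilon>1 \<rho>1 \<delta>1 where pos1: "\<epsilon>1 > 0" "\<rho>1 > 0" "\<delta>1 > 0" and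
    IH1: "\<And>(W :: 'i \<Rightarrow> 'a \<times> 'a \<Rightarrow> real) J S.
    (\<forall>i\<in>I. kernel M (W i)) \<Longrightarrow> nearly_full \<delta>1 I W \<Longrightarrow> J \<subseteq> I \<Longrightarrow> J \<noteq> {} \<Longrightarrow> card (I - J) = m \<Longrightarrow>
    S \<in> events \<Longrightarrow> \<alpha>1 \<le> prob S \<Longrightarrow> (\<forall>i\<in>J. mass M (W i) S \<le> \<epsilon>1 * (prob S)\<^sup>2) \<Longrightarrow>
    (\<exists>i\<in>I. rich (card I) \<rho>1 (W i))" by blast
  \<comment> \<open>If all points of a low set L have degree below \<beta> into L, its mass is at
    most \<beta> prob(L) <= \<epsilon>1 prob(L)^2, because prob(L) >= \<alpha>1. Otherwise some
    point has a neighbourhood in L of measure at least \<beta>/2 = \<alpha>2.\<close>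
  define \<beta> where "\<beta> = \<epsilon>1 * \<alpha>1"
  define \<alpha>2 where "\<alpha>2 = \<beta> / 2"
  have \<beta>: "\<beta> > 0" "\<alpha>2 > 0" using pos1 \<alpha>1 by (auto simp: \<beta>_def \<alpha>2_def)
  from Suc.IH[OF \<beta>(2)] obtain \<epsilon>2 \<rho>2 \<delta>2 where pos2: "\<epsilon>2 > 0" "\<rho>2 > 0" "\<delta>2 > 0" and
    IH2: "\<And>(W :: 'i \<Rightarrow> 'a \<times> 'a \<Rightarrow> real) J S.
    (\<forall>i\<in>I. kernel M (W i)) \<Longrightarrow> nearly_full \<delta>2 I W \<Longrightarrow> J \<subseteq> I \<Longrightarrow> J \<noteq> {} \<Longrightarrow> card (I - J) = m \<Longrightarrow>
    S \<in> events \<Longrightarrow> \<alpha>2 \<le> prob S \<Longrightarrow> (\<forall>i\<in>J. mass M (W i) S \<le> \<epsilon>2 * (prob S)\<^sup>2) \<Longrightarrow>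
    (\<exists>i\<in>I. rich (card I) \<rho>2 (W i))" by blast
  \<comment> \<open>The 5-cycle density that \<open>ex_sparse_neighbourhood\<close> yields for a
    neighbourhood of mass \<open>\<epsilon>2 * \<alpha>2\<^sup>2\<close>; below it the neighbourhood
    is sparse enough for the second induction hypothesis.\<close>
  define \<eta> where "\<eta> = (\<beta> / 2)\<^sup>2 * ((\<epsilon>2 * \<alpha>2\<^sup>2) ^ 3 / 32)"
  have \<eta>: "\<eta> > 0" using \<beta> pos2 by (simp add: \<eta>_def)
  \<comment> \<open>The first two entries keep the colours in \<open>J\<close> absent on subsets of
    measure \<alpha>1 or \<alpha>2. The last entries of \<epsilon> and \<delta> make \<delta> + k
    \<epsilon> at most (prob T)^2 / (2k).\<close>
  define \<epsilon> where "\<epsilon> = Min {\<epsilon>1 * \<alpha>1\<^sup>2, \<epsilon>2 * \<alpha>2\<^sup>2, \<alpha>\<^sup>2 / (16 * k\<^sup>2)}"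
  define \<delta> where "\<delta> = Min {\<delta>1, \<delta>2, \<alpha>\<^sup>2 / (16 * k)}"
  define \<rho> where "\<rho> = Min {\<rho>1, \<rho>2, \<eta>, \<alpha> / 2}"
  have pos: "\<epsilon> > 0" "\<delta> > 0" "\<rho> > 0"
    using pos1 pos2 \<alpha>1 \<beta> \<eta> Suc.prems k1 by (auto simp: \<epsilon>_def \<delta>_def \<rho>_def)
  have le: "\<epsilon> \<le> \<epsilon>1 * \<alpha>1\<^sup>2" "\<epsilon> \<le> \<epsilon>2 * \<alpha>2\<^sup>2" "\<epsilon> \<le> \<alpha>\<^sup>2 / (16 * k\<^sup>2)" "\<delta> \<le> \<delta>1" "\<delta> \<le> \<delta>2" "\<delta> \<le> \<alpha>\<^sup>2 / (16 * k)"
    "\<rho> \<le> \<rho>1" "\<rho> \<le> \<rho>2" "\<rho> \<le> \<eta>" "\<rho> \<le> \<alpha> / 2"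
    by (simp_all add: \<epsilon>_def \<delta>_def \<rho>_def)
  show ?case
  proof (rule exI[of _ \<epsilon>], intro conjI, rule pos, rule exI[of _ \<rho>], intro conjI, rule pos,
      rule exI[of _ \<delta>], intro conjI allI impI, rule pos)
    fix W :: "'i \<Rightarrow> 'a \<times> 'a \<Rightarrow> real" and J S
    assume ker: "\<forall>i\<in>I. kernel M (W i)" and full: "nearly_full \<delta> I W"
      and J: "J \<subseteq> I" "J \<noteq> {}" "card (I - J) = Suc m"
      and S: "S \<in> events" "\<alpha> \<le> prob S" and absent: "\<forall>i\<in>J. mass M (W i) S \<le> \<epsilon> * (prob S)\<^sup>2"
    have absent': "mass M (W i) T \<le> \<epsilon>" if "i \<in> J" "T \<in> events" "T \<subseteq> S" for i T
    proof -
      interpret kernel M "W i" using ker J that by auto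
      have "mass M (W i) T \<le> mass M (W i) S" using that S by (intro mass_mono)
      also have "\<dots> \<le> \<epsilon> * (prob S)\<^sup>2" using absent that by auto
      also have "\<dots> \<le> \<epsilon> * 1" using pos by (intro mult_left_mono power_le_one) auto
      finally show ?thesis by simp
    qed
    define L where "L = (\<lambda>i. {x \<in> S. C5_at M (W i) x < \<eta>})"
    have L: "L i \<in> events" "L i \<subseteq> S" if "i \<in> I" for i
    proof -
      interpret kernel M "W i" using ker that by auto
      have "(\<lambda>x. C5_at M (W i) x) \<in> borel_measurable M"
        by (intro bdd_meas_measurable bdd) auto
      then have "{x \<in> space M. x \<in> S \<and> C5_at M (W i) x < \<eta>} \<in> events"
        using S by measurable
      also have "{x \<in> space M. x \<in> S \<and> C5_at M (W i) x < \<eta>} = L i"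
        using S sets.sets_into_space by (auto simp: L_def)
      finally show "L i \<in> events" .
    qed (auto simp: L_def)
    show "\<exists>i\<in>I. rich (card I) \<rho> (W i)"
    proof (cases "\<exists>i\<in>I - J. \<alpha>1 \<le> prob (L i)")
      case True
      then obtain i where i: "i \<in> I" "i \<notin> J" "\<alpha>1 \<le> prob (L i)" by auto
      interpret kernel M "W i" using ker i by auto
      have "I - insert i J = (I - J) - {i}" by auto
      then have J': "insert i J \<subseteq> I" "insert i J \<noteq> {}" "card (I - insert i J) = m"
        using i J I by (auto simp: card_Diff_singleton)
      have absent_on: "\<forall>j\<in>insert i J. mass M (W j) T \<le> e * (prob T)\<^sup>2"
        if T: "T \<in> events" "T \<subseteq> L i" "a \<le> prob T" and a: "a > 0" "e > 0" "\<epsilon> \<le> e * a\<^sup>2"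
          and sp: "mass M (W i) T \<le> e * (prob T)\<^sup>2" for T a e
      proof
        fix j assume "j \<in> insert i J"
        then consider "j = i" | "j \<in> J" by auto
        then show "mass M (W j) T \<le> e * (prob T)\<^sup>2"
        proof cases
          case 2
          then have "mass M (W j) T \<le> \<epsilon>" using T L i by (intro absent') auto
          also have "\<dots> \<le> e * a\<^sup>2" by fact
          also have "\<dots> \<le> e * (prob T)\<^sup>2" using T a by (intro mult_left_mono power_mono) auto
          finally show ?thesis .
        qed (use sp in simp)
      qed
      show ?thesis
      proof (cases "\<exists>x\<in>L i. \<beta> \<le> (\<integral>y. indicator (L i) y * W i (x, y) \<partial>M)")
        case True
        then obtain x where x: "x \<in> L i" "\<beta> \<le> (\<integral>y. indicator (L i) y * W i (x, y) \<partial>M)" by auto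
        then have xM: "x \<in> space M" and c: "C5_at M (W i) x < \<eta>"
          using L[OF i(1)] sets.sets_into_space by (auto simp: L_def)
        obtain N where N: "N \<in> events" "N \<subseteq> L i" "\<beta> / 2 \<le> prob N"
          "(\<beta> / 2)\<^sup>2 * (mass M (W i) N ^ 3 / 32) \<le> C5_at M (W i) x"
          using ex_sparse_neighbourhood[OF xM L(1)[OF i(1)] \<beta>(1) x(2)] by auto
        have "mass M (W i) N \<le> \<epsilon>2 * \<alpha>2\<^sup>2"
        proof (rule ccontr)
          assume "\<not> ?thesis"
          then have "(\<epsilon>2 * \<alpha>2\<^sup>2) ^ 3 \<le> mass M (W i) N ^ 3"
            using pos2 by (intro power_mono) auto
          then have "\<eta> \<le> (\<beta> / 2)\<^sup>2 * (mass M (W i) N ^ 3 / 32)"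
            unfolding \<eta>_def by (intro mult_left_mono divide_right_mono) auto
          with N c show False by simp
        qed
        also have "\<dots> \<le> \<epsilon>2 * (prob N)\<^sup>2"
          using N \<beta> pos2 by (intro mult_left_mono power_mono) (auto simp: \<alpha>2_def)
        finally have "\<forall>j\<in>insert i J. mass M (W j) N \<le> \<epsilon>2 * (prob N)\<^sup>2"
          using N \<beta> pos2 le by (intro absent_on[of N \<alpha>2]) (auto simp: \<alpha>2_def)
        then have "\<exists>i\<in>I. rich (card I) \<rho>2 (W i)"
          using N by (intro IH2[OF ker nearly_full_mono[OF full le(5)] J' N(1)]) (auto simp: \<alpha>2_def)
        then show ?thesis using rich_mono le by blast
      next
        case False
        have [simp]: "L i \<in> events" by (rule L(1)[OF i(1)])
        have "mass M (W i) (L i) \<le> (\<integral>x. \<beta> * indicator (L i) x \<partial>M)"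
          unfolding mass_eq
        proof (intro integral_bdd_mono bdd)
          fix x
          show "indicator (L i) x * (\<integral>y. indicator (L i) y * W i (x, y) \<partial>M) \<le> \<beta> * indicator (L i) x"
            using False by (cases "x \<in> L i") auto
        qed auto
        also have "\<dots> = \<beta> * prob (L i)" by (simp add: integral_indicator_prob)
        also have "\<dots> \<le> \<epsilon>1 * (prob (L i))\<^sup>2"
          using i pos1 by (simp add: \<beta>_def power2_eq_square mult.assoc mult_left_mono mult_right_mono)
        finally have "\<forall>j\<in>insert i J. mass M (W j) (L i) \<le> \<epsilon>1 * (prob (L i))\<^sup>2"
          using i \<alpha>1 pos1 le by (intro absent_on[of "L i" \<alpha>1]) auto
        then have "\<exists>i\<in>I. rich (card I) \<rho>1 (W i)"
          using i by (intro IH1[OF ker nearly_full_mono[OF full le(4)] J']) auto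
        then show ?thesis using rich_mono le by blast
      qed
    next
      case False
      \<comment> \<open>At every point of \<open>T\<close> each colour outside \<open>J\<close> has
        5-cycle density at least \<eta>, so only a large share of the mass is still to be
        found.\<close>
      define T where "T = S - (\<Union>i\<in>I - J. L i)"
      have fin: "finite (I - J)" using I by auto
      have T: "T \<in> events" "T \<subseteq> S"
        unfolding T_def using S L fin by (auto intro!: sets.Diff sets.finite_UN)
      have U: "(\<Union>i\<in>I - J. L i) \<in> events" using L fin by auto
      have card: "card (I - J) \<le> card I" by (simp add: card_mono I)
      have "prob (\<Union>i\<in>I - J. L i) \<le> (\<Sum>i\<in>I - J. prob (L i))"
        using L fin by (intro finite_measure_subadditive_finite) auto
      also have "\<dots> \<le> card (I - J) * \<alpha>1" using False by (intro sum_bounded_above) (auto simp: not_le less_imp_le)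
      also have "\<dots> \<le> k * \<alpha>1" using card \<alpha>1 by (intro mult_right_mono) (auto simp: k_def)
      also have "\<dots> = \<alpha> / 2" using k1 by (simp add: \<alpha>1_def)
      finally have "prob (\<Union>i\<in>I - J. L i) \<le> \<alpha> / 2" .
      moreover have "prob T = prob S - prob (\<Union>i\<in>I - J. L i)"
        unfolding T_def using S U L by (intro finite_measure_Diff) auto
      ultimately have T2: "\<alpha> / 2 \<le> prob T" using S by linarith
      \<comment> \<open>\<open>J\<close> is nonempty, so at most k - 1 colours share
        \<open>T\<close>; the missing colour is what pushes one share above 1/k.\<close>
      have k2: "card (I - J) < card I"
        using J I by (intro psubset_card_mono) auto
      then have cJ: "real (card (I - J)) \<le> k - 1" "0 < real (card (I - J))"
        using J by (auto simp: k_def)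
      have ne: "I - J \<noteq> {}" by (metis J(3) card.empty nat.distinct(1))
      have aT: "\<alpha>\<^sup>2 / 4 \<le> (prob T)\<^sup>2"
        using power_mono[OF T2, of 2] Suc.prems by (simp add: power_divide)
      have "\<delta> + k * \<epsilon> \<le> \<alpha>\<^sup>2 / (16 * k) + k * (\<alpha>\<^sup>2 / (16 * k\<^sup>2))"
        using le k1 by (intro add_mono mult_left_mono) auto
      also have "\<dots> = (\<alpha>\<^sup>2 / 4) / (2 * k)" using k1 by (simp add: field_simps power2_eq_square)
      also have "\<dots> \<le> (prob T)\<^sup>2 / (2 * k)" using aT k1 by (intro divide_right_mono) auto
      finally have small: "\<delta> + k * \<epsilon> \<le> (prob T)\<^sup>2 / (2 * k)" .
      have "(prob T)\<^sup>2 - \<delta> \<le> (\<Sum>i\<in>I. mass M (W i) T)"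
        using full T by (auto simp: nearly_full_def)
      also have "\<dots> = (\<Sum>i\<in>I - J. mass M (W i) T) + (\<Sum>i\<in>J. mass M (W i) T)"
        using I J by (simp add: sum.subset_diff)
      also have "(\<Sum>i\<in>J. mass M (W i) T) \<le> card J * \<epsilon>"
        using absent' T by (intro sum_bounded_above) auto
      also have "\<dots> \<le> k * \<epsilon>" using pos I J by (intro mult_right_mono) (auto simp: k_def card_mono)
      finally have sum_ge: "(prob T)\<^sup>2 * (1 - 1 / (2 * k)) \<le> (\<Sum>i\<in>I - J. mass M (W i) T)"
        using small by (simp add: algebra_simps)
      have "\<exists>i\<in>I - J. (1 + 1 / (2 * k)) / k * (prob T)\<^sup>2 \<le> mass M (W i) T"
      proof (rule ccontr)
        assume "\<not> ?thesis"
        then have "(\<Sum>i\<in>I - J. mass M (W i) T) < (\<Sum>i\<in>I - J. (1 + 1 / (2 * k)) / k * (prob T)\<^sup>2)"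
          using fin ne by (intro sum_strict_mono) (auto simp: not_le)
        also have "\<dots> = card (I - J) * ((1 + 1 / (2 * k)) / k) * (prob T)\<^sup>2" by simp
        also have "\<dots> \<le> (k - 1) * ((1 + 1 / (2 * k)) / k) * (prob T)\<^sup>2"
          using cJ k1 by (intro mult_right_mono) auto
        also have "\<dots> \<le> (1 - 1 / (2 * k)) * (prob T)\<^sup>2"
          using k1 by (intro mult_right_mono) (auto simp: field_simps)
        finally show False using sum_ge by (simp add: mult.commute)
      qed
      then obtain i where i: "i \<in> I" "i \<notin> J" "(1 + 1 / (2 * k)) / k * (prob T)\<^sup>2 \<le> mass M (W i) T" by auto
      have "rich (card I) \<rho> (W i)"
        unfolding rich_def
      proof (intro bexI[of _ T] conjI ballI)
        fix x assume "x \<in> T"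
        then have "\<eta> \<le> C5_at M (W i) x" using i(1,2) by (auto simp: T_def L_def not_less)
        then show "\<rho> \<le> C5_at M (W i) x" using le by linarith
      qed (use i T T2 le in \<open>auto simp: k_def\<close>)
      then show ?thesis using i by auto
    qed
  qed
qed

section \<open>Finite powers of the probability space\<close>

sublocale Pi: product_prob_space "\<lambda>_ :: 'i. M" UNIV ..

lemma prob_space_PiM_const: "prob_space (\<Pi>\<^sub>M j\<in>J. M)"
  by (rule prob_space_PiM) (rule prob_space_axioms)

text \<open>Carries integrals and almost everywhere statements from the square to the two
  coordinates of a single edge. The identity is checked on rectangles.\<close>

lemma distr_PiM_two_components:
  assumes uv: "u \<in> J" "v \<in> J" "u \<noteq> v" and J: "finite J"
  shows "distr (\<Pi>\<^sub>M j\<in>J. M) (M \<Otimes>\<^sub>M M) (\<lambda>x. (x u, x v)) = M \<Otimes>\<^sub>M M"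
proof (rule pair_measure_eqI[symmetric])
  fix A B assume AB: "A \<in> events" "B \<in> events"
  define X where "X = (\<lambda>w. if w = u then A else if w = v then B else space M)"
  have "emeasure (distr (\<Pi>\<^sub>M j\<in>J. M) (M \<Otimes>\<^sub>M M) (\<lambda>x. (x u, x v))) (A \<times> B) =
    emeasure (\<Pi>\<^sub>M j\<in>J. M) ((\<lambda>x. (x u, x v)) -` (A \<times> B) \<inter> space (\<Pi>\<^sub>M j\<in>J. M))"
    using uv AB by (intro emeasure_distr) auto
  also have "(\<lambda>x. (x u, x v)) -` (A \<times> B) \<inter> space (\<Pi>\<^sub>M j\<in>J. M) = (\<Pi>\<^sub>E j\<in>J. X j)"
  proof (intro set_eqI iffI)
    fix x assume x: "x \<in> (\<lambda>x. (x u, x v)) -` (A \<times> B) \<inter> space (\<Pi>\<^sub>M j\<in>J. M)"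
    then show "x \<in> (\<Pi>\<^sub>E j\<in>J. X j)"
      by (intro PiE_I) (auto simp: X_def space_PiM PiE_iff extensional_def)
  next
    fix x assume x: "x \<in> (\<Pi>\<^sub>E j\<in>J. X j)"
    have "X j \<subseteq> space M" for j using AB[THEN sets.sets_into_space] by (auto simp: X_def)
    then have "x \<in> space (\<Pi>\<^sub>M j\<in>J. M)" using x by (fastforce simp: space_PiM PiE_iff)
    moreover have "x u \<in> A" "x v \<in> B"
      using PiE_mem[OF x uv(1)] PiE_mem[OF x uv(2)] uv by (auto simp: X_def)
    ultimately show "x \<in> (\<lambda>x. (x u, x v)) -` (A \<times> B) \<inter> space (\<Pi>\<^sub>M j\<in>J. M)" by simp
  qed
  also have "emeasure (\<Pi>\<^sub>M j\<in>J. M) \<dots> = (\<Prod>j\<in>J. emeasure M (X j))"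
    using J AB by (intro Pi.emeasure_PiM) (auto simp: X_def)
  also have "\<dots> = (\<Prod>j\<in>{u, v}. emeasure M (X j))"
    using J uv by (intro prod.mono_neutral_right) (auto simp: X_def emeasure_space_1)
  also have "\<dots> = emeasure M A * emeasure M B" using uv by (simp add: X_def)
  finally show "emeasure M A * emeasure M B = emeasure (distr (\<Pi>\<^sub>M j\<in>J. M) (M \<Otimes>\<^sub>M M) (\<lambda>x. (x u, x v))) (A \<times> B)"
    by simp
qed (auto intro: sigma_finite_measure_axioms)

lemma integral_PiM_insert:
  assumes J: "finite J" "i \<notin> J" and f: "bdd_meas (\<Pi>\<^sub>M j\<in>insert i J. M) f"
  shows "(\<integral>x. f x \<partial>(\<Pi>\<^sub>M j\<in>insert i J. M)) = (\<integral>x. \<integral>y. f (x(i := y)) \<partial>M \<partial>(\<Pi>\<^sub>M j\<in>J. M))"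
    and "bdd_meas (\<Pi>\<^sub>M j\<in>J. M) (\<lambda>x. \<integral>y. f (x(i := y)) \<partial>M)"
proof -
  interpret Q: prob_space "\<Pi>\<^sub>M j\<in>insert i J. M" by (rule prob_space_PiM_const)
  show "(\<integral>x. f x \<partial>(\<Pi>\<^sub>M j\<in>insert i J. M)) = (\<integral>x. \<integral>y. f (x(i := y)) \<partial>M \<partial>(\<Pi>\<^sub>M j\<in>J. M))"
    using J f by (intro Pi.product_integral_insert Q.bdd_integrable)
  show "bdd_meas (\<Pi>\<^sub>M j\<in>J. M) (\<lambda>x. \<integral>y. f (x(i := y)) \<partial>M)"
  proof (intro bdd_integral bdd_comp[OF f])
    show "(\<lambda>p. (fst p)(i := snd p)) \<in> (\<Pi>\<^sub>M j\<in>J. M) \<Otimes>\<^sub>M M \<rightarrow>\<^sub>M (\<Pi>\<^sub>M j\<in>insert i J. M)"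
      using measurable_add_dim[of i J "\<lambda>_. M"] by (simp add: split_beta')
  qed
qed

lemma integral_PiM_singleton:
  "bdd_meas M f \<Longrightarrow> (\<integral>x. f (x i) \<partial>(\<Pi>\<^sub>M j\<in>{i}. M)) = (\<integral>x. f x \<partial>M)"
  by (intro Pi.product_integral_singleton bdd_meas_measurable)

text \<open>Functions of disjoint sets of coordinates are independent. The blocks in the application
  are the vertices \<open>Left i\<close>, each with its cycle if it has one, while the other part is
  fixed.\<close>

lemma integral_PiM_blocks:
  fixes f :: "'k \<Rightarrow> ('i \<Rightarrow> 'a) \<Rightarrow> real"
  assumes K: "finite K" and B: "\<And>k. k \<in> K \<Longrightarrow> finite (B k)" "disjoint_family_on B K"
    and f: "\<And>k. k \<in> K \<Longrightarrow> bdd_meas (\<Pi>\<^sub>M j\<in>B k. M) (f k)"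
  shows "(\<integral>x. (\<Prod>k\<in>K. f k (restrict x (B k))) \<partial>(\<Pi>\<^sub>M j\<in>(\<Union>k\<in>K. B k). M)) =
    (\<Prod>k\<in>K. \<integral>x. f k x \<partial>(\<Pi>\<^sub>M j\<in>B k. M))"
  using K B f
proof (induction K)
  case empty
  interpret Q: prob_space "\<Pi>\<^sub>M j\<in>{}::'i set. M" by (rule prob_space_PiM_const)
  show ?case using Q.prob_space by simp
next
  case (insert l K)
  let ?U = "\<Union>k\<in>K. B k"
  interpret Q: prob_space "\<Pi>\<^sub>M j\<in>B l \<union> ?U. M" by (rule prob_space_PiM_const)
  have disj: "B l \<inter> B k = {}" if "k \<in> K" for k
    using that insert.hyps insert.prems(2) by (auto simp: disjoint_family_on_def)
  then have disj': "B l \<inter> ?U = {}" by auto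
  have fin: "finite (B l)" "finite ?U" using insert by auto
  have restr: "bdd_meas (\<Pi>\<^sub>M j\<in>B l \<union> ?U. M) (\<lambda>x. f k (restrict x (B k)))" if "k \<in> insert l K" for k
    using that by (intro bdd_comp[OF insert.prems(3)] measurable_restrict_subset) auto
  have "(\<integral>x. (\<Prod>k\<in>insert l K. f k (restrict x (B k))) \<partial>(\<Pi>\<^sub>M j\<in>(\<Union>k\<in>insert l K. B k). M)) =
    (\<integral>x. (\<Prod>k\<in>insert l K. f k (restrict x (B k))) \<partial>(\<Pi>\<^sub>M j\<in>B l \<union> ?U. M))"
    by simp
  also have "\<dots> = (\<integral>x. \<integral>y. (\<Prod>k\<in>insert l K. f k (restrict (merge (B l) ?U (x, y)) (B k)))
       \<partial>(\<Pi>\<^sub>M j\<in>?U. M) \<partial>(\<Pi>\<^sub>M j\<in>B l. M))"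
    using disj' fin restr by (intro Pi.product_integral_fold Q.bdd_integrable bdd) auto
  also have "\<dots> = (\<integral>x. \<integral>y. f l x * (\<Prod>k\<in>K. f k (restrict y (B k)))
       \<partial>(\<Pi>\<^sub>M j\<in>?U. M) \<partial>(\<Pi>\<^sub>M j\<in>B l. M))"
  proof (intro Bochner_Integration.integral_cong refl)
    fix x y assume x: "x \<in> space (\<Pi>\<^sub>M j\<in>B l. M)" and y: "y \<in> space (\<Pi>\<^sub>M j\<in>?U. M)"
    have 1: "restrict (merge (B l) ?U (x, y)) (B l) = x"
      using x by (auto simp: space_PiM PiE_def extensional_def merge_def restrict_def fun_eq_iff)
    have 2: "restrict (merge (B l) ?U (x, y)) (B k) = restrict y (B k)" if "k \<in> K" for k
      using disj[OF that] that by (auto simp: merge_def restrict_def fun_eq_iff)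
    show "(\<Prod>k\<in>insert l K. f k (restrict (merge (B l) ?U (x, y)) (B k))) =
       f l x * (\<Prod>k\<in>K. f k (restrict y (B k)))"
      using insert.hyps by (simp add: 1 2)
  qed
  also have "\<dots> = (\<integral>x. f l x \<partial>(\<Pi>\<^sub>M j\<in>B l. M)) *
      (\<integral>y. (\<Prod>k\<in>K. f k (restrict y (B k))) \<partial>(\<Pi>\<^sub>M j\<in>?U. M))"
    by simp
  also have "(\<integral>y. (\<Prod>k\<in>K. f k (restrict y (B k))) \<partial>(\<Pi>\<^sub>M j\<in>?U. M)) =
      (\<Prod>k\<in>K. \<integral>x. f k x \<partial>(\<Pi>\<^sub>M j\<in>B k. M))"
    using insert by (intro insert.IH) (auto simp: disjoint_family_on_def)
  finally show ?case using insert.hyps by simp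
qed

end

lemma measurable_PiM_component:
  "f \<in> measurable N (\<Pi>\<^sub>M j\<in>J. M) \<Longrightarrow> j \<in> J \<Longrightarrow> (\<lambda>z. f z j) \<in> measurable N M"
  using measurable_compose[OF _ measurable_component_singleton[of j J "\<lambda>_. M"]] by auto

section \<open>Cauchy--Schwarz and convexity over common neighbourhoods\<close>

context kernel
begin

definition codeg_on :: "'a set \<Rightarrow> 'a \<Rightarrow> 'a \<Rightarrow> real" where
  "codeg_on T x y = (\<integral>z. indicator T z * (W (x, z) * W (y, z)) \<partial>M)"

lemma bdd_codeg_on [bdd]:
  assumes [measurable]: "f \<in> measurable N M" "g \<in> measurable N M" and T: "T \<in> events"
  shows "bdd_meas N (\<lambda>z. codeg_on T (f z) (g z))"
  unfolding codeg_on_def by (intro bdd T; measurable)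

lemma codeg_on_nonneg: "0 \<le> codeg_on T x y"
  unfolding codeg_on_def by (intro Bochner_Integration.integral_nonneg mult_nonneg_nonneg W_nonneg) auto

lemma codeg_on_space: "codeg_on (space M) x y = codeg M W x y"
  unfolding codeg_on_def codeg_def by (intro Bochner_Integration.integral_cong) auto

text \<open>For fixed y, Cauchy--Schwarz gives F^2 <= A B, where F carries the weight sqrt(c).
  Writing F^2 as an integral over pairs of points and integrating y over T^R yields the codegree
  power in the assumption, which thus says that the mean of F^2 over T^R is at least m. By convexity
  the mean of its nth power there is at least m^n, so \<open>T\<close> costs one factor
  \<open>prob T ^ card R\<close> and not the nth power of it.\<close>

lemma integral_star_power_ge:
  fixes R :: "'i set"
  assumes R: "finite R" and T: "T \<in> events" and m: "0 \<le> m"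
    and le: "m * prob T ^ card R \<le>
      (\<integral>p. sqrt (C5_at M W (fst p)) * sqrt (C5_at M W (snd p)) * codeg_on T (fst p) (snd p) ^ card R \<partial>(M \<Otimes>\<^sub>M M))"
  shows "prob T ^ card R * m ^ n \<le>
    (\<integral>y. (\<integral>x. (\<Prod>r\<in>R. W (x, y r)) \<partial>M) ^ n * (\<integral>x. C5_at M W x * (\<Prod>r\<in>R. W (x, y r)) \<partial>M) ^ n
      \<partial>(\<Pi>\<^sub>M r\<in>R. M))"
proof -
  define Q where "Q = (\<Pi>\<^sub>M r\<in>R. M)"
  interpret Q: prob_space Q unfolding Q_def by (rule prob_space_PiM_const)
  define s where "s = (\<lambda>x. sqrt (C5_at M W x))"
  define w where "w = (\<lambda>x y. \<Prod>r\<in>R. W (x, y r))"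
  define F where "F = (\<lambda>y. \<integral>x. s x * w x y \<partial>M)"
  define A where "A = (\<lambda>y. \<integral>x. w x y \<partial>M)"
  define B where "B = (\<lambda>y. \<integral>x. C5_at M W x * w x y \<partial>M)"
  define \<phi> :: "('i \<Rightarrow> 'a) \<Rightarrow> real" where "\<phi> = (\<lambda>y. \<Prod>r\<in>R. indicator T (y r))"
  have comp: "(\<lambda>z. f z r) \<in> measurable N M" if "f \<in> measurable N Q" "r \<in> R"
    for f :: "'z \<Rightarrow> 'i \<Rightarrow> 'a" and N r
    using that unfolding Q_def by (rule measurable_PiM_component)
  have bs: "bdd_meas N (\<lambda>z. s (f z))" if "f \<in> measurable N M" for f and N :: "'z measure"
    unfolding s_def by (intro bdd that)
  have bw: "bdd_meas N (\<lambda>z. w (f z) (g z))" if "f \<in> measurable N M" "g \<in> measurable N Q"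
    for f g and N :: "'z measure"
    unfolding w_def by (intro bdd that comp) auto
  have b\<phi>: "bdd_meas N (\<lambda>z. \<phi> (g z))" if "g \<in> measurable N Q" for g and N :: "'z measure"
    unfolding \<phi>_def by (intro bdd T comp that) auto
  have bA: "bdd_meas Q A" and bB: "bdd_meas Q B" and bF: "bdd_meas Q F"
    unfolding A_def B_def F_def by (intro bdd bs bw; simp)+
  have w0: "0 \<le> w x y" for x y unfolding w_def by (intro prod_nonneg W_nonneg)
  have CS: "(F y)\<^sup>2 \<le> A y * B y" if y: "y \<in> space Q" for y
  proof -
    have "s x * w x y = sqrt (w x y) * sqrt (C5_at M W x * w x y)" for x
    proof -
      have "sqrt (w x y) * sqrt (C5_at M W x * w x y) = s x * (sqrt (w x y) * sqrt (w x y))"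
        by (simp only: s_def real_sqrt_mult mult_ac)
      then show ?thesis using w0 by simp
    qed
    then have "(F y)\<^sup>2 = (\<integral>x. sqrt (w x y) * sqrt (C5_at M W x * w x y) \<partial>M)\<^sup>2"
      unfolding F_def by simp
    also have "\<dots> \<le> (\<integral>x. (sqrt (w x y))\<^sup>2 \<partial>M) * (\<integral>x. (sqrt (C5_at M W x * w x y))\<^sup>2 \<partial>M)"
      using y by (intro Cauchy_Schwarz_bdd bdd bw) auto
    also have "\<dots> = A y * B y"
      unfolding A_def B_def using w0 C5_at_nonneg by simp
    finally show ?thesis .
  qed
  have \<phi>01: "\<phi> y = 0 \<or> \<phi> y = 1" for y
    unfolding \<phi>_def by (induction R rule: infinite_finite_induct) (auto simp: indicator_def)
  have I\<phi>: "(\<integral>y. \<phi> y \<partial>Q) = prob T ^ card R"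
    unfolding \<phi>_def Q_def using R T
    by (subst Pi.product_integral_prod) (auto simp: integral_indicator_prob intro!: bdd_integrable bdd)
  have I\<phi>F: "(\<integral>y. \<phi> y * (F y)\<^sup>2 \<partial>Q) =
    (\<integral>p. s (fst p) * s (snd p) * codeg_on T (fst p) (snd p) ^ card R \<partial>(M \<Otimes>\<^sub>M M))"
  proof -
    interpret QP: pair_prob_space Q "M \<Otimes>\<^sub>M M" ..
    have "(\<integral>y. \<phi> y * (F y)\<^sup>2 \<partial>Q) =
      (\<integral>y. \<integral>p. s (fst p) * s (snd p) * (\<phi> y * (w (fst p) y * w (snd p) y)) \<partial>(M \<Otimes>\<^sub>M M) \<partial>Q)"
    proof (intro Bochner_Integration.integral_cong refl)
      fix y assume y: "y \<in> space Q"
      have "(\<integral>p. (s (fst p) * w (fst p) y) * (s (snd p) * w (snd p) y) \<partial>(M \<Otimes>\<^sub>M M)) = F y * F y"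
        unfolding F_def using y by (intro integral_pair_mult bdd bs bw) auto
      then have "(\<integral>p. \<phi> y * ((s (fst p) * w (fst p) y) * (s (snd p) * w (snd p) y)) \<partial>(M \<Otimes>\<^sub>M M)) =
          \<phi> y * (F y)\<^sup>2"
        by (simp only: integral_mult_right_zero power2_eq_square)
      then show "\<phi> y * (F y)\<^sup>2 =
        (\<integral>p. s (fst p) * s (snd p) * (\<phi> y * (w (fst p) y * w (snd p) y)) \<partial>(M \<Otimes>\<^sub>M M))"
        by (simp only: mult_ac)
    qed
    also have "\<dots> = (\<integral>p. \<integral>y. s (fst p) * s (snd p) * (\<phi> y * (w (fst p) y * w (snd p) y)) \<partial>Q \<partial>(M \<Otimes>\<^sub>M M))"
      by (rule QP.Fubini_integral[symmetric], unfold split_beta')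
         (intro QP.P.bdd_integrable bdd bs bw b\<phi>; simp)
    also have "\<dots> = (\<integral>p. s (fst p) * s (snd p) * codeg_on T (fst p) (snd p) ^ card R \<partial>(M \<Otimes>\<^sub>M M))"
    proof (intro Bochner_Integration.integral_cong refl)
      fix p assume "p \<in> space (M \<Otimes>\<^sub>M M)"
      then have p: "fst p \<in> space M" "snd p \<in> space M" by (auto simp: space_pair_measure)
      have "(\<integral>y. \<phi> y * (w (fst p) y * w (snd p) y) \<partial>Q) =
        (\<integral>y. (\<Prod>r\<in>R. indicator T (y r) * (W (fst p, y r) * W (snd p, y r))) \<partial>Q)"
        by (simp add: \<phi>_def w_def prod.distrib)
      also have "\<dots> = codeg_on T (fst p) (snd p) ^ card R"
        unfolding Q_def using R p T
        by (subst Pi.product_integral_prod) (auto simp: codeg_on_def intro!: bdd_integrable bdd)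
      finally show "(\<integral>y. s (fst p) * s (snd p) * (\<phi> y * (w (fst p) y * w (snd p) y)) \<partial>Q) =
        s (fst p) * s (snd p) * codeg_on T (fst p) (snd p) ^ card R"
        by simp
    qed
    finally show ?thesis .
  qed
  \<comment> \<open>The integrated linear term of the tangent at m; it is nonnegative because F^2 is
    at least m on average over T^R.\<close>
  have "0 \<le> real n * m ^ (n - 1) * ((\<integral>y. \<phi> y * (F y)\<^sup>2 \<partial>Q) - m * (\<integral>y. \<phi> y \<partial>Q))"
    using le m unfolding I\<phi> I\<phi>F s_def by (intro mult_nonneg_nonneg) auto
  then  have "prob T ^ card R * m ^ n \<le> m ^ n * (\<integral>y. \<phi> y \<partial>Q)
      + real n * m ^ (n - 1) * ((\<integral>y. \<phi> y * (F y)\<^sup>2 \<partial>Q) - m * (\<integral>y. \<phi> y \<partial>Q))"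
    unfolding I\<phi> mult.commute[of "m ^ n"] by linarith
  also have "\<dots> = (\<integral>y. m ^ n * \<phi> y + real n * m ^ (n - 1) * (\<phi> y * (F y)\<^sup>2 - m * \<phi> y) \<partial>Q)"
  proof -
    have "integrable Q \<phi>" "integrable Q (\<lambda>y. \<phi> y * (F y)\<^sup>2)"
      by (intro Q.bdd_integrable bdd bF b\<phi>[of "\<lambda>y. y"]; simp)+
    then show ?thesis by simp
  qed
  also have "\<dots> \<le> (\<integral>y. A y ^ n * B y ^ n \<partial>Q)"
  proof (intro Q.integral_bdd_mono)
    fix y assume y: "y \<in> space Q"
    have AB0: "0 \<le> A y" "0 \<le> B y"
      unfolding A_def B_def by (intro Bochner_Integration.integral_nonneg mult_nonneg_nonneg w0 C5_at_nonneg)+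
    show "m ^ n * \<phi> y + real n * m ^ (n - 1) * (\<phi> y * (F y)\<^sup>2 - m * \<phi> y) \<le> A y ^ n * B y ^ n"
    proof (cases "\<phi> y = 0")
      case False
      then have "\<phi> y = 1" using \<phi>01 by auto
      then have "m ^ n * \<phi> y + real n * m ^ (n - 1) * (\<phi> y * (F y)\<^sup>2 - m * \<phi> y) \<le> ((F y)\<^sup>2) ^ n"
        using power_ge_tangent[of "(F y)\<^sup>2" m n] m by simp
      also have "\<dots> \<le> (A y * B y) ^ n" using CS[OF y] by (intro power_mono) auto
      finally show ?thesis by (simp add: power_mult_distrib)
    qed (use AB0 in auto)
  qed (intro bdd bA bB bF b\<phi>[of "\<lambda>y. y"]; simp)+
  finally show ?thesis unfolding A_def B_def w_def Q_def .
qed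

end

section \<open>The density of the graph in a kernel\<close>

lemma ends_doubleton: "ends {a, b} = (a, b) \<or> ends {a, b} = (b, a)"
proof -
  have "{a, b} = {fst (ends {a, b}), snd (ends {a, b})}"
    unfolding ends_def by (rule someI[of "\<lambda>p. {a, b} = {fst p, snd p}" "(a, b)"]) simp
  then show ?thesis by (auto simp: doubleton_eq_iff prod_eq_iff)
qed

lemma ends_in_verts:
  assumes "simple_graph H" "e \<in> edges H"
  obtains u v where "ends e = (u, v)" "u \<in> verts H" "v \<in> verts H" "u \<noteq> v"
proof -
  from assms have "e \<subseteq> verts H" "card e = 2" by (auto simp: simple_graph_def nsets_def)
  moreover from \<open>card e = 2\<close> obtain a b where "e = {a, b}" "a \<noteq> b" by (auto simp: card_2_iff)
  ultimately show thesis using that ends_doubleton[of a b] by auto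
qed

lemma finite_edges: "simple_graph H \<Longrightarrow> finite (edges H)"
  unfolding simple_graph_def by (meson finite_imp_finite_nsets finite_subset)

context kernel
begin

lemma W_ends_doubleton: "(case ends {a, b} of (u, v) \<Rightarrow> W (x u, x v)) = W (x a, x b)"
  using ends_doubleton[of a b] W_commute by auto

definition cycle_weight :: "nat \<Rightarrow> (vertex \<Rightarrow> 'a) \<Rightarrow> real" where
  "cycle_weight i x = W (x (Left i), x (Cyc i 0)) * W (x (Cyc i 0), x (Cyc i 1)) *
     W (x (Cyc i 1), x (Cyc i 2)) * W (x (Cyc i 2), x (Cyc i 3)) * W (x (Cyc i 3), x (Left i))"

text \<open>The edges are grouped by their vertex \<open>Left i\<close>, so that the integrand
  becomes a product over blocks.\<close>

lemma prod_edges_K_C5: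
  "(\<Prod>e\<in>edges (K_C5 n). case ends e of (u, v) \<Rightarrow> W (x u, x v)) =
   (\<Prod>i<2 * n. (\<Prod>r\<in>Right ` {..<2 * n}. W (x (Left i), x r)) * (if i < n then cycle_weight i x else 1))"
proof -
  define f where "f = (\<lambda>e. case ends e of (u, v) \<Rightarrow> W (x u, x v))"
  have f: "f {a, b} = W (x a, x b)" for a b unfolding f_def by (rule W_ends_doubleton)
  define B where "B = (\<lambda>(i, j). {Left i, Right j}) ` ({..<2 * n} \<times> {..<2 * n})"
  define C where "C = (\<lambda>i. {{Left i, Cyc i 0}, {Cyc i 0, Cyc i 1}, {Cyc i 1, Cyc i 2},
               {Cyc i 2, Cyc i 3}, {Cyc i 3, Left i}})"
  have "edges (K_C5 n) = B \<union> (\<Union>i<n. C i)"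
    by (auto simp: K_C5_def B_def C_def)
  moreover have "B \<inter> (\<Union>i<n. C i) = {}"
    by (auto simp: B_def C_def doubleton_eq_iff)
  moreover have "finite B" "finite (\<Union>i<n. C i)"
    by (auto simp: B_def C_def)
  ultimately have "prod f (edges (K_C5 n)) = prod f B * prod f (\<Union>i<n. C i)"
    by (simp add: prod.union_disjoint)
  also have "prod f B = (\<Prod>(i, j)\<in>{..<2 * n} \<times> {..<2 * n}. W (x (Left i), x (Right j)))"
    unfolding B_def by (subst prod.reindex) (auto simp: inj_on_def doubleton_eq_iff f split_beta intro!: prod.cong)
  also have "\<dots> = (\<Prod>i<2 * n. \<Prod>r\<in>Right ` {..<2 * n}. W (x (Left i), x r))"
    by (simp add: prod.cartesian_product prod.reindex inj_on_def)
  also have "prod f (\<Union>i<n. C i) = (\<Prod>i<n. prod f (C i))"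
    by (rule prod.UNION_disjoint) (auto simp: C_def doubleton_eq_iff)
  also have "\<dots> = (\<Prod>i<n. cycle_weight i x)"
    by (simp add: C_def doubleton_eq_iff f cycle_weight_def mult.assoc)
  also have "\<dots> = (\<Prod>i<2 * n. if i < n then cycle_weight i x else 1)"
  proof -
    have "{..<2 * n} \<inter> {i. i < n} = {..<n}" by auto
    then show ?thesis by (simp add: prod.If_cases lessThan_def)
  qed
  finally show ?thesis unfolding f_def by (simp add: prod.distrib)
qed

text \<open>Integrating out the neighbours \<open>Cyc i 0\<close> and \<open>Cyc i 3\<close> of the
  root leaves its codegrees with \<open>Cyc i 1\<close> and \<open>Cyc i 2\<close>, which is the
  form of \<open>C5_at\<close>.\<close>

lemma integral_cycle_block:
  fixes i :: nat
  defines "Bl \<equiv> insert (Left i) (Cyc i ` {..<4})"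
  assumes w: "bdd_meas M w"
  shows "(\<integral>z. w (z (Left i)) * cycle_weight i z \<partial>(\<Pi>\<^sub>M j\<in>Bl. M)) = (\<integral>x. C5_at M W x * w x \<partial>M)"
    and "bdd_meas (\<Pi>\<^sub>M j\<in>Bl. M) (\<lambda>z. w (z (Left i)) * cycle_weight i z)"
proof -
  have "Cyc i ` {..<4} = {Cyc i 0, Cyc i 1, Cyc i 2, Cyc i 3}"
    by (simp add: numeral_eq_Suc lessThan_Suc insert_commute)
  \<comment> \<open>The order of the insertions fixes the order of integration: the outermost
    insertion becomes the innermost integral.\<close>
  then have Bl: "Bl = insert (Cyc i 3) (insert (Cyc i 0) (insert (Cyc i 2) (insert (Cyc i 1) {Left i})))"
    unfolding Bl_def by auto
  define f where "f = (\<lambda>z. w (z (Left i)) * cycle_weight i z)"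
  have bf: "bdd_meas (\<Pi>\<^sub>M j\<in>Bl. M) f"
    unfolding f_def cycle_weight_def Bl
    by (intro bdd bdd_comp[OF w] measurable_component_singleton) auto
  then show "bdd_meas (\<Pi>\<^sub>M j\<in>Bl. M) (\<lambda>z. w (z (Left i)) * cycle_weight i z)"
    by (simp add: f_def)
  define G where "G = (\<lambda>x. C5_at M W x * w x)"
  have bG: "bdd_meas M G" unfolding G_def by (intro bdd w) simp
  note 1 = integral_PiM_insert[OF _ _ bf[unfolded Bl], simplified]
  note 2 = integral_PiM_insert[OF _ _ 1(2), simplified]
  note 3 = integral_PiM_insert[OF _ _ 2(2), simplified]
  note 4 = integral_PiM_insert[OF _ _ 3(2), simplified]
  have "(\<integral>z. f z \<partial>(\<Pi>\<^sub>M j\<in>Bl. M)) = (\<integral>z. \<integral>a. \<integral>b. \<integral>c. \<integral>d.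
      f (z(Cyc i 1 := a, Cyc i 2 := b, Cyc i 0 := c, Cyc i 3 := d)) \<partial>M \<partial>M \<partial>M \<partial>M \<partial>(\<Pi>\<^sub>M j\<in>{Left i}. M))"
    unfolding Bl using 1(1) 2(1) 3(1) 4(1) by simp
  also have "\<dots> = (\<integral>z. G (z (Left i)) \<partial>(\<Pi>\<^sub>M j\<in>{Left i}. M))"
  proof (intro Bochner_Integration.integral_cong refl)
    fix z :: "vertex \<Rightarrow> 'a"
    define x where "x = z (Left i)"
    have "(\<integral>c. \<integral>d. f (z(Cyc i 1 := a, Cyc i 2 := b, Cyc i 0 := c, Cyc i 3 := d)) \<partial>M \<partial>M) =
      codeg M W x a * W (a, b) * codeg M W x b * w x" for a b
    proof -
      have "(\<integral>c. \<integral>d. f (z(Cyc i 1 := a, Cyc i 2 := b, Cyc i 0 := c, Cyc i 3 := d)) \<partial>M \<partial>M) =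
        (\<integral>c. \<integral>d. (w x * W (a, b)) * (W (x, c) * W (a, c)) * (W (x, d) * W (b, d)) \<partial>M \<partial>M)"
        unfolding f_def cycle_weight_def by (simp add: x_def[symmetric] W_commute[of _ a] W_commute[of _ x] mult_ac)
      also have "\<dots> = codeg M W x a * W (a, b) * codeg M W x b * w x"
        by (simp only: integral_mult_right_zero integral_mult_left_zero flip: codeg_def) simp
      finally show ?thesis .
    qed
    then show "(\<integral>a. \<integral>b. \<integral>c. \<integral>d. f (z(Cyc i 1 := a, Cyc i 2 := b, Cyc i 0 := c, Cyc i 3 := d)) \<partial>M \<partial>M \<partial>M \<partial>M) =
      G (z (Left i))"
      by (simp add: G_def C5_at_def flip: x_def)
  qed
  also have "\<dots> = (\<integral>x. G x \<partial>M)" by (rule integral_PiM_singleton[OF bG])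
  finally show "(\<integral>z. w (z (Left i)) * cycle_weight i z \<partial>(\<Pi>\<^sub>M j\<in>Bl. M)) = (\<integral>x. C5_at M W x * w x \<partial>M)"
    by (simp add: f_def G_def)
qed

text \<open>Given the images y of the vertices \<open>Right j\<close>, the 2n blocks are
  independent. The n blocks with a cycle contribute the integral weighted by \<open>C5_at\<close>,
  the n others the plain one.\<close>

lemma integral_K_C5:
  fixes n :: nat
  defines "R \<equiv> Right ` {..<2 * n}"
  shows "(\<integral>x. (\<Prod>e\<in>edges (K_C5 n). case ends e of (u, v) \<Rightarrow> W (x u, x v)) \<partial>(\<Pi>\<^sub>M v\<in>verts (K_C5 n). M)) =
    (\<integral>y. (\<integral>x. (\<Prod>r\<in>R. W (x, y r)) \<partial>M) ^ n * (\<integral>x. C5_at M W x * (\<Prod>r\<in>R. W (x, y r)) \<partial>M) ^ n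
      \<partial>(\<Pi>\<^sub>M r\<in>R. M))"
proof -
  define Bl where "Bl = (\<lambda>i. insert (Left i) (if i < n then Cyc i ` {..<4} else {}))"
  define U where "U = (\<Union>i<2 * n. Bl i)"
  have "U = Left ` {..<2 * n} \<union> (\<Union>i<n. Cyc i ` {..<4})"
  proof (intro equalityI subsetI)
    fix v assume "v \<in> Left ` {..<2 * n} \<union> (\<Union>i<n. Cyc i ` {..<4})"
    then consider i where "i < 2 * n" "v = Left i" | i j where "i < n" "j < 4" "v = Cyc i j" by auto
    then show "v \<in> U"
    proof cases
      case 1
      then show ?thesis by (auto simp: U_def Bl_def)
    next
      case 2
      then have "i < 2 * n" "v \<in> Bl i" by (auto simp: Bl_def)
      then show ?thesis by (auto simp: U_def)
    qed
  qed (auto simp: U_def Bl_def split: if_splits)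
  then have verts: "verts (K_C5 n) = R \<union> U"
    unfolding K_C5_def R_def by auto
  have fin: "finite R" "finite U" "\<And>i. finite (Bl i)" and disj: "R \<inter> U = {}"
    by (auto simp: R_def U_def Bl_def split: if_splits)
  define g where "g = (\<lambda>i x. (\<Prod>r\<in>R. W (x (Left i), x r)) * (if i < n then cycle_weight i x else 1))"
  define f where "f = (\<lambda>y i z. (\<Prod>r\<in>R. W (z (Left i), y r)) * (if i < n then cycle_weight i z else 1))"
  interpret V: prob_space "\<Pi>\<^sub>M v\<in>R \<union> U. M" by (rule prob_space_PiM_const)
  have bg: "bdd_meas (\<Pi>\<^sub>M v\<in>R \<union> U. M) (g i)" if "i < 2 * n" for i
  proof -
    have *: "Left i \<in> R \<union> U" "r \<in> R \<Longrightarrow> r \<in> R \<union> U" "i < n \<Longrightarrow> j < 4 \<Longrightarrow> Cyc i j \<in> R \<union> U" for r j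
      using that by (auto simp: U_def Bl_def intro!: bexI[of _ i])
    have "bdd_meas (\<Pi>\<^sub>M v\<in>R \<union> U. M) (\<lambda>x. if i < n then cycle_weight i x else 1)"
    proof (cases "i < n")
      case True
      have "bdd_meas (\<Pi>\<^sub>M v\<in>R \<union> U. M) (cycle_weight i)"
        unfolding cycle_weight_def by (intro bdd measurable_component_singleton * True) simp_all
      then show ?thesis using True by simp
    qed (simp add: bdd)
    then show ?thesis
      unfolding g_def by (intro bdd measurable_component_singleton *)
  qed
  have "(\<integral>x. (\<Prod>e\<in>edges (K_C5 n). case ends e of (u, v) \<Rightarrow> W (x u, x v)) \<partial>(\<Pi>\<^sub>M v\<in>verts (K_C5 n). M)) =
    (\<integral>x. (\<Prod>i<2 * n. g i x) \<partial>(\<Pi>\<^sub>M v\<in>R \<union> U. M))"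
    unfolding prod_edges_K_C5 verts g_def R_def ..
  also have "\<dots> = (\<integral>y. \<integral>z. (\<Prod>i<2 * n. g i (merge R U (y, z))) \<partial>(\<Pi>\<^sub>M v\<in>U. M) \<partial>(\<Pi>\<^sub>M v\<in>R. M))"
    using disj fin bg by (intro Pi.product_integral_fold V.bdd_integrable bdd) auto
  also have "\<dots> = (\<integral>y. (\<integral>x. (\<Prod>r\<in>R. W (x, y r)) \<partial>M) ^ n * (\<integral>x. C5_at M W x * (\<Prod>r\<in>R. W (x, y r)) \<partial>M) ^ n
      \<partial>(\<Pi>\<^sub>M r\<in>R. M))"
  proof (intro Bochner_Integration.integral_cong refl)
    fix y assume "y \<in> space (\<Pi>\<^sub>M r\<in>R. M)"
    then have y: "y r \<in> space M" if "r \<in> R" for r using that by (auto simp: space_PiM)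
    define w where "w = (\<lambda>x. \<Prod>r\<in>R. W (x, y r))"
    have bw: "bdd_meas M w" unfolding w_def using y by (intro bdd) auto
    have f_block: "(\<integral>z. f y i z \<partial>(\<Pi>\<^sub>M v\<in>Bl i. M)) = (if i < n then \<integral>x. C5_at M W x * w x \<partial>M else \<integral>x. w x \<partial>M) \<and>
      bdd_meas (\<Pi>\<^sub>M v\<in>Bl i. M) (f y i)" for i
    proof (cases "i < n")
      case True
      then show ?thesis
        using integral_cycle_block[OF bw, of i] by (simp add: f_def Bl_def w_def)
    next
      case False
      then show ?thesis
        using integral_PiM_singleton[OF bw, of "Left i"] bdd_comp[OF bw measurable_component_singleton[of "Left i" "{Left i}"]]
        by (simp add: f_def Bl_def w_def)
    qed
    have "(\<integral>z. (\<Prod>i<2 * n. g i (merge R U (y, z))) \<partial>(\<Pi>\<^sub>M v\<in>U. M)) =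
      (\<integral>z. (\<Prod>i<2 * n. f y i (restrict z (Bl i))) \<partial>(\<Pi>\<^sub>M v\<in>(\<Union>i<2 * n. Bl i). M))"
      unfolding U_def[symmetric]
    proof (intro Bochner_Integration.integral_cong prod.cong refl)
      fix z i assume i: "i \<in> {..<2 * n}"
      have L: "Left i \<in> U" "Left i \<notin> R" using i by (auto simp: U_def Bl_def R_def)
      have C: "Cyc i j \<in> U" "Cyc i j \<notin> R" "Cyc i j \<in> Bl i" if "i < n" "j < 4" for j
        using that by (auto simp: U_def Bl_def R_def intro!: bexI[of _ i])
      show "g i (merge R U (y, z)) = f y i (restrict z (Bl i))"
        unfolding g_def f_def cycle_weight_def using L C
        by (auto simp: merge_def Bl_def intro!: prod.cong)
    qed
    also have "\<dots> = (\<Prod>i<2 * n. \<integral>z. f y i z \<partial>(\<Pi>\<^sub>M v\<in>Bl i. M))"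
      using fin f_block by (intro integral_PiM_blocks) (auto simp: disjoint_family_on_def Bl_def split: if_splits)
    also have "\<dots> = (\<Prod>i<2 * n. if i < n then \<integral>x. C5_at M W x * w x \<partial>M else \<integral>x. w x \<partial>M)"
      using f_block by simp
    also have "\<dots> = (\<integral>x. w x \<partial>M) ^ n * (\<integral>x. C5_at M W x * w x \<partial>M) ^ n"
    proof -
      have "{..<2 * n} \<inter> {i. i < n} = {..<n}" "{..<2 * n} \<inter> - {i. i < n} = {n..<2 * n}" by auto
      then show ?thesis by (simp add: prod.If_cases mult.commute)
    qed
    finally show "(\<integral>z. (\<Prod>i<2 * n. g i (merge R U (y, z))) \<partial>(\<Pi>\<^sub>M v\<in>U. M)) =
      (\<integral>x. (\<Prod>r\<in>R. W (x, y r)) \<partial>M) ^ n * (\<integral>x. C5_at M W x * (\<Prod>r\<in>R. W (x, y r)) \<partial>M) ^ n"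
      by (simp add: w_def)
  qed
  finally show ?thesis .
qed

end

section \<open>Lebesgue measurable graphons\<close>

text \<open>Agreement almost everywhere with a measurable g makes f measurable for the completion,
  so the completed integral is that of g.\<close>

lemma completion_AE_eq:
  fixes f g :: "'a \<Rightarrow> real"
  assumes g: "g \<in> borel_measurable M" and ae: "AE x in M. f x = g x"
  shows "(\<integral>x. f x \<partial>completion M) = (\<integral>x. g x \<partial>M)"
proof -
  have ae': "AE x in completion M. f x = g x" using ae by (rule AE_completion)
  have g': "g \<in> borel_measurable (completion M)" using g by (rule measurable_completion)
  have "f \<in> borel_measurable (completion M)"
  proof (rule measurableI)
    fix A :: "real set" assume A: "A \<in> sets borel"
    have "AE x in completion M. x \<in> g -` A \<inter> space (completion M) \<longleftrightarrow> x \<in> f -` A \<inter> space (completion M)"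
      using ae' by eventually_elim auto
    then show "f -` A \<inter> space (completion M) \<in> sets (completion M)"
      by (rule completion.in_sets_AE) (use measurable_sets[OF g' A] in auto)
  qed auto
  then have "(\<integral>x. f x \<partial>completion M) = (\<integral>x. g x \<partial>completion M)"
    using g' ae' by (rule integral_cong_AE)
  then show ?thesis using g by (simp add: integral_completion)
qed

definition unit_measure :: "real measure" where
  "unit_measure = restrict_space lborel {0..1}"

lemma space_unit_measure [simp]: "space unit_measure = {0..1}"
  by (simp add: unit_measure_def space_restrict_space)

interpretation unit: pair_space unit_measure
proof -
  have "prob_space unit_measure"
    by (rule prob_spaceI) (simp add: unit_measure_def space_restrict_space emeasure_restrict_space)
  then show "pair_space unit_measure" by (rule pair_space.intro)
qed

text \<open>The restriction acts on each factor separately, so a null set of the plane is passed on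
  through its sections, almost all of which are null. Enlarging it to a measurable null set lets
  Fubini apply in both directions.\<close>

lemma AE_unit_square:
  assumes "AE z in lborel. P z"
  shows "AE z in unit_measure \<Otimes>\<^sub>M unit_measure. P z"
proof -
  obtain N where N: "{z. \<not> P z} \<subseteq> N" "N \<in> null_sets (lborel :: (real \<times> real) measure)"
    using assms by (auto elim!: AE_E simp: null_sets_def)
  then have N': "N \<in> null_sets (lborel \<Otimes>\<^sub>M lborel :: (real \<times> real) measure)" by (simp add: lborel_prod)
  have "AE z in lborel \<Otimes>\<^sub>M lborel. z \<notin> N" using N' by (rule AE_not_in)
  then have "AE x in lborel. AE y in lborel. (x, y) \<notin> N" by (rule lborel_pair.AE_pair)
  then have "AE x in unit_measure. AE y in unit_measure. (x, y) \<notin> N"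
    unfolding unit_measure_def by (auto simp: AE_restrict_space_iff elim!: eventually_mono)
  moreover have id: "(\<lambda>z. z) \<in> unit_measure \<Otimes>\<^sub>M unit_measure \<rightarrow>\<^sub>M lborel \<Otimes>\<^sub>M lborel"
    unfolding unit_measure_def by (rule measurable_pair) (auto intro: measurable_restrict_space1 simp: comp_def
      intro!: measurable_compose[OF measurable_fst] measurable_compose[OF measurable_snd])
  have "{z \<in> space (unit_measure \<Otimes>\<^sub>M unit_measure). z \<notin> N} \<in> sets (unit_measure \<Otimes>\<^sub>M unit_measure)"
  proof -
    have "- N \<in> sets (lborel \<Otimes>\<^sub>M lborel :: (real \<times> real) measure)"
      using N' sets.compl_sets[of N "lborel \<Otimes>\<^sub>M lborel :: (real \<times> real) measure"]
      by (auto simp: space_pair_measure Compl_eq_Diff_UNIV)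
    from measurable_sets[OF id this] show ?thesis by (simp add: vimage_def Int_def conj_commute)
  qed
  ultimately have "AE z in unit_measure \<Otimes>\<^sub>M unit_measure. z \<notin> N"
    using unit.P.AE_pair_measure by auto
  then show ?thesis using N(1) by (auto elim!: eventually_mono)
qed

lemma AE_swap:
  assumes "AE z in unit_measure \<Otimes>\<^sub>M unit_measure. P z"
  shows "AE z in unit_measure \<Otimes>\<^sub>M unit_measure. P (snd z, fst z)"
proof -
  have "AE z in distr (unit_measure \<Otimes>\<^sub>M unit_measure) (unit_measure \<Otimes>\<^sub>M unit_measure) (\<lambda>(x, y). (y, x)). P z"
    by (subst unit.P.distr_pair_swap[symmetric]) (rule assms)
  from AE_distrD[OF _ this] show ?thesis by (simp add: split_beta')
qed

text \<open>Borel measurability is needed because sections of Lebesgue measurable functions need not be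
  measurable, so that iterated integrals could be junk.\<close>

lemma graphon_borel_version:
  assumes "graphon W"
  obtains W' where "kernel unit_measure W'" "AE z in unit_measure \<Otimes>\<^sub>M unit_measure. W z = W' z"
proof -
  let ?S = "{0..1} \<times> {0..1} :: (real \<times> real) set"
  let ?P = "unit_measure \<Otimes>\<^sub>M unit_measure"
  have "W \<in> borel_measurable (lebesgue_on ?S)" using assms by (simp add: graphon_def)
  moreover have "?S \<in> sets lebesgue" by (simp add: borel_closed closed_Times)
  ultimately have "(\<lambda>z. indicator ?S z *\<^sub>R W z) \<in> borel_measurable lebesgue"
    by (subst (asm) borel_measurable_restrict_space_iff) auto
  from completion_ex_borel_measurable_real[OF this]
  obtain g where g: "g \<in> borel_measurable lborel" "AE z in lborel. indicator ?S z *\<^sub>R W z = g z" by auto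
  \<comment> \<open>The Borel function g agrees with W only almost everywhere. Averaging with the
    transpose and clamping to [0,1] enforce symmetry and bounds at every point, and change nothing
    where g agrees with W both at a point of the square and at its mirror image.\<close>
  define W' where "W' = (\<lambda>z. max 0 (min 1 ((g z + g (snd z, fst z)) / 2)))"
  have "AE z in ?P. indicator ?S z *\<^sub>R W z = g z" using g(2) by (rule AE_unit_square)
  moreover have "AE z in ?P. z \<in> ?S"
    by (rule AE_I2) (auto simp: space_pair_measure)
  ultimately have ae: "AE z in ?P. z \<in> ?S \<and> W z = g z"
    by eventually_elim auto
  have sw: "AE z in ?P. (snd z, fst z) \<in> ?S \<and> W (snd z, fst z) = g (snd z, fst z)"
    by (rule AE_swap[OF ae])
  have "W z = W' z" if "z \<in> ?S \<and> W z = g z" "(snd z, fst z) \<in> ?S \<and> W (snd z, fst z) = g (snd z, fst z)" for z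
  proof -
    obtain x y where z: "z = (x, y)" by force
    have xy: "x \<in> {0..1}" "y \<in> {0..1}" using that(1) z by auto
    have "W (x, y) = W (y, x) \<and> 0 \<le> W (x, y) \<and> W (x, y) \<le> 1"
      using assms xy unfolding graphon_def by blast
    then show ?thesis using that by (simp add: W'_def z)
  qed
  then have "AE z in ?P. W z = W' z"
    by (rule eventually_elim2[OF ae sw])
  moreover have "kernel unit_measure W'"
  proof (intro kernel.intro kernel_axioms.intro unit.pair_space_axioms)
    have m: "(\<lambda>z. f z) \<in> ?P \<rightarrow>\<^sub>M borel" if "f \<in> ?P \<rightarrow>\<^sub>M unit_measure" for f
      using that unfolding unit_measure_def by (simp add: measurable_restrict_space2_iff)
    have "(\<lambda>z. (fst z, snd z)) \<in> ?P \<rightarrow>\<^sub>M lborel" "(\<lambda>z. (snd z, fst z)) \<in> ?P \<rightarrow>\<^sub>M lborel"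
      unfolding lborel_prod[symmetric] by (intro measurable_Pair; simp add: m)+
    then have "(\<lambda>z. g (fst z, snd z)) \<in> borel_measurable ?P" "(\<lambda>z. g (snd z, fst z)) \<in> borel_measurable ?P"
      using g(1) by (auto intro: measurable_compose)
    then show "W' \<in> borel_measurable ?P" unfolding W'_def by simp
  qed (auto simp: W'_def add.commute)
  ultimately show thesis using that by blast
qed

text \<open>The two coordinates of an edge are distinct, so their joint law is that of the square
  and the edge factors differ only on a null set; finitely many edges keep it null. A loop would
  evaluate \<open>W\<close> on the diagonal, which is itself a null set.\<close>

lemma hom_density_cong_AE:
  assumes H: "simple_graph H" and f: "f \<in> borel_measurable (unit_measure \<Otimes>\<^sub>M unit_measure)"
    and ae: "AE z in unit_measure \<Otimes>\<^sub>M unit_measure. W z = f z"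
  shows "hom_density H W =
    (\<integral>x. (\<Prod>e\<in>edges H. case ends e of (u, v) \<Rightarrow> f (x u, x v)) \<partial>(\<Pi>\<^sub>M v\<in>verts H. unit_measure))"
  unfolding hom_density_def unit_measure_def[symmetric]
proof (rule completion_AE_eq)
  let ?V = "\<Pi>\<^sub>M v\<in>verts H. unit_measure"
  have fin: "finite (verts H)" using H by (simp add: simple_graph_def)
  have pair: "(\<lambda>x. (x u, x v)) \<in> ?V \<rightarrow>\<^sub>M unit_measure \<Otimes>\<^sub>M unit_measure"
    if "u \<in> verts H" "v \<in> verts H" for u v
    using that by (intro measurable_Pair measurable_component_singleton)
  show "(\<lambda>x. \<Prod>e\<in>edges H. case ends e of (u, v) \<Rightarrow> f (x u, x v)) \<in> borel_measurable ?V"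
  proof (rule borel_measurable_prod)
    fix e assume "e \<in> edges H"
    from ends_in_verts[OF H this] obtain u v where "ends e = (u, v)" "u \<in> verts H" "v \<in> verts H" "u \<noteq> v" .
    then show "(\<lambda>x. case ends e of (u, v) \<Rightarrow> f (x u, x v)) \<in> borel_measurable ?V"
      using measurable_compose[OF pair f] by simp
  qed
  have "AE x in ?V. \<forall>e\<in>edges H. (case ends e of (u, v) \<Rightarrow> W (x u, x v)) = (case ends e of (u, v) \<Rightarrow> f (x u, x v))"
  proof (rule AE_finite_allI[OF finite_edges[OF H]])
    fix e assume "e \<in> edges H"
    from ends_in_verts[OF H this] obtain u v where e: "ends e = (u, v)" "u \<in> verts H" "v \<in> verts H" "u \<noteq> v" .
    have "AE z in distr ?V (unit_measure \<Otimes>\<^sub>M unit_measure) (\<lambda>x. (x u, x v)). W z = f z"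
      by (subst unit.distr_PiM_two_components[OF e(2-4) fin]) (rule ae)
    from AE_distrD[OF pair[OF e(2,3)] this]
    show "AE x in ?V. (case ends e of (u, v) \<Rightarrow> W (x u, x v)) = (case ends e of (u, v) \<Rightarrow> f (x u, x v))"
      using e(1) by simp
  qed
  then show "AE x in ?V. (\<Prod>e\<in>edges H. case ends e of (u, v) \<Rightarrow> W (x u, x v)) =
     (\<Prod>e\<in>edges H. case ends e of (u, v) \<Rightarrow> f (x u, x v))"
    by eventually_elim simp
qed

lemma hom_density_complete_graph_2:
  assumes f: "f \<in> borel_measurable (unit_measure \<Otimes>\<^sub>M unit_measure)"
    and ae: "AE z in unit_measure \<Otimes>\<^sub>M unit_measure. W z = f z"
  shows "hom_density (complete_graph 2) W = (\<integral>z. f z \<partial>(unit_measure \<Otimes>\<^sub>M unit_measure))"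
proof -
  have two: "{..<2} = {0, 1 :: nat}" by auto
  have "[{..<2}]\<^bsup>2\<^esup> = {{..<2 :: nat}}"
    using card_subset_eq[of "{..<2 :: nat}"] by (auto simp: nsets_def)
  then have *: "verts (complete_graph 2) = {..<2}" "edges (complete_graph 2) = {{0, 1}}"
    by (simp_all add: complete_graph_def two)
  obtain u v :: nat where uv: "ends {0, 1 :: nat} = (u, v)" "u \<in> {..<2}" "v \<in> {..<2}" "u \<noteq> v"
    using ends_in_verts[OF simple_graph_complete_graph[of 2], of "{0, 1}"] * by auto
  have "hom_density (complete_graph 2) W = (\<integral>x. f (x u, x v) \<partial>(\<Pi>\<^sub>M v\<in>{..<2}. unit_measure))"
    unfolding hom_density_cong_AE[OF simple_graph_complete_graph f ae] by (simp add: * uv[unfolded One_nat_def])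
  also have "\<dots> = (\<integral>z. f z \<partial>distr (\<Pi>\<^sub>M v\<in>{..<2}. unit_measure) (unit_measure \<Otimes>\<^sub>M unit_measure) (\<lambda>x. (x u, x v)))"
    using uv f by (intro integral_distr[symmetric] measurable_Pair measurable_component_singleton)
  finally show ?thesis by (simp add: unit.distr_PiM_two_components[OF uv(2-4)])
qed

section \<open>Lower bounds for a single kernel\<close>

context kernel
begin

definition K_C5_density :: "nat \<Rightarrow> real" where
  "K_C5_density n = (\<integral>x. (\<Prod>e\<in>edges (K_C5 n). case ends e of (u, v) \<Rightarrow> W (x u, x v))
    \<partial>(\<Pi>\<^sub>M v\<in>verts (K_C5 n). M))"

lemma K_C5_density_nonneg: "0 \<le> K_C5_density n"
  unfolding K_C5_density_def
  by (intro Bochner_Integration.integral_nonneg prod_nonneg) (auto simp: W_nonneg split: prod.split)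

lemma K_C5_density_ge:
  assumes T: "T \<in> events" and m: "0 \<le> m"
    and le: "m * prob T ^ (2 * n) \<le>
      (\<integral>p. sqrt (C5_at M W (fst p)) * sqrt (C5_at M W (snd p)) * codeg_on T (fst p) (snd p) ^ (2 * n) \<partial>(M \<Otimes>\<^sub>M M))"
  shows "prob T ^ (2 * n) * m ^ n \<le> K_C5_density n"
proof -
  have card: "card (Right ` {..<2 * n}) = 2 * n" by (simp add: card_image inj_on_def)
  show ?thesis
    unfolding K_C5_density_def integral_K_C5
    using integral_star_power_ge[of "Right ` {..<2 * n}" T m n] assms unfolding card by simp
qed

lemma K_C5_density_ge_power:
  assumes "density > 0" "0 < \<eta>" "\<eta> \<le> 1" "40 / (\<eta>\<^sup>2 * density ^ 10) \<le> real n"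
    and "\<And>x. x \<in> space M \<Longrightarrow> C5_at M W x < \<eta> \<Longrightarrow> deg M W x \<le> density\<^sup>2 / 3"
  shows "density ^ (4 * n\<^sup>2 + 5 * n) \<le> K_C5_density n"
proof -
  \<comment> \<open>Here T is the whole space and m = d^(4n+5), whose nth power has the number of
    edges as exponent.\<close>
  have "prob (space M) ^ (2 * n) * (density ^ (4 * n + 5)) ^ n \<le> K_C5_density n"
    using weighted_codeg_power_ge[OF assms] density_nonneg
    by (intro K_C5_density_ge) (simp_all add: prob_space codeg_on_space)
  also have "(density ^ (4 * n + 5)) ^ n = density ^ (4 * n\<^sup>2 + 5 * n)"
    by (simp add: algebra_simps power2_eq_square flip: power_mult)
  finally show ?thesis by (simp add: prob_space)
qed

text \<open>Cauchy--Schwarz over the middle vertex: the mass is the integral over \<open>S\<close>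
  of the degrees into \<open>S\<close>, and the second moment of these degrees over \<open>S\<close>
  counts paths of two edges inside \<open>S\<close>.\<close>

lemma mass_square_le:
  assumes S: "S \<in> events"
  shows "(mass M W S)\<^sup>2 \<le>
    prob S * (\<integral>p. indicator S (fst p) * indicator S (snd p) * codeg_on S (fst p) (snd p) \<partial>(M \<Otimes>\<^sub>M M))"
proof -
  interpret Q: pair_prob_space "M \<Otimes>\<^sub>M M" M ..
  define h where "h = (\<lambda>z. \<integral>x. indicator S x * W (z, x) \<partial>M)"
  have bh: "bdd_meas M h" unfolding h_def using S by (intro bdd) auto
  have "mass M W S = (\<integral>z. indicator S z * (indicator S z * h z) \<partial>M)"
    unfolding mass_eq h_def by (intro Bochner_Integration.integral_cong) (auto simp: indicator_def)
  then have "(mass M W S)\<^sup>2 \<le> (\<integral>z. (indicator S z)\<^sup>2 \<partial>M) * (\<integral>z. (indicator S z * h z)\<^sup>2 \<partial>M)"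
    using S bh by (auto intro!: Cauchy_Schwarz_bdd bdd)
  also have "(\<lambda>z. (indicator S z)\<^sup>2 :: real) = indicator S" by (auto simp: indicator_def)
  also have "(\<integral>z. indicator S z \<partial>M) = prob S" by (rule integral_indicator_prob[OF S])
  also have "(\<integral>z. (indicator S z * h z)\<^sup>2 \<partial>M) =
    (\<integral>z. \<integral>p. indicator S (fst p) * indicator S (snd p) * (indicator S z * (W (fst p, z) * W (snd p, z))) \<partial>(M \<Otimes>\<^sub>M M) \<partial>M)"
  proof (intro Bochner_Integration.integral_cong refl)
    fix z assume z: "z \<in> space M"
    have "(\<integral>p. (indicator S (fst p) * W (z, fst p)) * (indicator S (snd p) * W (z, snd p)) \<partial>(M \<Otimes>\<^sub>M M)) = h z * h z"
      unfolding h_def using z S by (intro integral_pair_mult bdd) auto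
    then have "(\<integral>p. indicator S z * ((indicator S (fst p) * W (z, fst p)) * (indicator S (snd p) * W (z, snd p))) \<partial>(M \<Otimes>\<^sub>M M)) =
      indicator S z * (h z * h z)"
      by (simp only: integral_mult_right_zero)
    also have "\<dots> = (indicator S z * h z)\<^sup>2" by (simp add: indicator_def power2_eq_square)
    finally show "(indicator S z * h z)\<^sup>2 =
      (\<integral>p. indicator S (fst p) * indicator S (snd p) * (indicator S z * (W (fst p, z) * W (snd p, z))) \<partial>(M \<Otimes>\<^sub>M M))"
      by (simp only: W_commute[of _ z] mult_ac)
  qed
  also have "\<dots> = (\<integral>p. \<integral>z. indicator S (fst p) * indicator S (snd p) * (indicator S z * (W (fst p, z) * W (snd p, z))) \<partial>M \<partial>(M \<Otimes>\<^sub>M M))"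
    using S by (intro Q.Fubini_integral[unfolded split_beta'] Q.P.bdd_integrable bdd) auto
  also have "\<dots> = (\<integral>p. indicator S (fst p) * indicator S (snd p) * codeg_on S (fst p) (snd p) \<partial>(M \<Otimes>\<^sub>M M))"
    by (simp add: codeg_on_def)
  finally show ?thesis .
qed

text \<open>On S x S the mean of \<open>codeg_on S\<close> is at least a = \<theta>^2 \<mu>. The
  factor \<mu>^(2n) of a^(2n) cancels against \<open>prob T ^ (2 * n)\<close> in the localised bound
  with T = S, so only powers of \<rho> and \<mu> with exponents of order n are lost, while \<theta>
  keeps the exponent 4n^2.\<close>

lemma K_C5_density_ge_rich:
  assumes rich: "rich k \<rho> W" and \<rho>: "\<rho> > 0" and k: "k \<ge> 1"
  shows "\<rho> ^ (5 * n) * ((1 + 1 / (2 * real k)) / real k) ^ (4 * n\<^sup>2) \<le> K_C5_density n"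
proof -
  define \<theta> where "\<theta> = (1 + 1 / (2 * real k)) / real k"
  have \<theta>: "\<theta> > 0" using k unfolding \<theta>_def by (intro divide_pos_pos add_pos_nonneg) auto
  obtain S where S: "S \<in> events" "\<rho> \<le> prob S" "\<And>x. x \<in> S \<Longrightarrow> \<rho> \<le> C5_at M W x"
    "\<theta> * (prob S)\<^sup>2 \<le> mass M W S"
    using rich by (auto simp: rich_def \<theta>_def)
  define \<mu> where "\<mu> = prob S"
  define a where "a = \<theta>\<^sup>2 * \<mu>"
  define A where "A = (\<integral>p. indicator S (fst p) * indicator S (snd p) * codeg_on S (fst p) (snd p) \<partial>(M \<Otimes>\<^sub>M M))"
  have \<mu>: "\<mu> > 0" "\<rho> \<le> \<mu>" using S \<rho> by (auto simp: \<mu>_def)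
  have a0: "a \<ge> 0" using \<mu> by (simp add: a_def)
  have "(\<theta> * \<mu>\<^sup>2)\<^sup>2 \<le> (mass M W S)\<^sup>2" using S \<theta> by (intro power_mono) (auto simp: \<mu>_def)
  also have "\<dots> \<le> \<mu> * A" unfolding \<mu>_def A_def by (rule mass_square_le[OF S(1)])
  finally have "\<mu> * (a * \<mu>\<^sup>2) \<le> \<mu> * A" by (simp add: a_def power2_eq_square mult_ac)
  then have A: "a * \<mu>\<^sup>2 \<le> A" using \<mu> by simp
  let ?K = "\<lambda>p. codeg_on S (fst p) (snd p)"
  let ?i = "\<lambda>p. indicator S (fst p) * indicator S (snd p) :: real"
  have b: "bdd_meas (M \<Otimes>\<^sub>M M) ?i" "bdd_meas (M \<Otimes>\<^sub>M M) (\<lambda>p. ?i p * ?K p)"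
    by (intro bdd S; simp)+
  have Ii: "(\<integral>p. ?i p \<partial>(M \<Otimes>\<^sub>M M)) = \<mu>\<^sup>2"
    using S by (subst integral_pair_mult) (auto simp: \<mu>_def integral_indicator_prob power2_eq_square intro!: bdd)
  \<comment> \<open>One \<rho> comes from the two square roots, and \<rho>^2 bounds \<mu>^2, the
    measure of S x S; this gives m = \<rho>^3 \<theta>^(4n).\<close>
  have "\<rho> ^ 3 * \<theta> ^ (4 * n) * \<mu> ^ (2 * n) = \<rho> * (a ^ (2 * n) * \<rho>\<^sup>2)"
  proof -
    have "a ^ (2 * n) = \<theta> ^ (4 * n) * \<mu> ^ (2 * n)"
      by (simp add: a_def power_mult_distrib flip: power_mult)
    then show ?thesis by (simp add: power3_eq_cube power2_eq_square)
  qed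
  also have "\<dots> \<le> \<rho> * (a ^ (2 * n) * \<mu>\<^sup>2)"
    using \<rho> \<mu> a0 by (intro mult_left_mono power_mono) auto
  also have "\<dots> \<le> \<rho> * (a ^ (2 * n) * \<mu>\<^sup>2 + real (2 * n) * a ^ (2 * n - 1) * (A - a * \<mu>\<^sup>2))"
    using \<rho> A a0 by (intro mult_left_mono) auto
  also have "\<dots> = (\<integral>p. \<rho> * (a ^ (2 * n) * ?i p + real (2 * n) * a ^ (2 * n - 1) * (?i p * ?K p - a * ?i p)) \<partial>(M \<Otimes>\<^sub>M M))"
    using b[THEN P.bdd_integrable] by (simp add: Ii flip: A_def)
  also have "\<dots> \<le> (\<integral>p. sqrt (C5_at M W (fst p)) * sqrt (C5_at M W (snd p)) * ?K p ^ (2 * n) \<partial>(M \<Otimes>\<^sub>M M))"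
  proof (intro P.integral_bdd_mono)
    fix p
    show "\<rho> * (a ^ (2 * n) * ?i p + real (2 * n) * a ^ (2 * n - 1) * (?i p * ?K p - a * ?i p))
      \<le> sqrt (C5_at M W (fst p)) * sqrt (C5_at M W (snd p)) * ?K p ^ (2 * n)"
    proof (cases "fst p \<in> S \<and> snd p \<in> S")
      case True
      have "\<rho> = sqrt \<rho> * sqrt \<rho>" using \<rho> by simp
      also have "\<dots> \<le> sqrt (C5_at M W (fst p)) * sqrt (C5_at M W (snd p))"
        using True S(3) \<rho> C5_at_nonneg by (intro mult_mono) auto
      finally have 1: "\<rho> \<le> sqrt (C5_at M W (fst p)) * sqrt (C5_at M W (snd p))" .
      have "a ^ (2 * n) + real (2 * n) * a ^ (2 * n - 1) * (?K p - a) \<le> ?K p ^ (2 * n)"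
        using a0 codeg_on_nonneg by (intro power_ge_tangent)
      then have "\<rho> * (a ^ (2 * n) + real (2 * n) * a ^ (2 * n - 1) * (?K p - a)) \<le> \<rho> * ?K p ^ (2 * n)"
        using \<rho> by (intro mult_left_mono) auto
      also have "\<dots> \<le> sqrt (C5_at M W (fst p)) * sqrt (C5_at M W (snd p)) * ?K p ^ (2 * n)"
        using 1 codeg_on_nonneg by (intro mult_right_mono) auto
      finally show ?thesis using True by simp
    qed (auto simp: indicator_def C5_at_nonneg codeg_on_nonneg)
  qed (intro bdd S; simp)+
  finally have "\<mu> ^ (2 * n) * (\<rho> ^ 3 * \<theta> ^ (4 * n)) ^ n \<le> K_C5_density n"
    using \<rho> \<theta> S(1) unfolding \<mu>_def by (intro K_C5_density_ge) auto
  moreover have "\<rho> ^ (2 * n) * (\<rho> ^ 3 * \<theta> ^ (4 * n)) ^ n \<le> \<mu> ^ (2 * n) * (\<rho> ^ 3 * \<theta> ^ (4 * n)) ^ n"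
    using \<rho> \<mu> \<theta> by (intro mult_right_mono power_mono) auto
  moreover have "\<rho> ^ (2 * n) * (\<rho> ^ 3 * \<theta> ^ (4 * n)) ^ n = \<rho> ^ (5 * n) * \<theta> ^ (4 * n\<^sup>2)"
    by (simp add: power_mult_distrib power2_eq_square mult_ac flip: power_mult power_add)
  ultimately show ?thesis unfolding \<theta>_def by linarith
qed

end

section \<open>Combining the colours\<close>

lemma sum_power_ge:
  fixes d :: "'i \<Rightarrow> real"
  assumes I: "finite I" "I \<noteq> {}" and d: "\<And>i. i \<in> I \<Longrightarrow> 0 \<le> d i" and e: "e > 0"
  shows "(\<Sum>i\<in>I. d i) ^ e / real (card I) ^ (e - 1) \<le> (\<Sum>i\<in>I. d i ^ e)"
proof -
  define p k where "p = (\<Sum>i\<in>I. d i)" "k = real (card I)"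
  have k: "k > 0" using I by (simp add: p_k_def card_gt_0_iff)
  have p: "p \<ge> 0" unfolding p_k_def by (intro sum_nonneg d)
  have "p ^ e / k ^ (e - 1) = k * (p / k) ^ e"
    using k e by (cases e) (simp_all add: power_divide field_simps)
  \<comment> \<open>The linear parts of the tangents at the mean p / k sum to zero.\<close>
  also have "\<dots> = (\<Sum>i\<in>I. (p / k) ^ e + real e * (p / k) ^ (e - 1) * (d i - p / k))"
    using k unfolding sum.distrib sum_distrib_left[symmetric] sum_subtractf
    by (simp flip: p_k_def)
  also have "\<dots> \<le> (\<Sum>i\<in>I. d i ^ e)"
    using p k d by (intro sum_mono power_ge_tangent) auto
  finally show ?thesis by (simp add: p_k_def)
qed

context pair_space
begin

text \<open>The uncovered weight 1 - \<Sum> W is nonnegative almost everywhere, so its integral over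
  S x S is at most that over the whole square, which is at most \<delta>.\<close>

lemma nearly_fullI:
  assumes I: "finite I" and W: "\<And>i. i \<in> I \<Longrightarrow> kernel M (W i)"
    and le: "AE z in M \<Otimes>\<^sub>M M. (\<Sum>i\<in>I. W i z) \<le> 1"
    and ge: "1 - \<delta> \<le> (\<Sum>i\<in>I. \<integral>z. W i z \<partial>(M \<Otimes>\<^sub>M M))"
  shows "nearly_full \<delta> I W"
  unfolding nearly_full_def
proof
  fix S assume S: "S \<in> events"
  let ?i = "\<lambda>p. indicator S (fst p) * indicator S (snd p) :: real"
  have bW: "bdd_meas (M \<Otimes>\<^sub>M M) (W i)" if "i \<in> I" for i
    using kernel.bdd_W[OF W[OF that]] .
  have bi: "bdd_meas (M \<Otimes>\<^sub>M M) ?i" by (intro bdd S) auto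
  have Ii: "(\<integral>p. ?i p \<partial>(M \<Otimes>\<^sub>M M)) = (prob S)\<^sup>2"
    using S by (subst integral_pair_mult) (auto simp: integral_indicator_prob power2_eq_square intro!: bdd)
  have "(\<integral>p. ?i p - (\<Sum>i\<in>I. ?i p * W i p) \<partial>(M \<Otimes>\<^sub>M M)) \<le> (\<integral>p. 1 - (\<Sum>i\<in>I. W i p) \<partial>(M \<Otimes>\<^sub>M M))"
  proof (rule integral_mono_AE)
    show "AE p in M \<Otimes>\<^sub>M M. ?i p - (\<Sum>i\<in>I. ?i p * W i p) \<le> 1 - (\<Sum>i\<in>I. W i p)"
      using le by eventually_elim (auto simp: indicator_def)
  qed (intro P.bdd_integrable bdd bW bi; simp)+
  also have "(\<integral>p. 1 - (\<Sum>i\<in>I. W i p) \<partial>(M \<Otimes>\<^sub>M M)) = 1 - (\<Sum>i\<in>I. \<integral>z. W i z \<partial>(M \<Otimes>\<^sub>M M))"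
    using bW by (simp add: P.bdd_integrable P.prob_space)
  also have "(\<integral>p. ?i p - (\<Sum>i\<in>I. ?i p * W i p) \<partial>(M \<Otimes>\<^sub>M M)) = (prob S)\<^sup>2 - (\<Sum>i\<in>I. mass M (W i) S)"
  proof -
    have m: "mass M (W i) S = (\<integral>p. ?i p * W i p \<partial>(M \<Otimes>\<^sub>M M))" if "i \<in> I" for i
      using kernel.mass_pair[OF W[OF that] S] .
    have "integrable (M \<Otimes>\<^sub>M M) (\<lambda>p. ?i p * W i p)" if "i \<in> I" for i
      by (intro P.bdd_integrable bdd_mult bi bW that)
    then show ?thesis
      using P.bdd_integrable[OF bi] by (simp add: Ii m)
  qed
  finally show "(prob S)\<^sup>2 - \<delta> \<le> (\<Sum>i\<in>I. mass M (W i) S)" using ge by linarith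
qed

lemma sum_K_C5_density_ge:
  fixes I :: "'i set"
  assumes I: "finite I" "I \<noteq> {}"
  shows "\<exists>N \<delta>. N \<ge> 1 \<and> 0 < \<delta> \<and> \<delta> < 1 \<and> (\<forall>W :: 'i \<Rightarrow> 'a \<times> 'a \<Rightarrow> real.
    (\<forall>i\<in>I. kernel M (W i)) \<longrightarrow> (AE z in M \<Otimes>\<^sub>M M. (\<Sum>i\<in>I. W i z) \<le> 1) \<longrightarrow>
    1 - \<delta> \<le> (\<Sum>i\<in>I. \<integral>z. W i z \<partial>(M \<Otimes>\<^sub>M M)) \<longrightarrow>
    (\<forall>n\<ge>N. (\<Sum>i\<in>I. \<integral>z. W i z \<partial>(M \<Otimes>\<^sub>M M)) ^ (4 * n\<^sup>2 + 5 * n) / real (card I) ^ (4 * n\<^sup>2 + 5 * n - 1)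
      \<le> (\<Sum>i\<in>I. kernel.K_C5_density M (W i) n)))"
proof -
  define k where "k = card I"
  have k: "k \<ge> 1" using I by (simp add: k_def card_gt_0_iff Suc_le_eq)
  \<comment> \<open>Meant for the whole space and J = {i}: a colour of density at most \<epsilon>1
    would be absent, so without rich colours all densities exceed \<epsilon>1.\<close>
  obtain \<epsilon>1 \<rho>1 \<delta>1 where pos1: "\<epsilon>1 > 0" "\<rho>1 > 0" "\<delta>1 > 0" and
    C1: "\<And>(W :: 'i \<Rightarrow> 'a \<times> 'a \<Rightarrow> real) J S.
    (\<forall>i\<in>I. kernel M (W i)) \<Longrightarrow> nearly_full \<delta>1 I W \<Longrightarrow> J \<subseteq> I \<Longrightarrow> J \<noteq> {} \<Longrightarrow> card (I - J) = k - 1 \<Longrightarrow>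
    S \<in> events \<Longrightarrow> 1 \<le> prob S \<Longrightarrow> (\<forall>i\<in>J. mass M (W i) S \<le> \<epsilon>1 * (prob S)\<^sup>2) \<Longrightarrow>
    (\<exists>i\<in>I. rich k \<rho>1 (W i))"
    using rich_of_absent_colour[OF I, of 1 "k - 1"] unfolding k_def by fastforce
  \<comment> \<open>At most d^2/3 for every density d > \<epsilon>1; d^2/3 is the degree permitted
    at points of small 5-cycle density.\<close>
  define \<kappa> where "\<kappa> = \<epsilon>1\<^sup>2 / 3"
  have \<kappa>: "\<kappa> > 0" "\<kappa> / 2 > 0" using pos1 by (auto simp: \<kappa>_def)
  obtain \<epsilon>2 \<rho>2 \<delta>2 where pos2: "\<epsilon>2 > 0" "\<rho>2 > 0" "\<delta>2 > 0" and
    C2: "\<And>(W :: 'i \<Rightarrow> 'a \<times> 'a \<Rightarrow> real) J S.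
    (\<forall>i\<in>I. kernel M (W i)) \<Longrightarrow> nearly_full \<delta>2 I W \<Longrightarrow> J \<subseteq> I \<Longrightarrow> J \<noteq> {} \<Longrightarrow> card (I - J) = k - 1 \<Longrightarrow>
    S \<in> events \<Longrightarrow> \<kappa> / 2 \<le> prob S \<Longrightarrow> (\<forall>i\<in>J. mass M (W i) S \<le> \<epsilon>2 * (prob S)\<^sup>2) \<Longrightarrow>
    (\<exists>i\<in>I. rich k \<rho>2 (W i))"
    using rich_of_absent_colour[OF I \<kappa>(2), of "k - 1"] unfolding k_def by fastforce
  \<comment> \<open>A point with c(x) < \<eta> and degree at least \<kappa> has a neighbourhood of
    measure at least \<kappa>/2 and mass at most \<epsilon>2 (\<kappa>/2)^2, on which its colour
    counts as absent.\<close>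
  define \<eta> where "\<eta> = min 1 ((\<kappa> / 2)\<^sup>2 * ((\<epsilon>2 * (\<kappa> / 2)\<^sup>2) ^ 3 / 32))"
  define \<rho> where "\<rho> = min \<rho>1 \<rho>2"
  define \<delta> where "\<delta> = Min {\<delta>1, \<delta>2, 1 / 2}"
  have pos: "0 < \<eta>" "\<eta> \<le> 1" "0 < \<rho>" "0 < \<delta>" "\<delta> < 1" "\<delta> \<le> \<delta>1" "\<delta> \<le> \<delta>2" "\<rho> \<le> \<rho>1" "\<rho> \<le> \<rho>2"
    using pos1 pos2 \<kappa> by (auto simp: \<eta>_def \<rho>_def \<delta>_def)
  \<comment> \<open>b / k is the share demanded by \<open>rich\<close>. As b > 1, some power of b
    outweighs the loss \<rho>^5, and this determines N1.\<close>
  define b where "b = 1 + 1 / (2 * real k)"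
  have b: "b > 1" using k by (simp add: b_def)
  obtain N1 where N1: "1 / \<rho> ^ 5 < b ^ N1" using real_arch_pow[OF b] by blast
  obtain N2 :: nat where N2: "40 / (\<eta>\<^sup>2 * \<epsilon>1 ^ 10) \<le> real N2" using real_arch_simple by blast
  define N where "N = Max {1, N1, N2}"
  have N: "1 \<le> N" "N1 \<le> N" "N2 \<le> N" by (auto simp: N_def)
  show ?thesis
  proof (rule exI[of _ N], rule exI[of _ \<delta>], intro conjI allI impI, rule N, rule pos, rule pos)
    fix W :: "'i \<Rightarrow> 'a \<times> 'a \<Rightarrow> real" and n
    assume ker: "\<forall>i\<in>I. kernel M (W i)" and le: "AE z in M \<Otimes>\<^sub>M M. (\<Sum>i\<in>I. W i z) \<le> 1"
      and ge: "1 - \<delta> \<le> (\<Sum>i\<in>I. \<integral>z. W i z \<partial>(M \<Otimes>\<^sub>M M))" and n: "N \<le> n"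
    define e where "e = 4 * n\<^sup>2 + 5 * n"
    define p where "p = (\<Sum>i\<in>I. \<integral>z. W i z \<partial>(M \<Otimes>\<^sub>M M))"
    have full: "nearly_full \<delta> I W" using nearly_fullI[OF I(1) _ le ge] ker by auto
    note full1 = nearly_full_mono[OF full pos(6)] and full2 = nearly_full_mono[OF full pos(7)]
    have e: "4 * n\<^sup>2 \<le> e - 1" "e > 0" using n N by (auto simp: e_def)
    have p0: "0 \<le> p" unfolding p_def
      using kernel.W_nonneg ker by (intro sum_nonneg Bochner_Integration.integral_nonneg) blast
    have p1: "p \<le> 1"
    proof -
      have "p = (\<integral>z. (\<Sum>i\<in>I. W i z) \<partial>(M \<Otimes>\<^sub>M M))"
        unfolding p_def using kernel.bdd_W ker P.bdd_integrable by (subst Bochner_Integration.integral_sum) blast+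
      also have "\<dots> \<le> (\<integral>z. 1 \<partial>(M \<Otimes>\<^sub>M M))"
        using le kernel.bdd_W ker by (intro integral_mono_AE P.bdd_integrable bdd) blast+
      finally show ?thesis by (simp add: P.prob_space)
    qed
    have dens0: "0 \<le> kernel.K_C5_density M (W i) n" if "i \<in> I" for i
      using kernel.K_C5_density_nonneg ker that by blast
    show "p ^ (4 * n\<^sup>2 + 5 * n) / real (card I) ^ (4 * n\<^sup>2 + 5 * n - 1) \<le> (\<Sum>i\<in>I. kernel.K_C5_density M (W i) n)"
      unfolding e_def[symmetric] k_def[symmetric]
    proof (cases "\<exists>i\<in>I. rich k \<rho> (W i)")
      case True
      then obtain i where i: "i \<in> I" "rich k \<rho> (W i)" by auto
      interpret kernel M "W i" using ker i by auto
      have "1 \<le> \<rho> ^ 5 * b ^ (4 * n)"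
      proof -
        have "b ^ N1 \<le> b ^ (4 * n)" using b n N by (intro power_increasing) auto
        with N1 have "1 / \<rho> ^ 5 \<le> b ^ (4 * n)" by linarith
        then show ?thesis using pos by (simp add: field_simps)
      qed
      then have "1 \<le> (\<rho> ^ 5 * b ^ (4 * n)) ^ n" by (rule one_le_power)
      also have "\<dots> = \<rho> ^ (5 * n) * b ^ (4 * n\<^sup>2)"
        by (simp add: power_mult_distrib power2_eq_square mult_ac flip: power_mult)
      finally have 1: "1 \<le> \<rho> ^ (5 * n) * b ^ (4 * n\<^sup>2)" .
      \<comment> \<open>As p <= 1 and the exponent of k is at least 4n^2, the target is at most
        k^(-4n^2), which the rich colour reaches alone.\<close>
      have "p ^ e / real k ^ (e - 1) \<le> 1 / real k ^ (4 * n\<^sup>2)"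
        using p0 p1 k e by (intro frac_le power_le_one power_increasing) auto
      also have "\<dots> \<le> \<rho> ^ (5 * n) * b ^ (4 * n\<^sup>2) / real k ^ (4 * n\<^sup>2)"
        using 1 by (intro divide_right_mono) auto
      also have "\<dots> = \<rho> ^ (5 * n) * (b / real k) ^ (4 * n\<^sup>2)" by (simp add: power_divide)
      also have "\<dots> \<le> K_C5_density n"
        unfolding b_def by (rule K_C5_density_ge_rich[OF i(2) pos(3) k])
      also have "\<dots> \<le> (\<Sum>i\<in>I. kernel.K_C5_density M (W i) n)"
        using I i dens0 by (intro member_le_sum) auto
      finally show "p ^ e / real k ^ (e - 1) \<le> (\<Sum>i\<in>I. kernel.K_C5_density M (W i) n)" .
    next
      case False
      then have not_rich: "\<not> (\<exists>i\<in>I. rich k \<rho>1 (W i))" "\<not> (\<exists>i\<in>I. rich k \<rho>2 (W i))"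
        using rich_mono pos by blast+
      have "(\<integral>z. W i z \<partial>(M \<Otimes>\<^sub>M M)) ^ e \<le> kernel.K_C5_density M (W i) n" if i: "i \<in> I" for i
      proof -
        interpret kernel M "W i" using ker i by auto
        have J: "{i} \<subseteq> I" "{i} \<noteq> {}" "card (I - {i}) = k - 1"
          using i I by (auto simp: k_def card_Diff_singleton)
        have d1: "\<epsilon>1 < density"
        proof (rule ccontr)
          assume "\<not> ?thesis"
          then have "\<forall>j\<in>{i}. mass M (W j) (space M) \<le> \<epsilon>1 * (prob (space M))\<^sup>2"
            by (simp add: mass_space prob_space)
          from C1[OF ker full1 J sets.top _ this] not_rich show False by (simp add: prob_space)
        qed
        have "density ^ e \<le> K_C5_density n"
          unfolding e_def
        proof (rule K_C5_density_ge_power[OF _ pos(1,2)])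
          show "0 < density" using d1 pos1 by linarith
          have "\<epsilon>1 ^ 10 \<le> density ^ 10" using d1 pos1 by (intro power_mono) auto
          then have "40 / (\<eta>\<^sup>2 * density ^ 10) \<le> 40 / (\<eta>\<^sup>2 * \<epsilon>1 ^ 10)"
            using pos pos1 d1 by (intro divide_left_mono mult_left_mono mult_pos_pos) auto
          also have "\<dots> \<le> real n" using N2 N n by linarith
          finally show "40 / (\<eta>\<^sup>2 * density ^ 10) \<le> real n" .
        next
          fix x assume x: "x \<in> space M" "C5_at M (W i) x < \<eta>"
          show "deg M (W i) x \<le> density\<^sup>2 / 3"
          proof (rule ccontr)
            assume "\<not> ?thesis"
            moreover have "\<kappa> \<le> density\<^sup>2 / 3"
              unfolding \<kappa>_def using d1 pos1 by (intro divide_right_mono power_mono) auto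
            ultimately have "\<kappa> \<le> deg M (W i) x" by simp
            also have "deg M (W i) x = (\<integral>y. indicator (space M) y * W i (x, y) \<partial>M)"
              unfolding deg_def by (intro Bochner_Integration.integral_cong) auto
            finally obtain T where T: "T \<in> events" "\<kappa> / 2 \<le> prob T"
              "(\<kappa> / 2)\<^sup>2 * (mass M (W i) T ^ 3 / 32) \<le> C5_at M (W i) x"
              using ex_sparse_neighbourhood[OF x(1) sets.top \<kappa>(1)] by blast
            have "mass M (W i) T \<le> \<epsilon>2 * (\<kappa> / 2)\<^sup>2"
            proof (rule ccontr)
              assume "\<not> ?thesis"
              then have "(\<epsilon>2 * (\<kappa> / 2)\<^sup>2) ^ 3 \<le> mass M (W i) T ^ 3"
                using pos2 by (intro power_mono) auto
              then have "(\<kappa> / 2)\<^sup>2 * ((\<epsilon>2 * (\<kappa> / 2)\<^sup>2) ^ 3 / 32) \<le> (\<kappa> / 2)\<^sup>2 * (mass M (W i) T ^ 3 / 32)"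
                by (intro mult_left_mono divide_right_mono) auto
              with T(3) x(2) show False by (simp add: \<eta>_def)
            qed
            also have "\<dots> \<le> \<epsilon>2 * (prob T)\<^sup>2"
              using T \<kappa> pos2 by (intro mult_left_mono power_mono) auto
            finally have "\<forall>j\<in>{i}. mass M (W j) T \<le> \<epsilon>2 * (prob T)\<^sup>2" by simp
            from C2[OF ker full2 J T(1,2) this] not_rich show False by simp
          qed
        qed
        then show ?thesis by (simp add: integral_W)
      qed
      then have "(\<Sum>i\<in>I. (\<integral>z. W i z \<partial>(M \<Otimes>\<^sub>M M)) ^ e) \<le> (\<Sum>i\<in>I. kernel.K_C5_density M (W i) n)"
        by (intro sum_mono)
      moreover have "p ^ e / real k ^ (e - 1) \<le> (\<Sum>i\<in>I. (\<integral>z. W i z \<partial>(M \<Otimes>\<^sub>M M)) ^ e)"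
        unfolding p_def k_def using e kernel.W_nonneg ker
        by (intro sum_power_ge I Bochner_Integration.integral_nonneg) blast+
      ultimately show "p ^ e / real k ^ (e - 1) \<le> (\<Sum>i\<in>I. kernel.K_C5_density M (W i) n)" by linarith
    qed
  qed
qed

end

theorem theorem15:
  fixes k :: nat
  assumes "k \<ge> 1"
  shows "\<exists>n\<^sub>k::nat. \<exists>\<delta>\<^sub>k::real. n\<^sub>k \<ge> 1 \<and> 0 < \<delta>\<^sub>k \<and> \<delta>\<^sub>k < 1 \<and>
    (\<forall>W :: nat \<Rightarrow> real \<times> real \<Rightarrow> real.
       (\<forall>i\<in>{1..k}. graphon (W i)) \<longrightarrow>
       (\<forall>p\<in>{0..1} \<times> {0..1}. (\<Sum>i\<in>{1..k}. W i p) \<le> 1) \<longrightarrow>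
       hom_density (complete_graph 2) (\<lambda>p. \<Sum>i\<in>{1..k}. W i p) \<ge> 1 - \<delta>\<^sub>k \<longrightarrow>
       (\<forall>n\<ge>n\<^sub>k.
          (\<Sum>i\<in>{1..k}. hom_density (K_C5 n) (W i)) \<ge>
            hom_density (complete_graph 2) (\<lambda>p. \<Sum>i\<in>{1..k}. W i p) ^ (4 * n\<^sup>2 + 5 * n) /
            real k ^ (4 * n\<^sup>2 + 5 * n - 1)))"
proof -
  let ?I = "{1..k}" and ?P = "unit_measure \<Otimes>\<^sub>M unit_measure"
  have "finite ?I" "?I \<noteq> {}" using assms by auto
  from unit.sum_K_C5_density_ge[OF this] obtain N \<delta> where N: "N \<ge> 1" "0 < \<delta>" "\<delta> < 1" and
    main: "\<And>W n. (\<forall>i\<in>?I. kernel unit_measure (W i)) \<Longrightarrow> (AE z in ?P. (\<Sum>i\<in>?I. W i z) \<le> 1) \<Longrightarrow>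
    1 - \<delta> \<le> (\<Sum>i\<in>?I. \<integral>z. W i z \<partial>?P) \<Longrightarrow> n \<ge> N \<Longrightarrow>
    (\<Sum>i\<in>?I. \<integral>z. W i z \<partial>?P) ^ (4 * n\<^sup>2 + 5 * n) / real (card ?I) ^ (4 * n\<^sup>2 + 5 * n - 1)
      \<le> (\<Sum>i\<in>?I. kernel.K_C5_density unit_measure (W i) n)"
    by blast
  show ?thesis
  proof (rule exI[of _ N], rule exI[of _ \<delta>], intro conjI allI impI, rule N, rule N, rule N)
    fix W :: "nat \<Rightarrow> real \<times> real \<Rightarrow> real" and n
    assume W: "\<forall>i\<in>?I. graphon (W i)" and le: "\<forall>p\<in>{0..1} \<times> {0..1}. (\<Sum>i\<in>?I. W i p) \<le> 1"
      and ge: "1 - \<delta> \<le> hom_density (complete_graph 2) (\<lambda>p. \<Sum>i\<in>?I. W i p)" and n: "N \<le> n"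
    \<comment> \<open>Densities do not see null sets, so each graphon may be replaced by a Borel
      version.\<close>
    have "\<forall>i\<in>?I. \<exists>V. kernel unit_measure V \<and> (AE z in ?P. W i z = V z)"
      using W graphon_borel_version by metis
    then obtain V where V: "\<And>i. i \<in> ?I \<Longrightarrow> kernel unit_measure (V i)"
      "\<And>i. i \<in> ?I \<Longrightarrow> AE z in ?P. W i z = V i z"
      by metis
    have meas: "V i \<in> borel_measurable ?P" if "i \<in> ?I" for i
      using kernel.W_measurable[OF V(1)[OF that]] .
    have "AE z in ?P. \<forall>i\<in>?I. W i z = V i z"
      by (intro AE_finite_allI V) auto
    then have sum_eq: "AE z in ?P. (\<Sum>i\<in>?I. W i z) = (\<Sum>i\<in>?I. V i z)"
      by eventually_elim (rule sum.cong; simp)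
    have "hom_density (complete_graph 2) (\<lambda>p. \<Sum>i\<in>?I. W i p) = (\<integral>z. (\<Sum>i\<in>?I. V i z) \<partial>?P)"
      using meas by (intro hom_density_complete_graph_2 sum_eq borel_measurable_sum)
    also have "\<dots> = (\<Sum>i\<in>?I. \<integral>z. V i z \<partial>?P)"
      using unit.P.bdd_integrable[OF kernel.bdd_W[OF V(1)]] by (intro Bochner_Integration.integral_sum)
    finally have K2: "hom_density (complete_graph 2) (\<lambda>p. \<Sum>i\<in>?I. W i p) = (\<Sum>i\<in>?I. \<integral>z. V i z \<partial>?P)" .
    have "hom_density (K_C5 n) (W i) = kernel.K_C5_density unit_measure (V i) n" if "i \<in> ?I" for i
      using hom_density_cong_AE[OF simple_graph_K_C5 meas[OF that] V(2)[OF that]]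
        kernel.K_C5_density_def[OF V(1)[OF that]] by simp
    then have "(\<Sum>i\<in>?I. hom_density (K_C5 n) (W i)) = (\<Sum>i\<in>?I. kernel.K_C5_density unit_measure (V i) n)"
      by (rule sum.cong[OF refl])
    moreover have "AE z in ?P. z \<in> {0..1} \<times> {0..1}"
      by (rule AE_I2) (auto simp: space_pair_measure)
    with sum_eq have "AE z in ?P. (\<Sum>i\<in>?I. V i z) \<le> 1"
      by eventually_elim (metis le)
    ultimately show "hom_density (complete_graph 2) (\<lambda>p. \<Sum>i\<in>?I. W i p) ^ (4 * n\<^sup>2 + 5 * n) /
        real k ^ (4 * n\<^sup>2 + 5 * n - 1) \<le> (\<Sum>i\<in>?I. hom_density (K_C5 n) (W i))"
      using main[of V n] V(1) ge n unfolding K2 by simp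
  qed
qed

end
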